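(* Let $n\ge1$, let $E$ be a left $A$-module and let $C^n\colon J^{n-1}_dE\to J^n_dE$ be an $n$-connection on $E$. The curvature $R_{C^n}$ vanishes if and only if the map $J^1_d(C^n)\circ l^n_{d,E}\circ C^n\colon J^{n-1}_dE\to J^1_dJ^n_dE$ has image in $J^{n+1}_dE\subseteq J^1_dJ^n_dE$.
   Context: **Setting.** $\Bbbk$ is a commutative unital ring, $A$ an associative unital $\Bbbk$-algebra, $\otimes=\otimes_\Bbbk$. $(\Omega^\bullet_d,\wedge,d)$ is an exterior algebra over $A$: a differential graded $\Bbbk$-algebra with $\Omega^0_d=A$, generated by $A$ and $dA$ (each $\Omega^k_d$ is spanned by elements $a_0da_1\wedge\dots\wedge da_k$), $d$ satisfying the graded Leibniz rule. $\Omega^k_dE=\Omega^k_d\otimes_AE$. **1-jets.** $J^1_dE=(A\otimes E)/\{\sum_ia_i\otimes e_i:\sum_ia_ie_i=0,\ \sum_ida_i\otimes_Ae_i=0\}$, with $a[b\otimes e]=[ab\otimes e]$, functorial in $E$ via $[a\otimes e]\mapsto[a\otimes f(e)]$; $\pi^{1,0}_{d,E}([a\otimes e])=ae$. **Holonomic jets.** Define $D^I_E\colon J^1_dJ^1_dE\to\Omega^1_dE$, $[a\otimes[c\otimes e]]\mapsto a\,dc\otimes_Ae$, and $D^{II}_E\colon J^1_dJ^1_dE\to\Omega^2_dE$, $[a\otimes[c\otimes e]]\mapsto da\wedge dc\otimes_Ae$. Put $J^0_dE=E$, $l^1=\mathrm{id}$, and for $n\ge2$ let $l^n_{d,E}\colon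 J^n_dE\hookrightarrow J^1_dJ^{n-1}_dE$ be the inclusion of the left $A$-submodule of those $x$ such that both $D^I_{J^{n-2}_dE}$ and $D^{II}_{J^{n-2}_dE}$ vanish on $J^1_d(l^{n-1}_{d,E})(x)$. $\pi^{n,n-1}_{d,E}=\pi^{1,0}_{d,J^{n-1}_dE}\circ l^n_{d,E}$. **$n$-connections and curvature.** An $n$-connection on $E$ is a left $A$-linear map $C^n\colon J^{n-1}_dE\to J^n_dE$ with $\pi^{n,n-1}_{d,E}\circ C^n=\mathrm{id}$. Its curvature is $$R_{C^n}:=-D^{II}_{J^{n-1}_dE}\circ J^1_d(l^n_{d,E})\circ J^1_d(C^n)\circ l^n_{d,E}\circ C^n\colon J^{n-1}_dE\to\Omega^2_dJ^{n-1}_dE.$$ *)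

theory Defs
  imports "HOL-Algebra.Module" "HOL-Algebra.AbelCoset" "HOL-Algebra.Free_Abelian_Groups"
begin

text \<open>The library's \<open>module\<close> and \<open>algebra\<close> require a commutative scalar ring, respectively a
  commutative algebra, so the noncommutative versions are introduced here.  As in the library,
  a module is a record of type \<open>module\<close> whose ring fields \<open>mult\<close> and \<open>one\<close> carry no meaning.\<close>

locale left_module = R?: ring R + M?: abelian_group M
  for R :: "('a, 'p) ring_scheme" (structure)
    and M :: "('a, 'm, 'q) module_scheme" (structure) +
  assumes lsmult_closed: "\<lbrakk>a \<in> carrier R; x \<in> carrier M\<rbrakk> \<Longrightarrow> a \<odot>\<^bsub>M\<^esub> x \<in> carrier M"
    and lsmult_l_distr: "\<lbrakk>a \<in> carrier R; b \<in> carrier R; x \<in> carrier M\<rbrakk> \<Longrightarrow>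
      (a \<oplus>\<^bsub>R\<^esub> b) \<odot>\<^bsub>M\<^esub> x = a \<odot>\<^bsub>M\<^esub> x \<oplus>\<^bsub>M\<^esub> b \<odot>\<^bsub>M\<^esub> x"
    and lsmult_r_distr: "\<lbrakk>a \<in> carrier R; x \<in> carrier M; y \<in> carrier M\<rbrakk> \<Longrightarrow>
      a \<odot>\<^bsub>M\<^esub> (x \<oplus>\<^bsub>M\<^esub> y) = a \<odot>\<^bsub>M\<^esub> x \<oplus>\<^bsub>M\<^esub> a \<odot>\<^bsub>M\<^esub> y"
    and lsmult_assoc: "\<lbrakk>a \<in> carrier R; b \<in> carrier R; x \<in> carrier M\<rbrakk> \<Longrightarrow>
      (a \<otimes>\<^bsub>R\<^esub> b) \<odot>\<^bsub>M\<^esub> x = a \<odot>\<^bsub>M\<^esub> (b \<odot>\<^bsub>M\<^esub> x)"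
    and lsmult_one: "x \<in> carrier M \<Longrightarrow> \<one>\<^bsub>R\<^esub> \<odot>\<^bsub>M\<^esub> x = x"

definition left_linear ::
  "('a, 'p) ring_scheme \<Rightarrow> ('a, 'm) module \<Rightarrow> ('a, 'n) module \<Rightarrow> ('m \<Rightarrow> 'n) set" where
  "left_linear R M N = {f \<in> hom (add_monoid M) (add_monoid N).
     \<forall>a\<in>carrier R. \<forall>x\<in>carrier M. f (a \<odot>\<^bsub>M\<^esub> x) = a \<odot>\<^bsub>N\<^esub> f x}"

locale associative_algebra = module K B + B: ring B
  for K (structure) and B (structure) +
  assumes smult_mult_left: "\<lbrakk>k \<in> carrier K; x \<in> carrier B; y \<in> carrier B\<rbrakk> \<Longrightarrow>
      k \<odot>\<^bsub>B\<^esub> (x \<otimes>\<^bsub>B\<^esub> y) = (k \<odot>\<^bsub>B\<^esub> x) \<otimes>\<^bsub>B\<^esub> y"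
    and smult_mult_right: "\<lbrakk>k \<in> carrier K; x \<in> carrier B; y \<in> carrier B\<rbrakk> \<Longrightarrow>
      k \<odot>\<^bsub>B\<^esub> (x \<otimes>\<^bsub>B\<^esub> y) = x \<otimes>\<^bsub>B\<^esub> (k \<odot>\<^bsub>B\<^esub> y)"


section \<open>Exterior algebras\<close>

text \<open>A differential graded algebra is its total algebra, the product being the wedge product,
  together with the homogeneous components \<open>grade \<Omega> p\<close> and the differential \<open>diff \<Omega>\<close>.\<close>

record ('k, 'w) dga = "('k, 'w) module" +
  grade :: "nat \<Rightarrow> 'w set"
  diff :: "'w \<Rightarrow> 'w"

locale dg_algebra = associative_algebra K \<Omega>
  for K :: "'k ring" and \<Omega> :: "('k, 'w) dga" +
  assumes grade_submodule: "submodule (grade \<Omega> p) K \<Omega>"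
    and grade_direct_sum: "w \<in> carrier \<Omega> \<Longrightarrow>
      \<exists>!f. (\<forall>p. f p \<in> grade \<Omega> p) \<and> finite {p. f p \<noteq> \<zero>\<^bsub>\<Omega>\<^esub>} \<and>
           (\<Oplus>\<^bsub>\<Omega>\<^esub>p\<in>{p. f p \<noteq> \<zero>\<^bsub>\<Omega>\<^esub>}. f p) = w"
    and grade_one: "\<one>\<^bsub>\<Omega>\<^esub> \<in> grade \<Omega> 0"
    and grade_mult: "\<lbrakk>v \<in> grade \<Omega> p; w \<in> grade \<Omega> q\<rbrakk> \<Longrightarrow> v \<otimes>\<^bsub>\<Omega>\<^esub> w \<in> grade \<Omega> (p + q)"
    and diff_grade: "w \<in> grade \<Omega> p \<Longrightarrow> diff \<Omega> w \<in> grade \<Omega> (Suc p)"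
    and diff_hom: "diff \<Omega> \<in> hom (add_monoid \<Omega>) (add_monoid \<Omega>)"
    and diff_smult: "\<lbrakk>k \<in> carrier K; w \<in> carrier \<Omega>\<rbrakk> \<Longrightarrow>
      diff \<Omega> (k \<odot>\<^bsub>\<Omega>\<^esub> w) = k \<odot>\<^bsub>\<Omega>\<^esub> diff \<Omega> w"
    and diff_diff: "w \<in> carrier \<Omega> \<Longrightarrow> diff \<Omega> (diff \<Omega> w) = \<zero>\<^bsub>\<Omega>\<^esub>"
    and Leibniz: "\<lbrakk>v \<in> grade \<Omega> p; w \<in> carrier \<Omega>\<rbrakk> \<Longrightarrow>
      diff \<Omega> (v \<otimes>\<^bsub>\<Omega>\<^esub> w) =
        diff \<Omega> v \<otimes>\<^bsub>\<Omega>\<^esub> w \<oplus>\<^bsub>\<Omega>\<^esub> ((\<ominus>\<^bsub>\<Omega>\<^esub> \<one>\<^bsub>\<Omega>\<^esub>) [^]\<^bsub>\<Omega>\<^esub> p) \<otimes>\<^bsub>\<Omega>\<^esub> (v \<otimes>\<^bsub>\<Omega>\<^esub> diff \<Omega> w)"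

text \<open>The condition \<open>\<Omega>\<^sup>0 = A\<close> is literal: \<open>A\<close> is the degree-zero subalgebra of \<open>\<Omega>\<close>.  Since \<open>A\<close>
  absorbs scalars from \<open>K\<close>, the additive span used in \<open>grade_spanned\<close> is also the linear span.\<close>

locale exterior_algebra = dg_algebra K \<Omega> + A: associative_algebra K A
  for K :: "'k ring" and A :: "('k, 'w) module" and \<Omega> :: "('k, 'w) dga" +
  assumes degree_zero: "A = \<lparr>carrier = grade \<Omega> 0, monoid.mult = monoid.mult \<Omega>, monoid.one = monoid.one \<Omega>,
      ring.zero = ring.zero \<Omega>, add = add \<Omega>, smult = smult \<Omega>\<rparr>"
    and grade_spanned: "grade \<Omega> p = generate (add_monoid \<Omega>)
      {a \<otimes>\<^bsub>\<Omega>\<^esub> foldr (\<lambda>b w. diff \<Omega> b \<otimes>\<^bsub>\<Omega>\<^esub> w) bs \<one>\<^bsub>\<Omega>\<^esub> | a bs.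
        a \<in> carrier A \<and> set bs \<subseteq> carrier A \<and> length bs = p}"

definition forms :: "('k, 'w) dga \<Rightarrow> nat \<Rightarrow> ('w, 'w) module" where
  "forms \<Omega> p = \<lparr>carrier = grade \<Omega> p, monoid.mult = monoid.mult \<Omega>, monoid.one = monoid.one \<Omega>,
     ring.zero = ring.zero \<Omega>, add = add \<Omega>, smult = monoid.mult \<Omega>\<rparr>"


section \<open>Tensor products and quotients\<close>

text \<open>\<open>tensor S ra la M N\<close> is the tensor product of \<open>M\<close> and \<open>N\<close> over the scalars \<open>S\<close>, acting by
  \<open>ra\<close> from the right on \<open>M\<close> and by \<open>la\<close> from the left on \<open>N\<close>; it is the quotient of the free
  abelian group on \<open>M \<times> N\<close>.  The module structure is the one coming from the left action
  \<open>smult M\<close> on the first factor.\<close>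

definition tensor_relations ::
  "'s set \<Rightarrow> ('m \<Rightarrow> 's \<Rightarrow> 'm) \<Rightarrow> ('s \<Rightarrow> 'n \<Rightarrow> 'n) \<Rightarrow> ('b, 'm) module \<Rightarrow> ('c, 'n) module
    \<Rightarrow> (('m \<times> 'n) \<Rightarrow>\<^sub>0 int) set" where
  "tensor_relations S ra la M N =
     {frag_of (x \<oplus>\<^bsub>M\<^esub> x', y) - frag_of (x, y) - frag_of (x', y) | x x' y.
        x \<in> carrier M \<and> x' \<in> carrier M \<and> y \<in> carrier N}
   \<union> {frag_of (x, y \<oplus>\<^bsub>N\<^esub> y') - frag_of (x, y) - frag_of (x, y') | x y y'.
        x \<in> carrier M \<and> y \<in> carrier N \<and> y' \<in> carrier N}
   \<union> {frag_of (ra x s, y) - frag_of (x, la s y) | x s y.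
        x \<in> carrier M \<and> s \<in> S \<and> y \<in> carrier N}"

definition tensor_kernel ::
  "'s set \<Rightarrow> ('m \<Rightarrow> 's \<Rightarrow> 'm) \<Rightarrow> ('s \<Rightarrow> 'n \<Rightarrow> 'n) \<Rightarrow> ('b, 'm) module \<Rightarrow> ('c, 'n) module
    \<Rightarrow> (('m \<times> 'n) \<Rightarrow>\<^sub>0 int) set" where
  "tensor_kernel S ra la M N =
     generate (free_Abelian_group (carrier M \<times> carrier N)) (tensor_relations S ra la M N)"

definition pure_tensor ::
  "'s set \<Rightarrow> ('m \<Rightarrow> 's \<Rightarrow> 'm) \<Rightarrow> ('s \<Rightarrow> 'n \<Rightarrow> 'n) \<Rightarrow> ('b, 'm) module \<Rightarrow> ('c, 'n) module
    \<Rightarrow> 'm \<Rightarrow> 'n \<Rightarrow> (('m \<times> 'n) \<Rightarrow>\<^sub>0 int) set" where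
  "pure_tensor S ra la M N x y =
     tensor_kernel S ra la M N #>\<^bsub>free_Abelian_group (carrier M \<times> carrier N)\<^esub> frag_of (x, y)"

definition tensor ::
  "'s set \<Rightarrow> ('m \<Rightarrow> 's \<Rightarrow> 'm) \<Rightarrow> ('s \<Rightarrow> 'n \<Rightarrow> 'n) \<Rightarrow> ('b, 'm) module \<Rightarrow> ('c, 'n) module
    \<Rightarrow> ('b, (('m \<times> 'n) \<Rightarrow>\<^sub>0 int) set) module" where
  "tensor S ra la M N =
     (let F = free_Abelian_group (carrier M \<times> carrier N); H = tensor_kernel S ra la M N
      in \<lparr>carrier = carrier (F Mod H), monoid.mult = undefined, monoid.one = undefined,
          ring.zero = monoid.one (F Mod H), add = monoid.mult (F Mod H),
          smult = (\<lambda>b U. \<Union>c\<in>U. H #>\<^bsub>F\<^esub> frag_extend (\<lambda>(x, y). frag_of (b \<odot>\<^bsub>M\<^esub> x, y)) c)\<rparr>)"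

definition quotient_module :: "('a, 'm) module \<Rightarrow> 'm set \<Rightarrow> ('a, 'm set) module" where
  "quotient_module M N = \<lparr>carrier = a_rcosets\<^bsub>M\<^esub> N, monoid.mult = undefined, monoid.one = undefined,
     ring.zero = N, add = set_add M, smult = (\<lambda>a U. \<Union>x\<in>U. N +>\<^bsub>M\<^esub> (a \<odot>\<^bsub>M\<^esub> x))\<rparr>"

definition transport :: "('m \<Rightarrow> 'n) \<Rightarrow> ('a, 'm) module \<Rightarrow> ('a, 'n) module" where
  "transport h M = (let g = inv_into (carrier M) h in
     \<lparr>carrier = h ` carrier M, monoid.mult = undefined, monoid.one = undefined, ring.zero = h \<zero>\<^bsub>M\<^esub>,
      add = (\<lambda>x y. h (g x \<oplus>\<^bsub>M\<^esub> g y)), smult = (\<lambda>a x. h (a \<odot>\<^bsub>M\<^esub> g x))\<rparr>)"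

text \<open>The unique additive map with a property that prescribes its values on generators.
  Linearity is not required because \<open>D_II\<close> below is additive but not \<open>A\<close>-linear.\<close>

definition additive_map ::
  "('x, 'p) ring_scheme \<Rightarrow> ('y, 'q) ring_scheme \<Rightarrow> (('x \<Rightarrow> 'y) \<Rightarrow> bool) \<Rightarrow> 'x \<Rightarrow> 'y" where
  "additive_map U V P = (THE f. f \<in> extensional (carrier U)
     \<and> f \<in> hom (add_monoid U) (add_monoid V) \<and> P f)"


section \<open>Forms with values in a module, and 1-jets\<close>

definition forms_in ::
  "('k, 'w) module \<Rightarrow> ('k, 'w) dga \<Rightarrow> nat \<Rightarrow> ('w, 'e) module \<Rightarrow> ('w, (('w \<times> 'e) \<Rightarrow>\<^sub>0 int) set) module"
  where
  "forms_in A \<Omega> p E = tensor (carrier A) (monoid.mult \<Omega>) (smult E) (forms \<Omega> p) E"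

definition form_tensor ::
  "('k, 'w) module \<Rightarrow> ('k, 'w) dga \<Rightarrow> nat \<Rightarrow> ('w, 'e) module \<Rightarrow> 'w \<Rightarrow> 'e \<Rightarrow> (('w \<times> 'e) \<Rightarrow>\<^sub>0 int) set"
  where
  "form_tensor A \<Omega> p E =
     pure_tensor (carrier A) (monoid.mult \<Omega>) (smult E) (forms \<Omega> p) E"

text \<open>The tensor product of \<open>A\<close> and \<open>E\<close> over \<open>K\<close>, which acts on \<open>E\<close> through \<open>k \<mapsto> k \<cdot> 1\<^sub>A\<close>.
  The left \<open>A\<close>-module \<open>A\<close> is \<open>forms \<Omega> 0\<close>.\<close>

definition A_tensor ::
  "'k ring \<Rightarrow> ('k, 'w) module \<Rightarrow> ('k, 'w) dga \<Rightarrow> ('w, 'e) module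
    \<Rightarrow> ('w, (('w \<times> 'e) \<Rightarrow>\<^sub>0 int) set) module" where
  "A_tensor K A \<Omega> E = tensor (carrier K) (\<lambda>a k. k \<odot>\<^bsub>A\<^esub> a)
     (\<lambda>k e. (k \<odot>\<^bsub>A\<^esub> \<one>\<^bsub>A\<^esub>) \<odot>\<^bsub>E\<^esub> e) (forms \<Omega> 0) E"

definition A_pure ::
  "'k ring \<Rightarrow> ('k, 'w) module \<Rightarrow> ('k, 'w) dga \<Rightarrow> ('w, 'e) module \<Rightarrow> 'w \<Rightarrow> 'e
    \<Rightarrow> (('w \<times> 'e) \<Rightarrow>\<^sub>0 int) set" where
  "A_pure K A \<Omega> E = pure_tensor (carrier K) (\<lambda>a k. k \<odot>\<^bsub>A\<^esub> a)
     (\<lambda>k e. (k \<odot>\<^bsub>A\<^esub> \<one>\<^bsub>A\<^esub>) \<odot>\<^bsub>E\<^esub> e) (forms \<Omega> 0) E"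

definition jet_kernel ::
  "'k ring \<Rightarrow> ('k, 'w) module \<Rightarrow> ('k, 'w) dga \<Rightarrow> ('w, 'e) module \<Rightarrow> (('w \<times> 'e) \<Rightarrow>\<^sub>0 int) set set"
  where
  "jet_kernel K A \<Omega> E =
     {\<Oplus>\<^bsub>A_tensor K A \<Omega> E\<^esub>i\<in>{..<m}. A_pure K A \<Omega> E (a i) (e i) | (m::nat) a e.
        (\<forall>i<m. a i \<in> carrier A \<and> e i \<in> carrier E)
      \<and> (\<Oplus>\<^bsub>E\<^esub>i\<in>{..<m}. a i \<odot>\<^bsub>E\<^esub> e i) = \<zero>\<^bsub>E\<^esub>
      \<and> (\<Oplus>\<^bsub>forms_in A \<Omega> 1 E\<^esub>i\<in>{..<m}. form_tensor A \<Omega> 1 E (diff \<Omega> (a i)) (e i))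
          = \<zero>\<^bsub>forms_in A \<Omega> 1 E\<^esub>}"

definition jet1_quotient ::
  "'k ring \<Rightarrow> ('k, 'w) module \<Rightarrow> ('k, 'w) dga \<Rightarrow> ('w, 'e) module
    \<Rightarrow> ('w, (('w \<times> 'e) \<Rightarrow>\<^sub>0 int) set set) module" where
  "jet1_quotient K A \<Omega> E = quotient_module (A_tensor K A \<Omega> E) (jet_kernel K A \<Omega> E)"

definition jet1_quotient_class ::
  "'k ring \<Rightarrow> ('k, 'w) module \<Rightarrow> ('k, 'w) dga \<Rightarrow> ('w, 'e) module \<Rightarrow> 'w \<Rightarrow> 'e
    \<Rightarrow> (('w \<times> 'e) \<Rightarrow>\<^sub>0 int) set set" where
  "jet1_quotient_class K A \<Omega> E a e =
     jet_kernel K A \<Omega> E +>\<^bsub>A_tensor K A \<Omega> E\<^esub> A_pure K A \<Omega> E a e"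

text \<open>The quotient construction changes the type of the elements, so it cannot be iterated \<open>n\<close>
  times for a variable \<open>n\<close>.  All iterated jet modules are therefore given elements in one type:
  every element of \<open>jet1_quotient\<close> is a finite sum of classes of elementary tensors, and it is
  named by one chosen list of pairs that produces it.  The naming is injective, so \<open>jet1\<close> below
  is an isomorphic copy of \<open>jet1_quotient\<close>.\<close>

datatype ('w, 'e) jet = Base 'e | Jet "('w \<times> ('w, 'e) jet) list"

definition jet_name ::
  "'k ring \<Rightarrow> ('k, 'w) module \<Rightarrow> ('k, 'w) dga \<Rightarrow> ('w, ('w, 'e) jet) module
    \<Rightarrow> (('w \<times> ('w, 'e) jet) \<Rightarrow>\<^sub>0 int) set set \<Rightarrow> ('w, 'e) jet" where
  "jet_name K A \<Omega> M U = Jet (SOME ps. set ps \<subseteq> carrier A \<times> carrier M \<and>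
     U = foldr (\<lambda>(a, e) V. jet1_quotient_class K A \<Omega> M a e \<oplus>\<^bsub>jet1_quotient K A \<Omega> M\<^esub> V)
           ps \<zero>\<^bsub>jet1_quotient K A \<Omega> M\<^esub>)"

definition jet1 ::
  "'k ring \<Rightarrow> ('k, 'w) module \<Rightarrow> ('k, 'w) dga \<Rightarrow> ('w, ('w, 'e) jet) module
    \<Rightarrow> ('w, ('w, 'e) jet) module" where
  "jet1 K A \<Omega> M = transport (jet_name K A \<Omega> M) (jet1_quotient K A \<Omega> M)"

definition jet1_class ::
  "'k ring \<Rightarrow> ('k, 'w) module \<Rightarrow> ('k, 'w) dga \<Rightarrow> ('w, ('w, 'e) jet) module
    \<Rightarrow> 'w \<Rightarrow> ('w, 'e) jet \<Rightarrow> ('w, 'e) jet" where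
  "jet1_class K A \<Omega> M a e = jet_name K A \<Omega> M (jet1_quotient_class K A \<Omega> M a e)"

definition jet1_map ::
  "'k ring \<Rightarrow> ('k, 'w) module \<Rightarrow> ('k, 'w) dga \<Rightarrow> ('w, ('w, 'e) jet) module
    \<Rightarrow> ('w, ('w, 'e) jet) module \<Rightarrow> (('w, 'e) jet \<Rightarrow> ('w, 'e) jet)
    \<Rightarrow> ('w, 'e) jet \<Rightarrow> ('w, 'e) jet" where
  "jet1_map K A \<Omega> M N f = additive_map (jet1 K A \<Omega> M) (jet1 K A \<Omega> N)
     (\<lambda>g. \<forall>a\<in>carrier A. \<forall>e\<in>carrier M. g (jet1_class K A \<Omega> M a e) = jet1_class K A \<Omega> N a (f e))"

definition jet1_proj ::
  "'k ring \<Rightarrow> ('k, 'w) module \<Rightarrow> ('k, 'w) dga \<Rightarrow> ('w, ('w, 'e) jet) module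
    \<Rightarrow> ('w, 'e) jet \<Rightarrow> ('w, 'e) jet" where
  "jet1_proj K A \<Omega> M = additive_map (jet1 K A \<Omega> M) M
     (\<lambda>g. \<forall>a\<in>carrier A. \<forall>e\<in>carrier M. g (jet1_class K A \<Omega> M a e) = a \<odot>\<^bsub>M\<^esub> e)"

definition D_I ::
  "'k ring \<Rightarrow> ('k, 'w) module \<Rightarrow> ('k, 'w) dga \<Rightarrow> ('w, ('w, 'e) jet) module
    \<Rightarrow> ('w, 'e) jet \<Rightarrow> (('w \<times> ('w, 'e) jet) \<Rightarrow>\<^sub>0 int) set" where
  "D_I K A \<Omega> M = additive_map (jet1 K A \<Omega> (jet1 K A \<Omega> M)) (forms_in A \<Omega> 1 M)
     (\<lambda>g. \<forall>a\<in>carrier A. \<forall>c\<in>carrier A. \<forall>e\<in>carrier M.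
        g (jet1_class K A \<Omega> (jet1 K A \<Omega> M) a (jet1_class K A \<Omega> M c e))
          = form_tensor A \<Omega> 1 M (a \<otimes>\<^bsub>\<Omega>\<^esub> diff \<Omega> c) e)"

definition D_II ::
  "'k ring \<Rightarrow> ('k, 'w) module \<Rightarrow> ('k, 'w) dga \<Rightarrow> ('w, ('w, 'e) jet) module
    \<Rightarrow> ('w, 'e) jet \<Rightarrow> (('w \<times> ('w, 'e) jet) \<Rightarrow>\<^sub>0 int) set" where
  "D_II K A \<Omega> M = additive_map (jet1 K A \<Omega> (jet1 K A \<Omega> M)) (forms_in A \<Omega> 2 M)
     (\<lambda>g. \<forall>a\<in>carrier A. \<forall>c\<in>carrier A. \<forall>e\<in>carrier M.
        g (jet1_class K A \<Omega> (jet1 K A \<Omega> M) a (jet1_class K A \<Omega> M c e))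
          = form_tensor A \<Omega> 2 M (diff \<Omega> a \<otimes>\<^bsub>\<Omega>\<^esub> diff \<Omega> c) e)"


section \<open>Holonomic jets\<close>

fun jets ::
  "'k ring \<Rightarrow> ('k, 'w) module \<Rightarrow> ('k, 'w) dga \<Rightarrow> ('w, 'e) module \<Rightarrow> nat
    \<Rightarrow> ('w, ('w, 'e) jet) module" where
  "jets K A \<Omega> E 0 = transport Base E"
| "jets K A \<Omega> E (Suc 0) = jet1 K A \<Omega> (jets K A \<Omega> E 0)"
| "jets K A \<Omega> E (Suc (Suc n)) =
     (let J = jets K A \<Omega> E (Suc n); J' = jets K A \<Omega> E n;
          l = jet1_map K A \<Omega> J (jet1 K A \<Omega> J') (\<lambda>x\<in>carrier J. x)
      in (jet1 K A \<Omega> J)\<lparr>carrier := {x \<in> carrier (jet1 K A \<Omega> J).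
            D_I K A \<Omega> J' (l x) = \<zero>\<^bsub>forms_in A \<Omega> 1 J'\<^esub>
          \<and> D_II K A \<Omega> J' (l x) = \<zero>\<^bsub>forms_in A \<Omega> 2 J'\<^esub>}\<rparr>)"

text \<open>For \<open>n \<ge> 1\<close>, the inclusion of \<open>jets n\<close> into \<open>jet1 (jets (n - 1))\<close>; it is the function
  written \<open>\<lambda>x\<in>carrier J. x\<close> in the recursion above.\<close>

definition jet_incl ::
  "'k ring \<Rightarrow> ('k, 'w) module \<Rightarrow> ('k, 'w) dga \<Rightarrow> ('w, 'e) module \<Rightarrow> nat
    \<Rightarrow> ('w, 'e) jet \<Rightarrow> ('w, 'e) jet" where
  "jet_incl K A \<Omega> E n = (\<lambda>x\<in>carrier (jets K A \<Omega> E n). x)"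

definition jet_proj ::
  "'k ring \<Rightarrow> ('k, 'w) module \<Rightarrow> ('k, 'w) dga \<Rightarrow> ('w, 'e) module \<Rightarrow> nat
    \<Rightarrow> ('w, 'e) jet \<Rightarrow> ('w, 'e) jet" where
  "jet_proj K A \<Omega> E n = jet1_proj K A \<Omega> (jets K A \<Omega> E (n - 1)) \<circ> jet_incl K A \<Omega> E n"

definition n_connection ::
  "'k ring \<Rightarrow> ('k, 'w) module \<Rightarrow> ('k, 'w) dga \<Rightarrow> ('w, 'e) module \<Rightarrow> nat
    \<Rightarrow> (('w, 'e) jet \<Rightarrow> ('w, 'e) jet) \<Rightarrow> bool" where
  "n_connection K A \<Omega> E n C \<longleftrightarrow>
     C \<in> left_linear A (jets K A \<Omega> E (n - 1)) (jets K A \<Omega> E n)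
   \<and> (\<forall>x\<in>carrier (jets K A \<Omega> E (n - 1)). (jet_proj K A \<Omega> E n \<circ> C) x = x)"

definition curvature ::
  "'k ring \<Rightarrow> ('k, 'w) module \<Rightarrow> ('k, 'w) dga \<Rightarrow> ('w, 'e) module \<Rightarrow> nat
    \<Rightarrow> (('w, 'e) jet \<Rightarrow> ('w, 'e) jet) \<Rightarrow> ('w, 'e) jet
    \<Rightarrow> (('w \<times> ('w, 'e) jet) \<Rightarrow>\<^sub>0 int) set" where
  "curvature K A \<Omega> E n C x =
     \<ominus>\<^bsub>forms_in A \<Omega> 2 (jets K A \<Omega> E (n - 1))\<^esub>
       (D_II K A \<Omega> (jets K A \<Omega> E (n - 1))
        \<circ> jet1_map K A \<Omega> (jets K A \<Omega> E n) (jet1 K A \<Omega> (jets K A \<Omega> E (n - 1))) (jet_incl K A \<Omega> E n)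
        \<circ> jet1_map K A \<Omega> (jets K A \<Omega> E (n - 1)) (jets K A \<Omega> E n) C
        \<circ> jet_incl K A \<Omega> E n \<circ> C) x"

end

theory Submission
  imports Defs
begin

text \<open>Write \<open>M = J\<^sup>n\<^sup>-\<^sup>1E\<close>, \<open>\<pi>[a \<otimes> e] = ae\<close> and \<open>\<rho>[a \<otimes> e] = da \<otimes> e\<close>; by definition of the jet relations
  \<open>(\<pi>, \<rho>)\<close> embeds \<open>J\<^sup>1M\<close> into \<open>M \<oplus> \<Omega>\<^sup>1M\<close>.  Since \<open>\<rho>(bx) = b \<rho>(x) + db \<otimes> \<pi>(x)\<close>, on \<open>J\<^sup>1J\<^sup>1M\<close> one has
  \<open>D_I = \<rho> \<circ> \<pi> - \<rho> \<circ> J\<^sup>1(\<pi>)\<close>.  On \<open>J\<^sup>1(l) J\<^sup>1(C) l C x\<close> both terms equal \<open>\<rho>(l C x)\<close>, by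
  naturality of \<open>\<pi>\<close> and by \<open>\<pi> l C = id\<close>, so only the condition on \<open>D_II\<close> remains, which is the
  vanishing of the curvature.  That \<open>J\<^sup>nE\<close> is a submodule uses
  \<open>D_II(by) = b D_II(y) + db \<and> D_I(y)\<close>.\<close>


section \<open>Additive maps and quotients\<close>

text \<open>The maps \<open>jet1_map\<close>, \<open>jet1_proj\<close>, \<open>D_I\<close> and
  \<open>D_II\<close> are definite descriptions of additive maps with prescribed values on
  generators. Nothing can be said about them before such a map is exhibited; uniqueness is cheap,
  since the generators span additively. For \<open>D_II\<close> existence is the obstacle: its value
  on [a \<otimes> j] ought to be da \<and> \<rho>(j), but \<rho> is not A-linear, so w \<otimes> j
  \<mapsto> w \<and> \<rho>(j) is not balanced over A. A corrected map is balanced, and the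
  correction is invisible on exact forms. The functor J^1 is not known to preserve injections.
  Holonomy of x is therefore tested on J^1(l)(x), and x is never identified with that image. What
  makes the final computation possible is that the image in question comes from J^1(l C), where l C
  is an A-linear section of \<pi>.\<close>

abbreviation add_hom :: "('a, 'p) ring_scheme \<Rightarrow> ('b, 'q) ring_scheme \<Rightarrow> ('a \<Rightarrow> 'b) set" where
  "add_hom U V \<equiv> hom (add_monoid U) (add_monoid V)"

lemma add_homI:
  assumes "\<And>x. x \<in> carrier U \<Longrightarrow> f x \<in> carrier V"
    and "\<And>x y. \<lbrakk>x \<in> carrier U; y \<in> carrier U\<rbrakk> \<Longrightarrow> f (x \<oplus>\<^bsub>U\<^esub> y) = f x \<oplus>\<^bsub>V\<^esub> f y"
  shows "f \<in> add_hom U V"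
  using assms by (auto simp: hom_def)

lemma add_hom_closed: "\<lbrakk>f \<in> add_hom U V; x \<in> carrier U\<rbrakk> \<Longrightarrow> f x \<in> carrier V"
  by (auto simp: hom_def)

lemma add_hom_add:
  "\<lbrakk>f \<in> add_hom U V; x \<in> carrier U; y \<in> carrier U\<rbrakk> \<Longrightarrow> f (x \<oplus>\<^bsub>U\<^esub> y) = f x \<oplus>\<^bsub>V\<^esub> f y"
  by (auto simp: hom_def)

lemma add_hom_zero:
  assumes "abelian_group U" "abelian_group V" "f \<in> add_hom U V"
  shows "f \<zero>\<^bsub>U\<^esub> = \<zero>\<^bsub>V\<^esub>"
  using hom_one[OF assms(3)] abelian_group.a_group[OF assms(1)] abelian_group.a_group[OF assms(2)]
  by simp

lemma add_hom_neg:
  assumes "abelian_group U" "abelian_group V" "f \<in> add_hom U V" "x \<in> carrier U"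
  shows "f (\<ominus>\<^bsub>U\<^esub> x) = \<ominus>\<^bsub>V\<^esub> f x"
proof -
  interpret group_hom "add_monoid U" "add_monoid V" f
    using assms by (simp add: group_hom_def group_hom_axioms_def abelian_group.a_group)
  show ?thesis using hom_inv[of x] assms(4) by (simp add: a_inv_def)
qed

lemma add_hom_comp: "\<lbrakk>f \<in> add_hom U V; g \<in> add_hom V W\<rbrakk> \<Longrightarrow> (\<lambda>x. g (f x)) \<in> add_hom U W"
  by (intro add_homI) (simp_all add: add_hom_closed add_hom_add)

lemma add_hom_sum:
  assumes "abelian_group V" "f \<in> add_hom U V" "g \<in> add_hom U V"
  shows "(\<lambda>x. f x \<oplus>\<^bsub>V\<^esub> g x) \<in> add_hom U V"
proof -
  interpret V: abelian_group V by fact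
  show ?thesis using assms(2,3)
    by (intro add_homI) (simp_all add: add_hom_closed add_hom_add V.a_ac)
qed

lemma add_hom_diff:
  assumes "abelian_group V" "f \<in> add_hom U V" "g \<in> add_hom U V"
  shows "(\<lambda>x. f x \<ominus>\<^bsub>V\<^esub> g x) \<in> add_hom U V"
proof -
  interpret V: abelian_group V by fact
  show ?thesis using assms(2,3)
    by (intro add_homI)
       (simp_all add: add_hom_closed add_hom_add a_minus_def V.minus_add V.a_ac)
qed

lemma add_hom_finsum:
  fixes f :: "'a \<Rightarrow> 'b"
  assumes "abelian_group U" "abelian_group V" "f \<in> add_hom U V"
    and "finite I" "g \<in> I \<rightarrow> carrier U"
  shows "f (\<Oplus>\<^bsub>U\<^esub>i\<in>I. g i) = (\<Oplus>\<^bsub>V\<^esub>i\<in>I. f (g i))"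
  using assms(4,5)
proof (induction I)
  case empty
  then show ?case
    using assms(1-3) by (simp add: add_hom_zero abelian_monoid.finsum_empty abelian_group.axioms(1))
next
  case (insert j I)
  interpret U: abelian_group U by fact
  interpret V: abelian_group V by fact
  have g: "g j \<in> carrier U" "g \<in> I \<rightarrow> carrier U" using insert.prems by auto
  then have "f (g j) \<in> carrier V" "(\<lambda>i. f (g i)) \<in> I \<rightarrow> carrier V"
    using assms(3) by (auto intro: add_hom_closed)
  with g show ?case
    using insert assms(3) by (simp add: add_hom_add)
qed

lemma add_hom_restrict:
  "\<lbrakk>abelian_group U; f \<in> add_hom U V\<rbrakk> \<Longrightarrow> restrict f (carrier U) \<in> add_hom U V"
  by (intro add_homI)
     (auto simp: add_hom_closed add_hom_add abelian_group_def abelian_monoid.a_closed)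

text \<open>\<open>additive_map\<close> is a definite description; \<open>P\<close> must not see values outside the carrier.\<close>

lemma additive_map_eq:
  assumes "f \<in> add_hom U V" "P (restrict f (carrier U))"
    and "\<And>g. \<lbrakk>g \<in> add_hom U V; P g\<rbrakk> \<Longrightarrow> \<forall>x\<in>carrier U. g x = f x"
    and "\<And>x y. \<lbrakk>x \<in> carrier U; y \<in> carrier U\<rbrakk> \<Longrightarrow> x \<oplus>\<^bsub>U\<^esub> y \<in> carrier U"
  shows "additive_map U V P = restrict f (carrier U)"
  unfolding additive_map_def
proof (rule the_equality)
  show "restrict f (carrier U) \<in> extensional (carrier U)
      \<and> restrict f (carrier U) \<in> add_hom U V \<and> P (restrict f (carrier U))"
    using assms(1,2,4) by (auto simp: hom_def)
  show "g = restrict f (carrier U)"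
    if "g \<in> extensional (carrier U) \<and> g \<in> add_hom U V \<and> P g" for g
    using that assms(3)[of g] by (intro extensionalityI[of _ "carrier U"]) auto
qed

text \<open>The scalar actions on tensor products and on quotient modules are unions over all
  representatives of a coset. A representative h x has image f(h) f(x) with f(h) in H, so all
  members of the union are the same coset and the union collapses.\<close>

lemma coset_hom_image:
  fixes G (structure)
  assumes "group G" "subgroup H G" "f \<in> hom G G" "f ` H \<subseteq> H" "x \<in> carrier G"
  shows "(\<Union>c\<in>H #>\<^bsub>G\<^esub> x. H #>\<^bsub>G\<^esub> f c) = H #>\<^bsub>G\<^esub> f x"
proof -
  interpret group G by fact
  interpret H: subgroup H G by fact
  have f: "f y \<in> carrier G" if "y \<in> carrier G" for y using that assms(3) by (auto simp: hom_def)
  have eq: "H #> f c = H #> f x" if "c \<in> H #> x" for c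
  proof -
    obtain h where h: "h \<in> H" "c = h \<otimes> x" using \<open>c \<in> H #> x\<close> by (auto simp: r_coset_def)
    then have "f c = f h \<otimes> f x" using assms by (auto simp: hom_def)
    moreover have fh: "f h \<in> H" using h assms by auto
    ultimately have "H #> f c = (H #> f h) #> f x"
      using assms f h by (simp add: coset_mult_assoc H.subset)
    then show ?thesis using fh by (simp add: coset_join2 assms(2))
  qed
  have "x \<in> H #> x" using assms by (simp add: rcos_self)
  with eq show ?thesis by blast
qed

text \<open>Tensor products and quotient modules copy the operations of a factor group into the
  additive fields of a record; the group laws depend on these fields alone.\<close>

lemma abelian_group_of_comm_group:
  assumes "comm_group G" "carrier U = carrier G"
    and "\<And>x y. x \<oplus>\<^bsub>U\<^esub> y = x \<otimes>\<^bsub>G\<^esub> y" "\<zero>\<^bsub>U\<^esub> = \<one>\<^bsub>G\<^esub>"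
  shows "abelian_group U"
proof -
  interpret comm_group G by fact
  show ?thesis
    by (rule abelian_groupI) (use assms in \<open>auto simp: m_ac intro: l_inv_ex\<close>)
qed

lemma comm_group_FactGroup: "\<lbrakk>comm_group G; subgroup H G\<rbrakk> \<Longrightarrow> comm_group (G Mod H)"
  by (rule comm_group.abelian_FactGroup)

lemma r_coset_add_FactGroup:
  assumes "comm_group G" "subgroup H G" "x \<in> carrier G" "y \<in> carrier G"
  shows "(H #>\<^bsub>G\<^esub> x) <#>\<^bsub>G\<^esub> (H #>\<^bsub>G\<^esub> y) = H #>\<^bsub>G\<^esub> (x \<otimes>\<^bsub>G\<^esub> y)"
  using assms comm_group.subgroup_imp_normal normal.rcos_sum by metis

lemma r_coset_eq_one_iff:
  assumes "group G" "subgroup H G" "x \<in> carrier G"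
  shows "H #>\<^bsub>G\<^esub> x = H \<longleftrightarrow> x \<in> H"
  using assms group.coset_join1 group.coset_join2 subgroup.subset by metis

section \<open>Finite sums written as folds over lists\<close>

lemma foldr_add_closed:
  fixes U (structure)
  assumes "abelian_group U" "\<And>p. p \<in> set ps \<Longrightarrow> f p \<in> carrier U" "z \<in> carrier U"
  shows "foldr (\<lambda>p v. f p \<oplus>\<^bsub>U\<^esub> v) ps z \<in> carrier U"
proof -
  interpret abelian_group U by fact
  show ?thesis using assms(2,3) by (induction ps) auto
qed

lemma foldr_add_acc:
  fixes U (structure)
  assumes "abelian_group U" "\<And>p. p \<in> set ps \<Longrightarrow> f p \<in> carrier U" "z \<in> carrier U"
  shows "foldr (\<lambda>p v. f p \<oplus>\<^bsub>U\<^esub> v) ps z = foldr (\<lambda>p v. f p \<oplus>\<^bsub>U\<^esub> v) ps \<zero>\<^bsub>U\<^esub> \<oplus>\<^bsub>U\<^esub> z"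
proof -
  interpret abelian_group U by fact
  show ?thesis using assms(2,3)
  proof (induction ps)
    case (Cons p ps)
    then have "foldr (\<lambda>p v. f p \<oplus> v) ps \<zero> \<in> carrier U"
      by (intro foldr_add_closed assms(1)) auto
    with Cons show ?case by (simp add: a_assoc)
  qed simp
qed

lemma foldr_add_eq_finsum:
  fixes U (structure)
  assumes "abelian_group U" "\<And>p. p \<in> set ps \<Longrightarrow> f p \<in> carrier U"
  shows "foldr (\<lambda>p v. f p \<oplus>\<^bsub>U\<^esub> v) ps \<zero>\<^bsub>U\<^esub> = (\<Oplus>\<^bsub>U\<^esub>i\<in>{..<length ps}. f (ps ! i))"
proof -
  interpret abelian_group U by fact
  show ?thesis using assms(2)
  \<comment> \<open>Appending an entry adds one last index to \<open>{..<length ps}\<close> and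
    leaves the others fixed, whereas a new head would shift all of them.\<close>
  proof (induction ps rule: rev_induct)
    case (snoc p ps)
    have cl: "foldr (\<lambda>p v. f p \<oplus> v) ps \<zero> \<in> carrier U"
      using snoc.prems by (intro foldr_add_closed assms(1)) auto
    have "foldr (\<lambda>p v. f p \<oplus> v) (ps @ [p]) \<zero> = f p \<oplus> foldr (\<lambda>p v. f p \<oplus> v) ps \<zero>"
      using snoc.prems foldr_add_acc[OF assms(1), of ps f "f p"] cl by (simp add: a_comm)
    also have "\<dots> = f p \<oplus> (\<Oplus>i\<in>{..<length ps}. f ((ps @ [p]) ! i))"
    proof -
      have "f (ps ! i) \<in> carrier U" if "i < length ps" for i
        using that snoc.prems nth_mem[of i ps] by auto
      then have "(\<Oplus>i\<in>{..<length ps}. f (ps ! i)) = (\<Oplus>i\<in>{..<length ps}. f ((ps @ [p]) ! i))"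
        by (intro finsum_cong') (auto simp: nth_append)
      then show ?thesis using snoc by simp
    qed
    also have "\<dots> = (\<Oplus>i\<in>{..<length (ps @ [p])}. f ((ps @ [p]) ! i))"
    proof -
      have "f ((ps @ [p]) ! i) \<in> carrier U" if "i < Suc (length ps)" for i
        using that snoc.prems nth_mem[of i "ps @ [p]"] by auto
      then have "(\<lambda>i. f ((ps @ [p]) ! i)) \<in> {..<length ps} \<rightarrow> carrier U"
        by (auto simp del: nth_append_left)
      then show ?thesis
        using snoc.prems by (simp add: lessThan_Suc finsum_insert)
    qed
    finally show ?case .
  qed simp
qed

text \<open>The induction rule for V is applied to the predicate of being a list sum; concatenation
  handles the case of sums. Having the rule as a hypothesis lets one proof serve both tensors and
  classes of jets.\<close>

lemma additive_span_foldr: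
  fixes U (structure)
  assumes "abelian_group U" "\<And>p. p \<in> S \<Longrightarrow> f p \<in> carrier U"
    and "V \<in> carrier U"
    and induct: "\<And>P. \<lbrakk>P \<zero>\<^bsub>U\<^esub>; \<And>p. p \<in> S \<Longrightarrow> P (f p);
        \<And>x y. \<lbrakk>x \<in> carrier U; y \<in> carrier U; P x; P y\<rbrakk> \<Longrightarrow> P (x \<oplus>\<^bsub>U\<^esub> y)\<rbrakk> \<Longrightarrow> P V"
  shows "\<exists>ps. set ps \<subseteq> S \<and> V = foldr (\<lambda>p v. f p \<oplus>\<^bsub>U\<^esub> v) ps \<zero>\<^bsub>U\<^esub>"
proof (rule induct)
  interpret abelian_group U by fact
  show "\<exists>ps. set ps \<subseteq> S \<and> \<zero>\<^bsub>U\<^esub> = foldr (\<lambda>p v. f p \<oplus>\<^bsub>U\<^esub> v) ps \<zero>\<^bsub>U\<^esub>"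
    by (intro exI[of _ "[]"]) auto
  show "\<exists>ps. set ps \<subseteq> S \<and> f p = foldr (\<lambda>p v. f p \<oplus>\<^bsub>U\<^esub> v) ps \<zero>\<^bsub>U\<^esub>" if "p \<in> S" for p
    using that assms(2) by (intro exI[of _ "[p]"]) auto
  fix x y
  assume "\<exists>ps. set ps \<subseteq> S \<and> x = foldr (\<lambda>p v. f p \<oplus>\<^bsub>U\<^esub> v) ps \<zero>\<^bsub>U\<^esub>"
    and "\<exists>ps. set ps \<subseteq> S \<and> y = foldr (\<lambda>p v. f p \<oplus>\<^bsub>U\<^esub> v) ps \<zero>\<^bsub>U\<^esub>"
  then obtain ps qs where
    pq: "set ps \<subseteq> S" "x = foldr (\<lambda>p v. f p \<oplus>\<^bsub>U\<^esub> v) ps \<zero>\<^bsub>U\<^esub>"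
      "set qs \<subseteq> S" "y = foldr (\<lambda>p v. f p \<oplus>\<^bsub>U\<^esub> v) qs \<zero>\<^bsub>U\<^esub>"
    by blast
  have "foldr (\<lambda>p v. f p \<oplus>\<^bsub>U\<^esub> v) (ps @ qs) \<zero>\<^bsub>U\<^esub> = x \<oplus> y"
    using pq assms(2) foldr_add_acc[OF assms(1), of ps f y]
      foldr_add_closed[OF assms(1), of qs f "\<zero>\<^bsub>U\<^esub>"]
    by (auto simp: subset_iff)
  with pq show "\<exists>ps. set ps \<subseteq> S \<and> x \<oplus> y = foldr (\<lambda>p v. f p \<oplus>\<^bsub>U\<^esub> v) ps \<zero>\<^bsub>U\<^esub>"
    by (intro exI[of _ "ps @ qs"]) auto
qed


section \<open>Tensor products\<close>

text \<open>Common ground of the two tensor products in play: over \<open>carrier A\<close>, acting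
  on forms from the right, and over \<open>carrier K\<close>, acting on a left A-module through
  multiples of the unit of A.\<close>

locale balanced_pair =
  fixes S :: "'s set" and ra :: "'m \<Rightarrow> 's \<Rightarrow> 'm" and la :: "'s \<Rightarrow> 'n \<Rightarrow> 'n"
    and M :: "('b, 'm) module" and N :: "('c, 'n) module"
  assumes M_group: "abelian_group M" and N_group: "abelian_group N"
    and ra_closed: "\<lbrakk>x \<in> carrier M; s \<in> S\<rbrakk> \<Longrightarrow> ra x s \<in> carrier M"
    and la_closed: "\<lbrakk>s \<in> S; y \<in> carrier N\<rbrakk> \<Longrightarrow> la s y \<in> carrier N"
begin

sublocale M: abelian_group M by (rule M_group)
sublocale N: abelian_group N by (rule N_group)

abbreviation "Free \<equiv> free_Abelian_group (carrier M \<times> carrier N)"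
abbreviation "Ker \<equiv> tensor_kernel S ra la M N"
abbreviation "T \<equiv> tensor S ra la M N"
abbreviation "pure \<equiv> pure_tensor S ra la M N"

lemma Free_add: "\<lbrakk>x \<in> carrier Free; y \<in> carrier Free\<rbrakk> \<Longrightarrow> x + y \<in> carrier Free"
  using keys_add[of x y] by auto

lemma Free_diff: "\<lbrakk>x \<in> carrier Free; y \<in> carrier Free\<rbrakk> \<Longrightarrow> x - y \<in> carrier Free"
  using keys_diff[of x y] by auto

lemma Free_frag: "\<lbrakk>x \<in> carrier M; y \<in> carrier N\<rbrakk> \<Longrightarrow> frag_of (x, y) \<in> carrier Free"
  by simp

lemma relations_subset: "tensor_relations S ra la M N \<subseteq> carrier Free"
  unfolding tensor_relations_def
  by (blast intro: Free_diff Free_frag ra_closed la_closed M.a_closed N.a_closed)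

lemma Ker_subgroup: "subgroup Ker Free"
  unfolding tensor_kernel_def
  by (rule group.generate_is_subgroup[OF group_free_Abelian_group relations_subset])

lemma relation_in_Ker: "r \<in> tensor_relations S ra la M N \<Longrightarrow> r \<in> Ker"
  unfolding tensor_kernel_def by (rule generate.incl)

lemma tensor_group: "abelian_group T"
  by (rule abelian_group_of_comm_group
        [OF comm_group_FactGroup[OF abelian_free_Abelian_group Ker_subgroup]])
     (simp_all add: tensor_def Let_def)

sublocale T: abelian_group T by (rule tensor_group)

lemma tensor_carrier: "carrier T = (\<lambda>x. Ker #>\<^bsub>Free\<^esub> x) ` carrier Free"
  by (simp add: tensor_def Let_def carrier_FactGroup)

lemma tensor_add: "x \<oplus>\<^bsub>T\<^esub> y = x <#>\<^bsub>Free\<^esub> y"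
  by (simp add: tensor_def Let_def)

lemma tensor_zero: "\<zero>\<^bsub>T\<^esub> = Ker"
  by (simp add: tensor_def Let_def)

lemma coset_in_tensor: "x \<in> carrier Free \<Longrightarrow> Ker #>\<^bsub>Free\<^esub> x \<in> carrier T"
  by (auto simp: tensor_carrier)

lemma coset_add:
  "\<lbrakk>x \<in> carrier Free; y \<in> carrier Free\<rbrakk> \<Longrightarrow>
    (Ker #>\<^bsub>Free\<^esub> x) \<oplus>\<^bsub>T\<^esub> (Ker #>\<^bsub>Free\<^esub> y) = Ker #>\<^bsub>Free\<^esub> (x + y)"
  using r_coset_add_FactGroup[OF abelian_free_Abelian_group Ker_subgroup, of x y]
  by (simp add: tensor_add)

lemma coset_eqI:
  assumes "x \<in> carrier Free" "y \<in> carrier Free" "x - y \<in> Ker"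
  shows "Ker #>\<^bsub>Free\<^esub> x = Ker #>\<^bsub>Free\<^esub> y"
proof -
  have "(Ker #>\<^bsub>Free\<^esub> (x - y)) \<oplus>\<^bsub>T\<^esub> (Ker #>\<^bsub>Free\<^esub> y) = Ker #>\<^bsub>Free\<^esub> x"
    using assms by (subst coset_add) (simp_all only: Free_diff, simp)
  moreover have "Ker #>\<^bsub>Free\<^esub> (x - y) = \<zero>\<^bsub>T\<^esub>"
    unfolding tensor_zero
    by (rule group.coset_join2[OF group_free_Abelian_group Free_diff[OF assms(1,2)] Ker_subgroup assms(3)])
  ultimately show ?thesis using assms coset_in_tensor by simp
qed

lemma pure_closed: "\<lbrakk>x \<in> carrier M; y \<in> carrier N\<rbrakk> \<Longrightarrow> pure x y \<in> carrier T"
  unfolding pure_tensor_def by (rule coset_in_tensor) simp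

lemma pure_add_left:
  assumes "x \<in> carrier M" "x' \<in> carrier M" "y \<in> carrier N"
  shows "pure (x \<oplus>\<^bsub>M\<^esub> x') y = pure x y \<oplus>\<^bsub>T\<^esub> pure x' y"
proof -
  have "frag_of (x \<oplus>\<^bsub>M\<^esub> x', y) - (frag_of (x, y) + frag_of (x', y)) \<in> Ker"
    unfolding diff_diff_eq[symmetric]
    by (rule relation_in_Ker) (use assms in \<open>auto simp: tensor_relations_def\<close>)
  then show ?thesis using assms unfolding pure_tensor_def
    by (simp only: coset_add Free_frag) (intro coset_eqI Free_add Free_frag; simp)
qed

lemma pure_add_right:
  assumes "x \<in> carrier M" "y \<in> carrier N" "y' \<in> carrier N"
  shows "pure x (y \<oplus>\<^bsub>N\<^esub> y') = pure x y \<oplus>\<^bsub>T\<^esub> pure x y'"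
proof -
  have "frag_of (x, y \<oplus>\<^bsub>N\<^esub> y') - (frag_of (x, y) + frag_of (x, y')) \<in> Ker"
    unfolding diff_diff_eq[symmetric]
    by (rule relation_in_Ker) (use assms in \<open>auto simp: tensor_relations_def\<close>)
  then show ?thesis using assms unfolding pure_tensor_def
    by (simp only: coset_add Free_frag) (intro coset_eqI Free_add Free_frag; simp)
qed

lemma pure_balanced:
  assumes "x \<in> carrier M" "s \<in> S" "y \<in> carrier N"
  shows "pure (ra x s) y = pure x (la s y)"
proof -
  have "frag_of (ra x s, y) - frag_of (x, la s y) \<in> Ker"
    by (rule relation_in_Ker) (use assms in \<open>auto simp: tensor_relations_def\<close>)
  then show ?thesis using assms unfolding pure_tensor_def
    by (intro coset_eqI Free_frag ra_closed la_closed)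
qed

lemma pure_hom_left: "y \<in> carrier N \<Longrightarrow> (\<lambda>x. pure x y) \<in> add_hom M T"
  by (intro add_homI) (simp_all add: pure_closed pure_add_left)

lemma pure_hom_right: "x \<in> carrier M \<Longrightarrow> pure x \<in> add_hom N T"
  by (intro add_homI) (simp_all add: pure_closed pure_add_right)

lemmas pure_zero_left = add_hom_zero[OF M_group tensor_group pure_hom_left]
  and pure_neg_left = add_hom_neg[OF M_group tensor_group pure_hom_left]

text \<open>There is no case for negation, because the negative of a pure tensor is the pure tensor
  with the first factor negated.\<close>

lemma tensor_induct [consumes 1, case_names zero pure add]:
  assumes "t \<in> carrier T" and zero: "P \<zero>\<^bsub>T\<^esub>"
    and pure: "\<And>x y. \<lbrakk>x \<in> carrier M; y \<in> carrier N\<rbrakk> \<Longrightarrow> P (pure x y)"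
    and add: "\<And>u v. \<lbrakk>u \<in> carrier T; v \<in> carrier T; P u; P v\<rbrakk> \<Longrightarrow> P (u \<oplus>\<^bsub>T\<^esub> v)"
  shows "P t"
proof -
  obtain c where c: "c \<in> carrier Free" "t = Ker #>\<^bsub>Free\<^esub> c"
    using assms(1) by (auto simp: tensor_carrier)
  have *: "\<zero>\<^bsub>T\<^esub> = Ker #>\<^bsub>Free\<^esub> 0"
    using group.coset_join2[OF group_free_Abelian_group _ Ker_subgroup, of 0]
      subgroup.one_closed[OF Ker_subgroup] by (simp add: tensor_zero)
  have uminus: "- d \<in> carrier Free" if "d \<in> carrier Free" for d
    using that by simp
  have "Poly_Mapping.keys c \<subseteq> carrier M \<times> carrier N" using c(1) by simp
  \<comment> \<open>\<open>frag_induction\<close> proceeds by differences while the rule to be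
    proved offers sums only, so the claim is carried for c and - c at once.\<close>
  then have "c \<in> carrier Free \<and> P (Ker #>\<^bsub>Free\<^esub> c) \<and> P (Ker #>\<^bsub>Free\<^esub> (- c))"
  proof (induction c rule: frag_induction)
    case zero
    then show ?case using assms(2) * by simp
  next
    case (one p)
    then obtain x y where p: "p = (x, y)" "x \<in> carrier M" "y \<in> carrier N" by auto
    then have p_in: "frag_of p \<in> carrier Free" by simp
    have "(Ker #>\<^bsub>Free\<^esub> (- frag_of p)) \<oplus>\<^bsub>T\<^esub> (Ker #>\<^bsub>Free\<^esub> frag_of p) = \<zero>\<^bsub>T\<^esub>"
      using coset_add[OF uminus[OF p_in] p_in] * by simp
    then have "Ker #>\<^bsub>Free\<^esub> (- frag_of p) = \<ominus>\<^bsub>T\<^esub> pure x y"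
      using p coset_in_tensor[OF uminus[OF p_in]] pure_closed[of x y]
      by (intro T.minus_equality[symmetric]) (auto simp: pure_tensor_def)
    also have "\<dots> = pure (\<ominus>\<^bsub>M\<^esub> x) y" using p by (simp add: pure_neg_left)
    finally show ?case
      using pure[of x y] pure[of "\<ominus>\<^bsub>M\<^esub> x" y] p by (simp add: pure_tensor_def)
  next
    case (diff c d)
    then have cd: "c \<in> carrier Free" "d \<in> carrier Free" "- c \<in> carrier Free" "- d \<in> carrier Free"
      using uminus by blast+
    have "(Ker #>\<^bsub>Free\<^esub> c) \<oplus>\<^bsub>T\<^esub> (Ker #>\<^bsub>Free\<^esub> (- d)) = Ker #>\<^bsub>Free\<^esub> (c - d)"
       "(Ker #>\<^bsub>Free\<^esub> (- c)) \<oplus>\<^bsub>T\<^esub> (Ker #>\<^bsub>Free\<^esub> d) = Ker #>\<^bsub>Free\<^esub> (- (c - d))"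
      using cd by (simp_all only: coset_add) simp_all
    then show ?case
      using add[OF coset_in_tensor[OF cd(1)] coset_in_tensor[OF cd(4)]]
        add[OF coset_in_tensor[OF cd(3)] coset_in_tensor[OF cd(2)]] diff Free_diff[OF cd(1,2)]
      by simp
  qed
  with c show ?thesis by simp
qed

text \<open>The extension of f to the free abelian group kills the three kinds of relations, hence
  the subgroup they generate, and factors through the quotient. The target is a mere abelian group,
  since some of the maps lifted later, such as a \<otimes> e \<mapsto> da \<otimes> e, are additive
  without being A-linear.\<close>

lemma tensor_lift:
  assumes G: "abelian_group G"
    and closed: "\<And>x y. \<lbrakk>x \<in> carrier M; y \<in> carrier N\<rbrakk> \<Longrightarrow> f x y \<in> carrier G"
    and left: "\<And>x x' y. \<lbrakk>x \<in> carrier M; x' \<in> carrier M; y \<in> carrier N\<rbrakk> \<Longrightarrow>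
      f (x \<oplus>\<^bsub>M\<^esub> x') y = f x y \<oplus>\<^bsub>G\<^esub> f x' y"
    and right: "\<And>x y y'. \<lbrakk>x \<in> carrier M; y \<in> carrier N; y' \<in> carrier N\<rbrakk> \<Longrightarrow>
      f x (y \<oplus>\<^bsub>N\<^esub> y') = f x y \<oplus>\<^bsub>G\<^esub> f x y'"
    and balanced: "\<And>x s y. \<lbrakk>x \<in> carrier M; s \<in> S; y \<in> carrier N\<rbrakk> \<Longrightarrow>
      f (ra x s) y = f x (la s y)"
  obtains g where "g \<in> add_hom T G"
    and "\<And>x y. \<lbrakk>x \<in> carrier M; y \<in> carrier N\<rbrakk> \<Longrightarrow> g (pure x y) = f x y"
proof -
  interpret G: abelian_group G by fact
  obtain h where h: "h \<in> hom Free (add_monoid G)"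
    and h_of: "\<And>p. p \<in> carrier M \<times> carrier N \<Longrightarrow> h (frag_of p) = (case p of (x, y) \<Rightarrow> f x y)"
  proof (rule comm_group.free_Abelian_group_universal[OF G.a_comm_group,
        of "\<lambda>(x, y). f x y" "carrier M \<times> carrier N"])
    show "(\<lambda>(x, y). f x y) ` (carrier M \<times> carrier N) \<subseteq> carrier (add_monoid G)"
      using closed by auto
  qed blast
  interpret h: group_hom Free "add_monoid G" h
    using h G.a_group by (simp add: group_hom_def group_hom_axioms_def)
  have h_diff: "h (u - v) = h u \<ominus>\<^bsub>G\<^esub> h v" if "u \<in> carrier Free" "v \<in> carrier Free" for u v
    using h.hom_mult[OF that(1), of "- v"] h.hom_inv[OF that(2)] that
    by (simp add: a_minus_def a_inv_def)
  have h_closed: "h u \<in> carrier G" if "u \<in> carrier Free" for u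
    using h.hom_closed[OF that] by simp
  have "h r = \<zero>\<^bsub>G\<^esub>" if r: "r \<in> tensor_relations S ra la M N" for r
  proof -
    \<comment> \<open>Under h the two additivity relations become u + v - u - v, and the balancing
      relation becomes u - u.\<close>
    have cancel: "u \<oplus>\<^bsub>G\<^esub> v \<ominus>\<^bsub>G\<^esub> u \<ominus>\<^bsub>G\<^esub> v = \<zero>\<^bsub>G\<^esub>" 
      if "u \<in> carrier G" "v \<in> carrier G" for u v
      using that G.r_neg[of u] G.r_neg[of v] G.a_ac
      by (simp add: a_minus_def) (metis G.a_inv_closed G.r_neg1)
    have cancel': "u \<ominus>\<^bsub>G\<^esub> u = \<zero>\<^bsub>G\<^esub>" if "u \<in> carrier G" for u
      using that G.r_neg[of u] by (simp add: a_minus_def)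
    show ?thesis
      using r unfolding tensor_relations_def
      by (auto simp: h_diff Free_diff[unfolded carrier_free_Abelian_group_iff] h_of left right
            balanced ra_closed la_closed closed cancel cancel')
  qed
  then have "tensor_relations S ra la M N \<subseteq> kernel Free (add_monoid G) h"
    using relations_subset by (auto simp: kernel_def simp del: carrier_free_Abelian_group_iff)
  then have "Ker \<subseteq> kernel Free (add_monoid G) h"
    unfolding tensor_kernel_def
    by (rule group.generate_subgroup_incl[OF group_free_Abelian_group _ h.subgroup_kernel])
  then obtain g where g: "g \<in> hom (Free Mod Ker) (add_monoid G)"
      "\<And>x. x \<in> carrier Free \<Longrightarrow> g (Ker #>\<^bsub>Free\<^esub> x) = h x"
    using h.FactGroup_universal_kernel
      comm_group.subgroup_imp_normal[OF abelian_free_Abelian_group Ker_subgroup] by blast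
  show thesis
    by (rule that[of g]) (use g h_of in \<open>auto simp: hom_def tensor_def Let_def pure_tensor_def\<close>)
qed

end

text \<open>A left action of B on M that commutes with the right action of S passes to the tensor
  product. The case in use is \<open>carrier A\<close> acting on A by left multiplication, with
  scalars from \<open>carrier K\<close>.\<close>

locale bimodule_pair = balanced_pair S ra la M N
  for S :: "'s set" and ra :: "'m \<Rightarrow> 's \<Rightarrow> 'm" and la :: "'s \<Rightarrow> 'n \<Rightarrow> 'n"
    and M :: "('b, 'm) module" and N :: "('c, 'n) module" +
  fixes B :: "'b set"
  assumes smult_closed: "\<lbrakk>b \<in> B; x \<in> carrier M\<rbrakk> \<Longrightarrow> b \<odot>\<^bsub>M\<^esub> x \<in> carrier M"
    and smult_add: "\<lbrakk>b \<in> B; x \<in> carrier M; x' \<in> carrier M\<rbrakk> \<Longrightarrow>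
      b \<odot>\<^bsub>M\<^esub> (x \<oplus>\<^bsub>M\<^esub> x') = b \<odot>\<^bsub>M\<^esub> x \<oplus>\<^bsub>M\<^esub> b \<odot>\<^bsub>M\<^esub> x'"
    and smult_ra: "\<lbrakk>b \<in> B; x \<in> carrier M; s \<in> S\<rbrakk> \<Longrightarrow> b \<odot>\<^bsub>M\<^esub> ra x s = ra (b \<odot>\<^bsub>M\<^esub> x) s"
begin

context
  fixes b assumes b: "b \<in> B"
begin

abbreviation "act \<equiv> frag_extend (\<lambda>(x, y). frag_of (b \<odot>\<^bsub>M\<^esub> x, y))"

lemma act_hom: "act \<in> hom Free Free"
proof -
  have "act c \<in> carrier Free" if "c \<in> carrier Free" for c
    using that keys_frag_extend[of "\<lambda>(x, y). frag_of (b \<odot>\<^bsub>M\<^esub> x, y)" c] b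
    by (fastforce simp: keys_frag_of smult_closed split: prod.splits)
  then show ?thesis by (auto simp: hom_def frag_extend_add)
qed

text \<open>Replacing x by b x turns each relation into one of the same kind: the first kind by
  additivity of b, the third because b commutes with \<open>ra\<close>. A homomorphism maps a
  generated subgroup onto the subgroup generated by the image.\<close>

lemma act_Ker: "act ` Ker \<subseteq> Ker"
proof -
  interpret act: group_hom Free Free act
    using act_hom by (simp add: group_hom_def group_hom_axioms_def)
  have "act ` tensor_relations S ra la M N \<subseteq> tensor_relations S ra la M N"
  proof
    fix r assume "r \<in> act ` tensor_relations S ra la M N"
    then obtain c where "c \<in> tensor_relations S ra la M N" "r = act c" by blast
    then consider
        x x' y where "r = act (frag_of (x \<oplus>\<^bsub>M\<^esub> x', y) - frag_of (x, y) - frag_of (x', y))"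
          "x \<in> carrier M" "x' \<in> carrier M" "y \<in> carrier N"
      | x y y' where "r = act (frag_of (x, y \<oplus>\<^bsub>N\<^esub> y') - frag_of (x, y) - frag_of (x, y'))"
          "x \<in> carrier M" "y \<in> carrier N" "y' \<in> carrier N"
      | x s y where "r = act (frag_of (ra x s, y) - frag_of (x, la s y))"
          "x \<in> carrier M" "s \<in> S" "y \<in> carrier N"
      unfolding tensor_relations_def by blast
    then show "r \<in> tensor_relations S ra la M N"
    proof cases
      case 1
      then have "r = frag_of (b \<odot>\<^bsub>M\<^esub> x \<oplus>\<^bsub>M\<^esub> b \<odot>\<^bsub>M\<^esub> x', y) - frag_of (b \<odot>\<^bsub>M\<^esub> x, y) - frag_of (b \<odot>\<^bsub>M\<^esub> x', y)"
        using b by (simp add: frag_extend_diff smult_add)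
      then show ?thesis
        unfolding tensor_relations_def using 1 b by (blast intro: smult_closed)
    next
      case 2
      then have "r = frag_of (b \<odot>\<^bsub>M\<^esub> x, y \<oplus>\<^bsub>N\<^esub> y') - frag_of (b \<odot>\<^bsub>M\<^esub> x, y) - frag_of (b \<odot>\<^bsub>M\<^esub> x, y')"
        by (simp add: frag_extend_diff)
      then show ?thesis
        unfolding tensor_relations_def using 2 b by (blast intro: smult_closed)
    next
      case 3
      then have "r = frag_of (ra (b \<odot>\<^bsub>M\<^esub> x) s, y) - frag_of (b \<odot>\<^bsub>M\<^esub> x, la s y)"
        using b by (simp add: frag_extend_diff smult_ra)
      then show ?thesis
        unfolding tensor_relations_def using 3 b by (blast intro: smult_closed)
    qed
  qed
  moreover have "act ` Ker = generate Free (act ` tensor_relations S ra la M N)"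
    unfolding tensor_kernel_def using act.generate_img[OF relations_subset] by simp
  ultimately show ?thesis
    unfolding tensor_kernel_def using group.mono_generate[OF group_free_Abelian_group] by simp
qed

lemma tensor_smult_coset:
  "c \<in> carrier Free \<Longrightarrow> b \<odot>\<^bsub>T\<^esub> (Ker #>\<^bsub>Free\<^esub> c) = Ker #>\<^bsub>Free\<^esub> act c"
  using coset_hom_image[OF group_free_Abelian_group Ker_subgroup act_hom act_Ker]
  by (simp add: tensor_def Let_def)

lemma tensor_smult_hom: "(\<odot>\<^bsub>T\<^esub>) b \<in> add_hom T T"
proof (rule add_homI)
  fix s t assume "s \<in> carrier T" "t \<in> carrier T"
  then obtain c d where cd: "c \<in> carrier Free" "s = Ker #>\<^bsub>Free\<^esub> c" "d \<in> carrier Free" "t = Ker #>\<^bsub>Free\<^esub> d"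
    by (auto simp: tensor_carrier)
  have act: "act c \<in> carrier Free" "act d \<in> carrier Free" "c + d \<in> carrier Free"
    using cd hom_in_carrier[OF act_hom] Free_add by blast+
  then show "b \<odot>\<^bsub>T\<^esub> s \<in> carrier T" using cd by (simp only: tensor_smult_coset coset_in_tensor)
  show "b \<odot>\<^bsub>T\<^esub> (s \<oplus>\<^bsub>T\<^esub> t) = b \<odot>\<^bsub>T\<^esub> s \<oplus>\<^bsub>T\<^esub> b \<odot>\<^bsub>T\<^esub> t"
    using cd act by (simp only: tensor_smult_coset coset_add frag_extend_add)
qed

lemma tensor_smult_pure:
  "\<lbrakk>x \<in> carrier M; y \<in> carrier N\<rbrakk> \<Longrightarrow> b \<odot>\<^bsub>T\<^esub> pure x y = pure (b \<odot>\<^bsub>M\<^esub> x) y"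
  unfolding pure_tensor_def by (subst tensor_smult_coset) simp_all

end

end


section \<open>Left modules\<close>

lemma left_moduleI:
  assumes "ring R" "abelian_group M"
    and "\<And>a x. \<lbrakk>a \<in> carrier R; x \<in> carrier M\<rbrakk> \<Longrightarrow> a \<odot>\<^bsub>M\<^esub> x \<in> carrier M"
    and "\<And>a b x. \<lbrakk>a \<in> carrier R; b \<in> carrier R; x \<in> carrier M\<rbrakk> \<Longrightarrow>
      (a \<oplus>\<^bsub>R\<^esub> b) \<odot>\<^bsub>M\<^esub> x = a \<odot>\<^bsub>M\<^esub> x \<oplus>\<^bsub>M\<^esub> b \<odot>\<^bsub>M\<^esub> x"
    and "\<And>a x y. \<lbrakk>a \<in> carrier R; x \<in> carrier M; y \<in> carrier M\<rbrakk> \<Longrightarrow>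
      a \<odot>\<^bsub>M\<^esub> (x \<oplus>\<^bsub>M\<^esub> y) = a \<odot>\<^bsub>M\<^esub> x \<oplus>\<^bsub>M\<^esub> a \<odot>\<^bsub>M\<^esub> y"
    and "\<And>a b x. \<lbrakk>a \<in> carrier R; b \<in> carrier R; x \<in> carrier M\<rbrakk> \<Longrightarrow>
      (a \<otimes>\<^bsub>R\<^esub> b) \<odot>\<^bsub>M\<^esub> x = a \<odot>\<^bsub>M\<^esub> (b \<odot>\<^bsub>M\<^esub> x)"
    and "\<And>x. x \<in> carrier M \<Longrightarrow> \<one>\<^bsub>R\<^esub> \<odot>\<^bsub>M\<^esub> x = x"
  shows "left_module R M"
  using assms by (intro left_module.intro left_module_axioms.intro) auto

lemma left_module_ring: "left_module R M \<Longrightarrow> ring R"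
  and left_module_group: "left_module R M \<Longrightarrow> abelian_group M"
  by (simp_all add: left_module_def)

lemma lsmult_hom: "\<lbrakk>left_module R M; a \<in> carrier R\<rbrakk> \<Longrightarrow> (\<odot>\<^bsub>M\<^esub>) a \<in> add_hom M M"
  by (intro add_homI) (auto simp: left_module.lsmult_closed left_module.lsmult_r_distr)

lemma left_linearI:
  assumes "f \<in> add_hom M N"
    and "\<And>a x. \<lbrakk>a \<in> carrier R; x \<in> carrier M\<rbrakk> \<Longrightarrow> f (a \<odot>\<^bsub>M\<^esub> x) = a \<odot>\<^bsub>N\<^esub> f x"
  shows "f \<in> left_linear R M N"
  using assms by (simp add: left_linear_def)

lemma left_linear_hom: "f \<in> left_linear R M N \<Longrightarrow> f \<in> add_hom M N"
  by (simp add: left_linear_def)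

lemma left_linear_smult:
  "\<lbrakk>f \<in> left_linear R M N; a \<in> carrier R; x \<in> carrier M\<rbrakk> \<Longrightarrow> f (a \<odot>\<^bsub>M\<^esub> x) = a \<odot>\<^bsub>N\<^esub> f x"
  by (simp add: left_linear_def)

lemma left_linear_comp:
  "\<lbrakk>f \<in> left_linear R L M; g \<in> left_linear R M N\<rbrakk> \<Longrightarrow> (\<lambda>x. g (f x)) \<in> left_linear R L N"
  by (rule left_linearI)
     (auto intro: add_hom_comp left_linear_hom
       simp: left_linear_smult add_hom_closed[OF left_linear_hom])

text \<open>Here 0 x = 0 by cancellation, and then -1 + 1 = 0 is applied to x. The purpose is to
  obtain additive inverses from the action, so that a subset stable under scalars is stable under
  negation.\<close>

lemma left_module_neg_one:
  assumes "left_module R M" "x \<in> carrier M"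
  shows "(\<ominus>\<^bsub>R\<^esub> \<one>\<^bsub>R\<^esub>) \<odot>\<^bsub>M\<^esub> x \<oplus>\<^bsub>M\<^esub> x = \<zero>\<^bsub>M\<^esub>"
proof -
  interpret R: ring R using assms(1) by (rule left_module_ring)
  interpret M: abelian_group M using assms(1) by (rule left_module_group)
  note smult = left_module.lsmult_closed[OF assms(1)] left_module.lsmult_one[OF assms]
  have "\<zero>\<^bsub>R\<^esub> \<odot>\<^bsub>M\<^esub> x \<oplus>\<^bsub>M\<^esub> x = (\<zero>\<^bsub>R\<^esub> \<oplus>\<^bsub>R\<^esub> \<one>\<^bsub>R\<^esub>) \<odot>\<^bsub>M\<^esub> x"
    using assms smult by (simp add: left_module.lsmult_l_distr[OF assms(1)] del: R.l_zero R.r_zero)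
  then have "\<zero>\<^bsub>R\<^esub> \<odot>\<^bsub>M\<^esub> x \<oplus>\<^bsub>M\<^esub> x = x" using smult by simp
  then have "\<zero>\<^bsub>R\<^esub> \<odot>\<^bsub>M\<^esub> x = \<zero>\<^bsub>M\<^esub>" using assms(2) smult(1) by simp
  moreover have "(\<ominus>\<^bsub>R\<^esub> \<one>\<^bsub>R\<^esub> \<oplus>\<^bsub>R\<^esub> \<one>\<^bsub>R\<^esub>) \<odot>\<^bsub>M\<^esub> x = (\<ominus>\<^bsub>R\<^esub> \<one>\<^bsub>R\<^esub>) \<odot>\<^bsub>M\<^esub> x \<oplus>\<^bsub>M\<^esub> x"
    using left_module.lsmult_l_distr[OF assms(1), of "\<ominus>\<^bsub>R\<^esub> \<one>\<^bsub>R\<^esub>" "\<one>\<^bsub>R\<^esub>" x] assms smult by simp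
  ultimately show ?thesis by (simp add: R.l_neg)
qed

lemma left_module_submodule:
  assumes M: "left_module R M" and "H \<subseteq> carrier M" "\<zero>\<^bsub>M\<^esub> \<in> H"
    and add: "\<And>x y. \<lbrakk>x \<in> H; y \<in> H\<rbrakk> \<Longrightarrow> x \<oplus>\<^bsub>M\<^esub> y \<in> H"
    and smult: "\<And>a x. \<lbrakk>a \<in> carrier R; x \<in> H\<rbrakk> \<Longrightarrow> a \<odot>\<^bsub>M\<^esub> x \<in> H"
  shows "left_module R (M\<lparr>carrier := H\<rparr>)"
proof (rule left_moduleI)
  show R: "ring R" using M by (rule left_module_ring)
  interpret R: ring R by fact
  interpret M: abelian_group M using M by (rule left_module_group)
  have H: "x \<in> carrier M" if "x \<in> H" for x using that assms(2) by blast
  show "abelian_group (M\<lparr>carrier := H\<rparr>)"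
  proof (rule abelian_groupI)
    fix x assume "x \<in> carrier (M\<lparr>carrier := H\<rparr>)"
    then show "\<exists>y\<in>carrier (M\<lparr>carrier := H\<rparr>). y \<oplus>\<^bsub>M\<lparr>carrier := H\<rparr>\<^esub> x = \<zero>\<^bsub>M\<lparr>carrier := H\<rparr>\<^esub>"
      using left_module_neg_one[OF M, of x] H smult
      by (intro bexI[of _ "(\<ominus>\<^bsub>R\<^esub> \<one>\<^bsub>R\<^esub>) \<odot>\<^bsub>M\<^esub> x"]) auto
  qed (use assms(3) add H in \<open>auto simp: M.a_ac\<close>)
qed (use subsetD[OF assms(2)] smult M in \<open>auto simp: left_module.lsmult_l_distr left_module.lsmult_r_distr
        left_module.lsmult_assoc left_module.lsmult_one\<close>)

text \<open>The inclusion is a restricted function, as in the recursion for \<open>jets\<close>;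
  closure of H under the operations keeps sums and multiples where this function is the
  identity.\<close>

lemma left_linear_inclusion:
  assumes "left_module R (M\<lparr>carrier := H\<rparr>)" "H \<subseteq> carrier M"
  shows "(\<lambda>x\<in>H. x) \<in> left_linear R (M\<lparr>carrier := H\<rparr>) M"
proof -
  interpret abelian_group "M\<lparr>carrier := H\<rparr>" by (rule left_module_group[OF assms(1)])
  show ?thesis
  proof (rule left_linearI)
    show "(\<lambda>x\<in>H. x) \<in> add_hom (M\<lparr>carrier := H\<rparr>) M"
      using assms(2) a_closed by (intro add_homI) auto
    show "(\<lambda>x\<in>H. x) (a \<odot>\<^bsub>M\<lparr>carrier := H\<rparr>\<^esub> x) = a \<odot>\<^bsub>M\<^esub> (\<lambda>x\<in>H. x) x"
      if "a \<in> carrier R" "x \<in> carrier (M\<lparr>carrier := H\<rparr>)" for a x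
      using that left_module.lsmult_closed[OF assms(1) that] by simp
  qed
qed

section \<open>Quotients of left modules\<close>

lemma quotient_module_group:
  assumes "abelian_group M" "subgroup N (add_monoid M)"
  shows "abelian_group (quotient_module M N)"
    and "carrier (quotient_module M N) = (\<lambda>x. N +>\<^bsub>M\<^esub> x) ` carrier M"
    and "(\<lambda>x. N +>\<^bsub>M\<^esub> x) \<in> add_hom M (quotient_module M N)"
    and "x \<in> carrier M \<Longrightarrow> N +>\<^bsub>M\<^esub> x = \<zero>\<^bsub>quotient_module M N\<^esub> \<longleftrightarrow> x \<in> N"
proof -
  note comm = abelian_group.a_comm_group[OF assms(1)]
  note defs = quotient_module_def A_RCOSETS_def a_r_coset_def set_add_def
  show "abelian_group (quotient_module M N)"
    by (rule abelian_group_of_comm_group[OF comm_group_FactGroup[OF comm assms(2)]])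
       (simp_all add: defs FactGroup_def)
  show car: "carrier (quotient_module M N) = (\<lambda>x. N +>\<^bsub>M\<^esub> x) ` carrier M"
    by (auto simp: defs RCOSETS_def)
  show "(\<lambda>x. N +>\<^bsub>M\<^esub> x) \<in> add_hom M (quotient_module M N)"
    using r_coset_add_FactGroup[OF comm assms(2)]
    by (intro add_homI) (simp add: car, simp add: defs)
  show "N +>\<^bsub>M\<^esub> x = \<zero>\<^bsub>quotient_module M N\<^esub> \<longleftrightarrow> x \<in> N" if "x \<in> carrier M"
    using r_coset_eq_one_iff[OF abelian_group.a_group[OF assms(1)] assms(2), of x] that
    by (simp add: defs)
qed

text \<open>This is \<open>coset_hom_image\<close> for the additive endomorphism given by the scalar
  a.\<close>

lemma quotient_module_smult:
  assumes "left_module R M" "subgroup N (add_monoid M)"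
    and "\<And>x. x \<in> N \<Longrightarrow> a \<odot>\<^bsub>M\<^esub> x \<in> N" "a \<in> carrier R" "x \<in> carrier M"
  shows "a \<odot>\<^bsub>quotient_module M N\<^esub> (N +>\<^bsub>M\<^esub> x) = N +>\<^bsub>M\<^esub> (a \<odot>\<^bsub>M\<^esub> x)"
  using coset_hom_image[OF abelian_group.a_group[OF left_module_group[OF assms(1)]] assms(2)
      lsmult_hom[OF assms(1,4)], of x] assms
  by (auto simp: quotient_module_def a_r_coset_def)

lemma left_module_quotient:
  assumes M: "left_module R M" and N: "subgroup N (add_monoid M)"
    and smult: "\<And>a x. \<lbrakk>a \<in> carrier R; x \<in> N\<rbrakk> \<Longrightarrow> a \<odot>\<^bsub>M\<^esub> x \<in> N"
  shows "left_module R (quotient_module M N)"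
    and "(\<lambda>x. N +>\<^bsub>M\<^esub> x) \<in> left_linear R M (quotient_module M N)"
proof -
  note q = quotient_module_group[OF left_module_group[OF M] N]
  note qs = quotient_module_smult[OF M N smult]
  interpret R: ring R using M by (rule left_module_ring)
  interpret M: left_module R M by fact
  note qa = add_hom_add[OF q(3), symmetric]
  show "left_module R (quotient_module M N)"
    by (rule left_moduleI)
       (use q(1) in \<open>auto simp: q(2) qs qa M.lsmult_closed M.lsmult_l_distr M.lsmult_r_distr
          M.lsmult_assoc M.lsmult_one R.ring_axioms\<close>)
  show "(\<lambda>x. N +>\<^bsub>M\<^esub> x) \<in> left_linear R M (quotient_module M N)"
    by (rule left_linearI) (use q(3) qs in auto)
qed

lemma quotient_module_lift:
  assumes M: "abelian_group M" and N: "subgroup N (add_monoid M)" and G: "abelian_group G"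
    and f: "f \<in> add_hom M G" and zero: "\<And>x. x \<in> N \<Longrightarrow> f x = \<zero>\<^bsub>G\<^esub>"
  obtains g where "g \<in> add_hom (quotient_module M N) G"
    and "\<And>x. x \<in> carrier M \<Longrightarrow> g (N +>\<^bsub>M\<^esub> x) = f x"
proof -
  note comm = abelian_group.a_comm_group[OF M]
  interpret f: group_hom "add_monoid M" "add_monoid G" f
    using f M G by (simp add: group_hom_def group_hom_axioms_def abelian_group.a_group)
  have "N \<subseteq> kernel (add_monoid M) (add_monoid G) f"
    using zero subgroup.subset[OF N] by (auto simp: kernel_def)
  then obtain g where g: "g \<in> hom (add_monoid M Mod N) (add_monoid G)"
      "\<And>x. x \<in> carrier (add_monoid M) \<Longrightarrow> g (N #>\<^bsub>add_monoid M\<^esub> x) = f x"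
    using f.FactGroup_universal_kernel comm_group.subgroup_imp_normal[OF comm N] by blast
  show thesis
    by (rule that[of g])
       (use g in \<open>auto simp: hom_def quotient_module_def A_RCOSETS_def a_r_coset_def set_add_def FactGroup_def\<close>)
qed

section \<open>Transport of structure along an injection\<close>

lemma transport_facts:
  assumes "inj_on h (carrier M)"
  shows "carrier (transport h M) = h ` carrier M" "\<zero>\<^bsub>transport h M\<^esub> = h \<zero>\<^bsub>M\<^esub>"
    and "\<lbrakk>x \<in> carrier M; y \<in> carrier M\<rbrakk> \<Longrightarrow> h x \<oplus>\<^bsub>transport h M\<^esub> h y = h (x \<oplus>\<^bsub>M\<^esub> y)"
    and "x \<in> carrier M \<Longrightarrow> a \<odot>\<^bsub>transport h M\<^esub> h x = h (a \<odot>\<^bsub>M\<^esub> x)"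
  using assms by (simp_all add: transport_def Let_def)

lemma left_module_transport:
  assumes M: "left_module R M" and h: "inj_on h (carrier M)"
  shows "left_module R (transport h M)"
proof -
  interpret R: ring R using M by (rule left_module_ring)
  interpret Mg: abelian_group M using M by (rule left_module_group)
  interpret M: left_module R M by fact
  note t = transport_facts[OF h]
  have "abelian_group (transport h M)"
  proof (rule abelian_groupI)
    fix x assume "x \<in> carrier (transport h M)"
    then obtain z where z: "z \<in> carrier M" "x = h z" by (auto simp: t)
    then show "\<exists>y\<in>carrier (transport h M). y \<oplus>\<^bsub>transport h M\<^esub> x = \<zero>\<^bsub>transport h M\<^esub>"
      by (intro bexI[of _ "h (\<ominus>\<^bsub>M\<^esub> z)"]) (auto simp: t Mg.l_neg)
  qed (auto simp: t Mg.a_ac)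
  then show ?thesis
    by (intro left_moduleI) (auto simp: t M.lsmult_closed M.lsmult_l_distr M.lsmult_r_distr
          M.lsmult_assoc M.lsmult_one R.ring_axioms)
qed

lemma transport_hom:
  assumes "abelian_group M" "inj_on h (carrier M)"
  shows "h \<in> add_hom M (transport h M)" "inv_into (carrier M) h \<in> add_hom (transport h M) M"
proof -
  interpret abelian_group M by fact
  note t = transport_facts[OF assms(2)]
  show "h \<in> add_hom M (transport h M)" by (rule add_homI) (auto simp: t)
  show "inv_into (carrier M) h \<in> add_hom (transport h M) M"
    by (rule add_homI) (auto simp: t assms(2))
qed


section \<open>Forms with values in a module\<close>

context exterior_algebra
begin

lemma Omega_ring: "ring \<Omega>"
  by unfold_locales

lemmas Omega_l_neg = abelian_group.l_neg[OF ring.is_abelian_group[OF Omega_ring]]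

lemma A_ring: "ring A"
  using A.B.ring_axioms .

lemma carrier_A: "carrier A = grade \<Omega> 0"
  and mult_A: "x \<otimes>\<^bsub>A\<^esub> y = x \<otimes>\<^bsub>\<Omega>\<^esub> y"
  and one_A: "\<one>\<^bsub>A\<^esub> = \<one>\<^bsub>\<Omega>\<^esub>"
  and add_A: "x \<oplus>\<^bsub>A\<^esub> y = x \<oplus>\<^bsub>\<Omega>\<^esub> y"
  and smult_A: "k \<odot>\<^bsub>A\<^esub> x = k \<odot>\<^bsub>\<Omega>\<^esub> x"
  by (subst degree_zero, simp)+

lemma carrier_forms [simp]: "carrier (forms \<Omega> p) = grade \<Omega> p"
  and add_forms [simp]: "x \<oplus>\<^bsub>forms \<Omega> p\<^esub> y = x \<oplus>\<^bsub>\<Omega>\<^esub> y"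
  and zero_forms [simp]: "\<zero>\<^bsub>forms \<Omega> p\<^esub> = \<zero>\<^bsub>\<Omega>\<^esub>"
  and smult_forms [simp]: "x \<odot>\<^bsub>forms \<Omega> p\<^esub> y = x \<otimes>\<^bsub>\<Omega>\<^esub> y"
  by (simp_all add: forms_def)

lemma grade_subgroup: "subgroup (grade \<Omega> p) (add_monoid \<Omega>)"
  using grade_submodule[of p] by (rule submodule.axioms(1))

lemma grade_closed: "w \<in> grade \<Omega> p \<Longrightarrow> w \<in> carrier \<Omega>"
  using subgroup.subset[OF grade_subgroup[of p]] by auto

lemma grade_add: "\<lbrakk>v \<in> grade \<Omega> p; w \<in> grade \<Omega> p\<rbrakk> \<Longrightarrow> v \<oplus>\<^bsub>\<Omega>\<^esub> w \<in> grade \<Omega> p"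
  using subgroup.m_closed[OF grade_subgroup[of p]] by simp

lemma grade_zero: "\<zero>\<^bsub>\<Omega>\<^esub> \<in> grade \<Omega> p"
  using subgroup.one_closed[OF grade_subgroup[of p]] by simp

lemma grade_neg: "w \<in> grade \<Omega> p \<Longrightarrow> \<ominus>\<^bsub>\<Omega>\<^esub> w \<in> grade \<Omega> p"
  using subgroup.m_inv_closed[OF grade_subgroup[of p]] by (simp add: a_inv_def)

lemma grade_mult_A: "\<lbrakk>w \<in> grade \<Omega> p; a \<in> carrier A\<rbrakk> \<Longrightarrow> w \<otimes>\<^bsub>\<Omega>\<^esub> a \<in> grade \<Omega> p"
  using grade_mult[of w p a 0] by (simp add: carrier_A)

lemma A_mult_grade: "\<lbrakk>a \<in> carrier A; w \<in> grade \<Omega> p\<rbrakk> \<Longrightarrow> a \<otimes>\<^bsub>\<Omega>\<^esub> w \<in> grade \<Omega> p"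
  using grade_mult[of a 0 w p] by (simp add: carrier_A)

lemma A_closed: "a \<in> carrier A \<Longrightarrow> a \<in> carrier \<Omega>"
  using grade_closed by (simp add: carrier_A)

lemma diff_A: "a \<in> carrier A \<Longrightarrow> diff \<Omega> a \<in> grade \<Omega> 1"
  using diff_grade[of a 0] by (simp add: carrier_A)

lemma diff_grade1: "w \<in> grade \<Omega> 1 \<Longrightarrow> diff \<Omega> w \<in> grade \<Omega> 2"
  using diff_grade[of w 1] by (simp add: numeral_2_eq_2)

lemma diff_add: "\<lbrakk>v \<in> carrier \<Omega>; w \<in> carrier \<Omega>\<rbrakk> \<Longrightarrow> diff \<Omega> (v \<oplus>\<^bsub>\<Omega>\<^esub> w) = diff \<Omega> v \<oplus>\<^bsub>\<Omega>\<^esub> diff \<Omega> w"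
  using add_hom_add[OF diff_hom] .

lemma diff_A_mult:
  assumes "a \<in> carrier A" "w \<in> carrier \<Omega>"
  shows "diff \<Omega> (a \<otimes>\<^bsub>\<Omega>\<^esub> w) = diff \<Omega> a \<otimes>\<^bsub>\<Omega>\<^esub> w \<oplus>\<^bsub>\<Omega>\<^esub> a \<otimes>\<^bsub>\<Omega>\<^esub> diff \<Omega> w"
proof -
  have "diff \<Omega> w \<in> carrier \<Omega>" using add_hom_closed[OF diff_hom] assms by simp
  then show ?thesis
    using Leibniz[of a 0 w] assms A_closed by (simp add: carrier_A)
qed

text \<open>The minus is the Leibniz sign in degree 1. It is what later balances the wedge product
  of a 1-form with the derivation \<open>jet1_form\<close>.\<close>

lemma diff_mult_A:
  assumes "w \<in> grade \<Omega> 1" "a \<in> carrier A"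
  shows "diff \<Omega> (w \<otimes>\<^bsub>\<Omega>\<^esub> a) = diff \<Omega> w \<otimes>\<^bsub>\<Omega>\<^esub> a \<ominus>\<^bsub>\<Omega>\<^esub> w \<otimes>\<^bsub>\<Omega>\<^esub> diff \<Omega> a"
proof -
  have "diff \<Omega> a \<in> carrier \<Omega>" using add_hom_closed[OF diff_hom] assms A_closed by simp
  then show ?thesis
    using Leibniz[of w 1 a] assms A_closed grade_closed[OF assms(1)]
    by (simp add: B.l_minus a_minus_def)
qed

lemma forms_group: "abelian_group (forms \<Omega> p)"
proof (rule abelian_groupI)
  fix x assume "x \<in> carrier (forms \<Omega> p)"
  then show "\<exists>y\<in>carrier (forms \<Omega> p). y \<oplus>\<^bsub>forms \<Omega> p\<^esub> x = \<zero>\<^bsub>forms \<Omega> p\<^esub>"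
    using grade_closed Omega_l_neg grade_neg by (intro bexI[of _ "\<ominus>\<^bsub>\<Omega>\<^esub> x"]) auto
next
  show "x \<oplus>\<^bsub>forms \<Omega> p\<^esub> y \<oplus>\<^bsub>forms \<Omega> p\<^esub> z = x \<oplus>\<^bsub>forms \<Omega> p\<^esub> (y \<oplus>\<^bsub>forms \<Omega> p\<^esub> z)"
    "x \<oplus>\<^bsub>forms \<Omega> p\<^esub> y = y \<oplus>\<^bsub>forms \<Omega> p\<^esub> x" "\<zero>\<^bsub>forms \<Omega> p\<^esub> \<oplus>\<^bsub>forms \<Omega> p\<^esub> x = x"
    if "x \<in> carrier (forms \<Omega> p)" "y \<in> carrier (forms \<Omega> p)" "z \<in> carrier (forms \<Omega> p)" for x y z
    using that grade_closed by (auto simp: M.a_ac)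
qed (auto simp: grade_add grade_zero)

text \<open>\<open>a_inv\<close> is a definite description relative to the carrier of its record, so
  negation in \<open>forms\<close> and in the total algebra agree only because negatives of
  homogeneous forms are homogeneous of the same degree.\<close>

lemma forms_neg: "w \<in> grade \<Omega> p \<Longrightarrow> \<ominus>\<^bsub>forms \<Omega> p\<^esub> w = \<ominus>\<^bsub>\<Omega>\<^esub> w"
proof -
  assume "w \<in> grade \<Omega> p"
  then show ?thesis
    using grade_closed Omega_l_neg grade_neg
    by (intro abelian_group.minus_equality[OF forms_group]) auto
qed

lemma forms_pair:
  assumes "left_module A M"
  shows "balanced_pair (carrier A) (monoid.mult \<Omega>) (smult M) (forms \<Omega> p) M"
  using assms
  by (simp add: balanced_pair_def forms_group left_module_group grade_mult_A
      left_module.lsmult_closed)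

text \<open>The rules of the tensor locale are restated with \<open>forms_in\<close>,
  \<open>form_tensor\<close> and \<open>grade\<close>, which keeps the quotient construction out of
  sight.\<close>

lemmas forms_in_group = balanced_pair.tensor_group
    [OF forms_pair, folded forms_in_def]
  and form_tensor_closed = balanced_pair.pure_closed
    [OF forms_pair, folded forms_in_def form_tensor_def, unfolded carrier_forms]
  and form_tensor_add_left = balanced_pair.pure_add_left
    [OF forms_pair, folded forms_in_def form_tensor_def, unfolded carrier_forms add_forms]
  and form_tensor_add_right = balanced_pair.pure_add_right
    [OF forms_pair, folded forms_in_def form_tensor_def, unfolded carrier_forms]
  and form_tensor_balanced = balanced_pair.pure_balanced
    [OF forms_pair, folded forms_in_def form_tensor_def, unfolded carrier_forms]
  and form_tensor_zero_left = balanced_pair.pure_zero_left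
    [OF forms_pair, folded forms_in_def form_tensor_def, unfolded zero_forms]
  and form_tensor_neg_left = balanced_pair.pure_neg_left
    [OF forms_pair, folded forms_in_def form_tensor_def, unfolded carrier_forms]
  and form_tensor_hom_right = balanced_pair.pure_hom_right
    [OF forms_pair, folded forms_in_def form_tensor_def, unfolded carrier_forms]
  and forms_in_induct = balanced_pair.tensor_induct
    [OF forms_pair, folded forms_in_def form_tensor_def, unfolded carrier_forms,
      consumes 2, case_names zero tensor add]
  and forms_in_lift = balanced_pair.tensor_lift
    [OF forms_pair, folded forms_in_def form_tensor_def, unfolded carrier_forms add_forms]

text \<open>Prototype of a recurring principle: additive maps are compared on additive generators.
  \<open>A_tensor_hom_eq\<close>, \<open>jet1_hom_eq\<close> and \<open>jet2_hom_eq\<close> are its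
  analogues, and most identities between maps below are obtained in this way.\<close>

lemma forms_in_hom_eq:
  assumes M: "left_module A M" and G: "abelian_group G"
    and f: "f \<in> add_hom (forms_in A \<Omega> p M) G" and g: "g \<in> add_hom (forms_in A \<Omega> p M) G"
    and eq: "\<And>w m. \<lbrakk>w \<in> grade \<Omega> p; m \<in> carrier M\<rbrakk> \<Longrightarrow>
      f (form_tensor A \<Omega> p M w m) = g (form_tensor A \<Omega> p M w m)"
    and t: "t \<in> carrier (forms_in A \<Omega> p M)"
  shows "f t = g t"
  using M t
proof (induction t rule: forms_in_induct)
  case zero
  then show ?case using f g G forms_in_group[OF M] by (simp add: add_hom_zero)
next
  case (tensor w m)
  then show ?case by (rule eq)
next
  case (add u v)
  then show ?case using f g by (simp add: add_hom_add)
qed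

lemma form_tensor_diff_left:
  assumes M: "left_module A M" and "v \<in> grade \<Omega> p" "w \<in> grade \<Omega> p" "m \<in> carrier M"
  shows "form_tensor A \<Omega> p M (v \<ominus>\<^bsub>\<Omega>\<^esub> w) m
    = form_tensor A \<Omega> p M v m \<ominus>\<^bsub>forms_in A \<Omega> p M\<^esub> form_tensor A \<Omega> p M w m"
  using form_tensor_neg_left[OF M assms(4,3)] assms
  by (simp add: a_minus_def form_tensor_add_left forms_neg grade_neg)

text \<open>The map usually written id \<otimes> f. Linearity of f over A enters in the balancing
  condition w a \<otimes> f(x) = w \<otimes> f(a x).\<close>

lemma forms_in_map:
  assumes M: "left_module A M" and N: "left_module A N" and f: "f \<in> left_linear A M N"
  obtains g where "g \<in> add_hom (forms_in A \<Omega> p M) (forms_in A \<Omega> p N)"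
    and "\<And>w m. \<lbrakk>w \<in> grade \<Omega> p; m \<in> carrier M\<rbrakk> \<Longrightarrow>
      g (form_tensor A \<Omega> p M w m) = form_tensor A \<Omega> p N w (f m)"
proof (rule forms_in_lift[OF M forms_in_group[OF N], of p "\<lambda>w m. form_tensor A \<Omega> p N w (f m)"])
  note fh = left_linear_hom[OF f]
  fix v w a x y
  show "form_tensor A \<Omega> p N v (f x) \<in> carrier (forms_in A \<Omega> p N)"
    if "v \<in> grade \<Omega> p" "x \<in> carrier M"
    using that N fh by (simp add: form_tensor_closed add_hom_closed)
  show "form_tensor A \<Omega> p N (v \<oplus>\<^bsub>\<Omega>\<^esub> w) (f x) =
      form_tensor A \<Omega> p N v (f x) \<oplus>\<^bsub>forms_in A \<Omega> p N\<^esub> form_tensor A \<Omega> p N w (f x)"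
    if "v \<in> grade \<Omega> p" "w \<in> grade \<Omega> p" "x \<in> carrier M"
    using that N fh by (simp add: form_tensor_add_left add_hom_closed)
  show "form_tensor A \<Omega> p N v (f (x \<oplus>\<^bsub>M\<^esub> y)) =
      form_tensor A \<Omega> p N v (f x) \<oplus>\<^bsub>forms_in A \<Omega> p N\<^esub> form_tensor A \<Omega> p N v (f y)"
    if "v \<in> grade \<Omega> p" "x \<in> carrier M" "y \<in> carrier M"
    using that N fh by (simp add: form_tensor_add_right add_hom_closed add_hom_add)
  show "form_tensor A \<Omega> p N (v \<otimes>\<^bsub>\<Omega>\<^esub> a) (f x) = form_tensor A \<Omega> p N v (f (a \<odot>\<^bsub>M\<^esub> x))"
    if "v \<in> grade \<Omega> p" "a \<in> carrier A" "x \<in> carrier M"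
    using that N f fh by (simp add: left_linear_smult form_tensor_balanced add_hom_closed)
qed (use that in auto)

text \<open>Left multiplication by the form v of degree q; for q = 0 it is the left action of A on
  forms with values in M. A choice suffices, because additive maps with these values on elementary
  tensors agree on the whole carrier.\<close>

definition wedge :: "nat \<Rightarrow> nat \<Rightarrow> ('w, 'm) module \<Rightarrow> 'w \<Rightarrow> (('w \<times> 'm) \<Rightarrow>\<^sub>0 int) set \<Rightarrow> (('w \<times> 'm) \<Rightarrow>\<^sub>0 int) set" where
  "wedge q p M v = (SOME g. g \<in> add_hom (forms_in A \<Omega> p M) (forms_in A \<Omega> (q + p) M) \<and>
     (\<forall>w\<in>grade \<Omega> p. \<forall>m\<in>carrier M.
        g (form_tensor A \<Omega> p M w m) = form_tensor A \<Omega> (q + p) M (v \<otimes>\<^bsub>\<Omega>\<^esub> w) m))"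

text \<open>Left multiplication by v commutes with right multiplication by elements of A, by
  associativity, and so descends to the tensor product over A.\<close>

lemma
  assumes M: "left_module A M" and v: "v \<in> grade \<Omega> q"
  shows wedge_hom: "wedge q p M v \<in> add_hom (forms_in A \<Omega> p M) (forms_in A \<Omega> (q + p) M)"
    and wedge_tensor: "\<lbrakk>w \<in> grade \<Omega> p; m \<in> carrier M\<rbrakk> \<Longrightarrow>
      wedge q p M v (form_tensor A \<Omega> p M w m) = form_tensor A \<Omega> (q + p) M (v \<otimes>\<^bsub>\<Omega>\<^esub> w) m"
proof -
  obtain g where g: "g \<in> add_hom (forms_in A \<Omega> p M) (forms_in A \<Omega> (q + p) M)"
    "\<And>w m. \<lbrakk>w \<in> grade \<Omega> p; m \<in> carrier M\<rbrakk> \<Longrightarrow>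
      g (form_tensor A \<Omega> p M w m) = form_tensor A \<Omega> (q + p) M (v \<otimes>\<^bsub>\<Omega>\<^esub> w) m"
  proof (rule forms_in_lift[OF M forms_in_group[OF M],
        of p "\<lambda>w m. form_tensor A \<Omega> (q + p) M (v \<otimes>\<^bsub>\<Omega>\<^esub> w) m" "q + p"])
    fix u w a x y
    show "form_tensor A \<Omega> (q + p) M (v \<otimes>\<^bsub>\<Omega>\<^esub> (u \<otimes>\<^bsub>\<Omega>\<^esub> a)) x
        = form_tensor A \<Omega> (q + p) M (v \<otimes>\<^bsub>\<Omega>\<^esub> u) (a \<odot>\<^bsub>M\<^esub> x)"
      if "u \<in> grade \<Omega> p" "a \<in> carrier A" "x \<in> carrier M"
      using that v M by (simp add: form_tensor_balanced[symmetric] grade_mult grade_closed A_closed B.m_assoc)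
  qed (use v M in \<open>auto simp: form_tensor_closed form_tensor_add_left form_tensor_add_right
      grade_mult B.r_distr grade_closed\<close>)
  have "wedge q p M v \<in> add_hom (forms_in A \<Omega> p M) (forms_in A \<Omega> (q + p) M) \<and>
     (\<forall>w\<in>grade \<Omega> p. \<forall>m\<in>carrier M.
        wedge q p M v (form_tensor A \<Omega> p M w m) = form_tensor A \<Omega> (q + p) M (v \<otimes>\<^bsub>\<Omega>\<^esub> w) m)"
    unfolding wedge_def by (rule someI[of _ g]) (use g in blast)
  then show "wedge q p M v \<in> add_hom (forms_in A \<Omega> p M) (forms_in A \<Omega> (q + p) M)"
    and "\<lbrakk>w \<in> grade \<Omega> p; m \<in> carrier M\<rbrakk> \<Longrightarrow>
      wedge q p M v (form_tensor A \<Omega> p M w m) = form_tensor A \<Omega> (q + p) M (v \<otimes>\<^bsub>\<Omega>\<^esub> w) m"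
    by blast+
qed

lemma wedge_add:
  assumes M: "left_module A M" and "v \<in> grade \<Omega> q" "v' \<in> grade \<Omega> q"
    and t: "t \<in> carrier (forms_in A \<Omega> p M)"
  shows "wedge q p M (v \<oplus>\<^bsub>\<Omega>\<^esub> v') t = wedge q p M v t \<oplus>\<^bsub>forms_in A \<Omega> (q + p) M\<^esub> wedge q p M v' t"
proof (rule forms_in_hom_eq[OF M forms_in_group[OF M] _ _ _ t])
  fix w m assume "w \<in> grade \<Omega> p" "m \<in> carrier M"
  then show "wedge q p M (v \<oplus>\<^bsub>\<Omega>\<^esub> v') (form_tensor A \<Omega> p M w m) = wedge q p M v (form_tensor A \<Omega> p M w m)
      \<oplus>\<^bsub>forms_in A \<Omega> (q + p) M\<^esub> wedge q p M v' (form_tensor A \<Omega> p M w m)"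
    using assms by (simp add: wedge_tensor grade_add grade_closed B.l_distr form_tensor_add_left grade_mult)
qed (use assms in \<open>auto intro!: add_hom_sum wedge_hom forms_in_group grade_add\<close>)

text \<open>A scalar moves from the left of t to the right of v. Together with
  \<open>wedge_add\<close> this is what is needed to lift a map that takes the form v as its first
  argument.\<close>

lemma wedge_wedge_A:
  assumes M: "left_module A M" and v: "v \<in> grade \<Omega> q" and a: "a \<in> carrier A"
    and t: "t \<in> carrier (forms_in A \<Omega> p M)"
  shows "wedge q p M v (wedge 0 p M a t) = wedge q p M (v \<otimes>\<^bsub>\<Omega>\<^esub> a) t"
proof (rule forms_in_hom_eq[OF M forms_in_group[OF M] _ _ _ t])
  have a0: "a \<in> grade \<Omega> 0" using a by (simp add: carrier_A)
  show "(\<lambda>t. wedge q p M v (wedge 0 p M a t)) \<in> add_hom (forms_in A \<Omega> p M) (forms_in A \<Omega> (q + p) M)"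
    using add_hom_comp[OF wedge_hom[OF M a0, of p, simplified] wedge_hom[OF M v, of p]] .
  fix w m assume "w \<in> grade \<Omega> p" "m \<in> carrier M"
  then show "wedge q p M v (wedge 0 p M a (form_tensor A \<Omega> p M w m))
      = wedge q p M (v \<otimes>\<^bsub>\<Omega>\<^esub> a) (form_tensor A \<Omega> p M w m)"
    using M v a a0 by (simp add: wedge_tensor A_mult_grade grade_mult_A grade_closed A_closed B.m_assoc)
qed (use assms in \<open>auto intro!: wedge_hom grade_mult_A\<close>)

end


section \<open>Modules of 1-jets\<close>

context exterior_algebra
begin

section \<open>The left A-module formed from A and M over K\<close>

lemma scalar_A_closed: "k \<in> carrier K \<Longrightarrow> k \<odot>\<^bsub>A\<^esub> \<one>\<^bsub>A\<^esub> \<in> carrier A"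
  using A.smult_closed A.B.one_closed by blast

text \<open>Scalars from K are central: k a = k (a 1) = a (k 1). A left A-module sees K only through
  the elements k 1, so this identity balances the evaluation a \<otimes> e \<mapsto> a e over
  K.\<close>

lemma scalar_mult_A:
  assumes "k \<in> carrier K" "a \<in> carrier A"
  shows "k \<odot>\<^bsub>A\<^esub> a = a \<otimes>\<^bsub>A\<^esub> (k \<odot>\<^bsub>A\<^esub> \<one>\<^bsub>A\<^esub>)"
  using A.smult_mult_right[OF assms(1,2) A.B.one_closed] assms by simp

lemma A_pair:
  assumes "left_module A M"
  shows "bimodule_pair (carrier K) (\<lambda>a k. k \<odot>\<^bsub>A\<^esub> a) (\<lambda>k e. (k \<odot>\<^bsub>A\<^esub> \<one>\<^bsub>A\<^esub>) \<odot>\<^bsub>M\<^esub> e)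
    (forms \<Omega> 0) M (carrier A)"
proof -
  have "k \<odot>\<^bsub>A\<^esub> a \<in> carrier A" if "k \<in> carrier K" "a \<in> carrier A" for k a
    using that by (rule A.smult_closed)
  moreover have "b \<otimes>\<^bsub>A\<^esub> (k \<odot>\<^bsub>A\<^esub> a) = k \<odot>\<^bsub>A\<^esub> (b \<otimes>\<^bsub>A\<^esub> a)"
    if "k \<in> carrier K" "a \<in> carrier A" "b \<in> carrier A" for k a b
    using A.smult_mult_right[OF that(1,3,2)] by simp
  moreover have "b \<otimes>\<^bsub>A\<^esub> (x \<oplus>\<^bsub>\<Omega>\<^esub> y) = b \<otimes>\<^bsub>A\<^esub> x \<oplus>\<^bsub>\<Omega>\<^esub> b \<otimes>\<^bsub>A\<^esub> y"
    if "b \<in> carrier A" "x \<in> carrier A" "y \<in> carrier A" for b x y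
    using that by (simp add: B.r_distr A_closed mult_A)
  ultimately show ?thesis
    using assms
    by (simp add: bimodule_pair_def balanced_pair_def bimodule_pair_axioms_def forms_group
        left_module_group left_module.lsmult_closed scalar_A_closed carrier_A[symmetric]
        mult_A[symmetric] A.B.m_closed)
qed

lemmas A_balanced = bimodule_pair.axioms(1)[OF A_pair]

lemmas A_tensor_group = balanced_pair.tensor_group
    [OF A_balanced, folded A_tensor_def]
  and A_pure_closed = balanced_pair.pure_closed
    [OF A_balanced, folded A_tensor_def A_pure_def, unfolded carrier_forms, folded carrier_A]
  and A_pure_add_left = balanced_pair.pure_add_left
    [OF A_balanced, folded A_tensor_def A_pure_def, unfolded carrier_forms add_forms,
      folded carrier_A add_A]
  and A_tensor_induct = balanced_pair.tensor_induct
    [OF A_balanced, folded A_tensor_def A_pure_def, unfolded carrier_forms, folded carrier_A,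
      consumes 2, case_names zero pure add]
  and A_tensor_lift = balanced_pair.tensor_lift
    [OF A_balanced, folded A_tensor_def A_pure_def, unfolded carrier_forms add_forms,
      folded carrier_A add_A]
  and A_tensor_smult_hom = bimodule_pair.tensor_smult_hom
    [OF A_pair, folded A_tensor_def]
  and A_tensor_smult_pure = bimodule_pair.tensor_smult_pure
    [OF A_pair, folded A_tensor_def A_pure_def, unfolded carrier_forms smult_forms,
      folded carrier_A mult_A]

lemma A_tensor_hom_eq:
  assumes M: "left_module A M" and G: "abelian_group G"
    and f: "f \<in> add_hom (A_tensor K A \<Omega> M) G" and g: "g \<in> add_hom (A_tensor K A \<Omega> M) G"
    and eq: "\<And>a m. \<lbrakk>a \<in> carrier A; m \<in> carrier M\<rbrakk> \<Longrightarrow> f (A_pure K A \<Omega> M a m) = g (A_pure K A \<Omega> M a m)"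
    and t: "t \<in> carrier (A_tensor K A \<Omega> M)"
  shows "f t = g t"
  using M t
proof (induction t rule: A_tensor_induct)
  case zero
  then show ?case using f g G A_tensor_group[OF M] by (simp add: add_hom_zero)
next
  case (pure a m)
  then show ?case by (rule eq)
next
  case (add u v)
  then show ?case using f g by (simp add: add_hom_add)
qed

text \<open>With the scalars fixed, both sides of each remaining axiom are additive in t. This
  reduces them to pure tensors, where they are laws of the ring A in the first factor.\<close>

lemma A_tensor_module:
  assumes M: "left_module A M"
  shows "left_module A (A_tensor K A \<Omega> M)"
proof (rule left_moduleI)
  let ?T = "A_tensor K A \<Omega> M"
  note G = A_tensor_group[OF M]
  show "ring A" "abelian_group ?T" by (rule A_ring, rule G)
  fix a b t s assume t: "t \<in> carrier ?T"
  { assume a: "a \<in> carrier A"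
    note h = A_tensor_smult_hom[OF M a]
    show "a \<odot>\<^bsub>?T\<^esub> t \<in> carrier ?T" using h t by (rule add_hom_closed)
    show "a \<odot>\<^bsub>?T\<^esub> (t \<oplus>\<^bsub>?T\<^esub> s) = a \<odot>\<^bsub>?T\<^esub> t \<oplus>\<^bsub>?T\<^esub> a \<odot>\<^bsub>?T\<^esub> s" if "s \<in> carrier ?T"
      using h t that by (rule add_hom_add)
    assume b: "b \<in> carrier A"
    have ab: "a \<oplus>\<^bsub>A\<^esub> b \<in> carrier A" "a \<otimes>\<^bsub>A\<^esub> b \<in> carrier A"
      using a b by (auto intro: ring.ring_simprules(1)[OF A_ring] A.B.m_closed)
    show "(a \<oplus>\<^bsub>A\<^esub> b) \<odot>\<^bsub>?T\<^esub> t = a \<odot>\<^bsub>?T\<^esub> t \<oplus>\<^bsub>?T\<^esub> b \<odot>\<^bsub>?T\<^esub> t"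
    proof (rule A_tensor_hom_eq[OF M G _ _ _ t])
      show "(\<odot>\<^bsub>?T\<^esub>) (a \<oplus>\<^bsub>A\<^esub> b) \<in> add_hom ?T ?T"
        by (intro A_tensor_smult_hom[OF M] ab)
      show "(\<lambda>t. a \<odot>\<^bsub>?T\<^esub> t \<oplus>\<^bsub>?T\<^esub> b \<odot>\<^bsub>?T\<^esub> t) \<in> add_hom ?T ?T"
        by (intro add_hom_sum G A_tensor_smult_hom[OF M] a b)
      fix c m assume "c \<in> carrier A" "m \<in> carrier M"
      then show "(a \<oplus>\<^bsub>A\<^esub> b) \<odot>\<^bsub>?T\<^esub> A_pure K A \<Omega> M c m
          = a \<odot>\<^bsub>?T\<^esub> A_pure K A \<Omega> M c m \<oplus>\<^bsub>?T\<^esub> b \<odot>\<^bsub>?T\<^esub> A_pure K A \<Omega> M c m"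
        using a b ab M by (simp add: A_tensor_smult_pure A.B.l_distr A_pure_add_left A.B.m_closed)
    qed
    show "(a \<otimes>\<^bsub>A\<^esub> b) \<odot>\<^bsub>?T\<^esub> t = a \<odot>\<^bsub>?T\<^esub> (b \<odot>\<^bsub>?T\<^esub> t)"
    proof (rule A_tensor_hom_eq[OF M G _ _ _ t])
      show "(\<odot>\<^bsub>?T\<^esub>) (a \<otimes>\<^bsub>A\<^esub> b) \<in> add_hom ?T ?T"
        by (intro A_tensor_smult_hom[OF M] ab)
      show "(\<lambda>t. a \<odot>\<^bsub>?T\<^esub> (b \<odot>\<^bsub>?T\<^esub> t)) \<in> add_hom ?T ?T"
        by (rule add_hom_comp[OF A_tensor_smult_hom[OF M b] A_tensor_smult_hom[OF M a]])
      fix c m assume "c \<in> carrier A" "m \<in> carrier M"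
      then show "(a \<otimes>\<^bsub>A\<^esub> b) \<odot>\<^bsub>?T\<^esub> A_pure K A \<Omega> M c m = a \<odot>\<^bsub>?T\<^esub> (b \<odot>\<^bsub>?T\<^esub> A_pure K A \<Omega> M c m)"
        using a b ab M by (simp add: A_tensor_smult_pure A.B.m_closed A.B.m_assoc)
    qed }
  show "\<one>\<^bsub>A\<^esub> \<odot>\<^bsub>?T\<^esub> t = t"
  proof (rule A_tensor_hom_eq[OF M G _ _ _ t])
    show "(\<odot>\<^bsub>?T\<^esub>) \<one>\<^bsub>A\<^esub> \<in> add_hom ?T ?T" by (intro A_tensor_smult_hom[OF M] A.B.one_closed)
    show "(\<lambda>t. t) \<in> add_hom ?T ?T" by (intro add_homI) simp_all
    fix c m assume "c \<in> carrier A" "m \<in> carrier M"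
    then show "\<one>\<^bsub>A\<^esub> \<odot>\<^bsub>?T\<^esub> A_pure K A \<Omega> M c m = A_pure K A \<Omega> M c m"
      using M by (simp add: A_tensor_smult_pure A.B.one_closed A.B.l_one)
  qed
qed

text \<open>Brings a tensor into the indexed form that occurs in \<open>jet_kernel\<close>.\<close>

lemma A_tensor_eq_finsum:
  assumes M: "left_module A M" and t: "t \<in> carrier (A_tensor K A \<Omega> M)"
  obtains m :: nat and a e where "\<And>i. i < m \<Longrightarrow> a i \<in> carrier A \<and> e i \<in> carrier M"
    and "t = (\<Oplus>\<^bsub>A_tensor K A \<Omega> M\<^esub>i\<in>{..<m}. A_pure K A \<Omega> M (a i) (e i))"
proof -
  let ?f = "\<lambda>(a, e). A_pure K A \<Omega> M a e"
  have "\<exists>ps. set ps \<subseteq> carrier A \<times> carrier M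
      \<and> t = foldr (\<lambda>p v. ?f p \<oplus>\<^bsub>A_tensor K A \<Omega> M\<^esub> v) ps \<zero>\<^bsub>A_tensor K A \<Omega> M\<^esub>"
    by (rule additive_span_foldr[OF A_tensor_group[OF M] _ t])
       (auto simp: A_pure_closed M intro: A_tensor_induct[OF M t])
  then obtain ps where ps: "set ps \<subseteq> carrier A \<times> carrier M"
      "t = foldr (\<lambda>p v. ?f p \<oplus>\<^bsub>A_tensor K A \<Omega> M\<^esub> v) ps \<zero>\<^bsub>A_tensor K A \<Omega> M\<^esub>"
    by blast
  show thesis
  proof (rule that)
    show "fst (ps ! i) \<in> carrier A \<and> snd (ps ! i) \<in> carrier M" if "i < length ps" for i
      using subsetD[OF ps(1) nth_mem[OF that]] by (auto simp: mem_Times_iff)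
    show "t = (\<Oplus>\<^bsub>A_tensor K A \<Omega> M\<^esub>i\<in>{..<length ps}. A_pure K A \<Omega> M (fst (ps ! i)) (snd (ps ! i)))"
      using foldr_add_eq_finsum[OF A_tensor_group[OF M], of ps ?f] ps M
      by (auto simp: case_prod_beta A_pure_closed subset_iff mem_Times_iff)
  qed
qed

section \<open>The two maps behind the jet relations\<close>

lemma A_tensor_eval:
  assumes M: "left_module A M"
  obtains \<mu> where "\<mu> \<in> add_hom (A_tensor K A \<Omega> M) M"
    and "\<And>a e. \<lbrakk>a \<in> carrier A; e \<in> carrier M\<rbrakk> \<Longrightarrow> \<mu> (A_pure K A \<Omega> M a e) = a \<odot>\<^bsub>M\<^esub> e"
proof (rule A_tensor_lift[OF M left_module_group[OF M], of "smult M"])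
  fix a k e assume "a \<in> carrier A" "k \<in> carrier K" "e \<in> carrier M"
  then show "(k \<odot>\<^bsub>A\<^esub> a) \<odot>\<^bsub>M\<^esub> e = a \<odot>\<^bsub>M\<^esub> ((k \<odot>\<^bsub>A\<^esub> \<one>\<^bsub>A\<^esub>) \<odot>\<^bsub>M\<^esub> e)"
    using M by (subst scalar_mult_A) (simp_all add: left_module.lsmult_assoc scalar_A_closed)
qed (use M that in \<open>auto simp: left_module.lsmult_closed left_module.lsmult_l_distr
      left_module.lsmult_r_distr\<close>)

text \<open>Balancing over K comes from d(k a) = k da = da (k 1), the differential being K-linear;
  then k 1 crosses the tensor product over A.\<close>

lemma A_tensor_form:
  assumes M: "left_module A M"
  obtains \<delta> where "\<delta> \<in> add_hom (A_tensor K A \<Omega> M) (forms_in A \<Omega> 1 M)"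
    and "\<And>a e. \<lbrakk>a \<in> carrier A; e \<in> carrier M\<rbrakk> \<Longrightarrow>
      \<delta> (A_pure K A \<Omega> M a e) = form_tensor A \<Omega> 1 M (diff \<Omega> a) e"
proof (rule A_tensor_lift[OF M forms_in_group[OF M], of "\<lambda>a. form_tensor A \<Omega> 1 M (diff \<Omega> a)" 1])
  fix a k e assume *: "a \<in> carrier A" "k \<in> carrier K" "e \<in> carrier M"
  have "diff \<Omega> (k \<odot>\<^bsub>A\<^esub> a) = k \<odot>\<^bsub>\<Omega>\<^esub> (diff \<Omega> a \<otimes>\<^bsub>\<Omega>\<^esub> \<one>\<^bsub>\<Omega>\<^esub>)"
    using * grade_closed[OF diff_A] by (simp add: smult_A diff_smult A_closed)
  also have "\<dots> = diff \<Omega> a \<otimes>\<^bsub>\<Omega>\<^esub> (k \<odot>\<^bsub>A\<^esub> \<one>\<^bsub>A\<^esub>)"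
    using * grade_closed[OF diff_A] by (subst smult_mult_right) (simp_all add: smult_A one_A)
  finally show "form_tensor A \<Omega> 1 M (diff \<Omega> (k \<odot>\<^bsub>A\<^esub> a)) e
      = form_tensor A \<Omega> 1 M (diff \<Omega> a) ((k \<odot>\<^bsub>A\<^esub> \<one>\<^bsub>A\<^esub>) \<odot>\<^bsub>M\<^esub> e)"
    using * M by (simp add: form_tensor_balanced diff_A[unfolded One_nat_def] scalar_A_closed)
qed (use M that in \<open>auto simp: form_tensor_closed form_tensor_add_left form_tensor_add_right
       diff_A[unfolded One_nat_def] A_closed diff_add add_A\<close>)

text \<open>\<open>jet_kernel\<close> asks for some representation by pure tensors whose two
  associated sums vanish. These sums are the values of \<mu> and \<delta>, hence do not depend on
  the representation, and every tensor has one.\<close>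

lemma jet_kernel_eq:
  assumes M: "left_module A M"
    and \<mu>: "\<mu> \<in> add_hom (A_tensor K A \<Omega> M) M"
      "\<And>a e. \<lbrakk>a \<in> carrier A; e \<in> carrier M\<rbrakk> \<Longrightarrow> \<mu> (A_pure K A \<Omega> M a e) = a \<odot>\<^bsub>M\<^esub> e"
    and \<delta>: "\<delta> \<in> add_hom (A_tensor K A \<Omega> M) (forms_in A \<Omega> 1 M)"
      "\<And>a e. \<lbrakk>a \<in> carrier A; e \<in> carrier M\<rbrakk> \<Longrightarrow>
        \<delta> (A_pure K A \<Omega> M a e) = form_tensor A \<Omega> 1 M (diff \<Omega> a) e"
  shows "jet_kernel K A \<Omega> M = {t \<in> carrier (A_tensor K A \<Omega> M).
    \<mu> t = \<zero>\<^bsub>M\<^esub> \<and> \<delta> t = \<zero>\<^bsub>forms_in A \<Omega> 1 M\<^esub>}" (is "_ = ?Z")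
proof -
  let ?T = "A_tensor K A \<Omega> M" and ?F = "forms_in A \<Omega> 1 M"
  note G = A_tensor_group[OF M] left_module_group[OF M] forms_in_group[OF M, of 1]
  interpret T: abelian_group ?T by (rule G(1))
  interpret Mg: abelian_group M by (rule G(2))
  interpret F: abelian_group ?F by (rule G(3))
  have sums: "\<mu> (\<Oplus>\<^bsub>?T\<^esub>i\<in>{..<m}. A_pure K A \<Omega> M (a i) (e i)) = (\<Oplus>\<^bsub>M\<^esub>i\<in>{..<m}. a i \<odot>\<^bsub>M\<^esub> e i)"
    "\<delta> (\<Oplus>\<^bsub>?T\<^esub>i\<in>{..<m}. A_pure K A \<Omega> M (a i) (e i))
      = (\<Oplus>\<^bsub>?F\<^esub>i\<in>{..<m}. form_tensor A \<Omega> 1 M (diff \<Omega> (a i)) (e i))"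
    "(\<Oplus>\<^bsub>?T\<^esub>i\<in>{..<m}. A_pure K A \<Omega> M (a i) (e i)) \<in> carrier ?T"
    if ae: "\<forall>i<m. a i \<in> carrier A \<and> e i \<in> carrier M" for m :: nat and a e
  proof -
    have p: "(\<lambda>i. A_pure K A \<Omega> M (a i) (e i)) \<in> {..<m} \<rightarrow> carrier ?T"
      using ae M by (auto simp: A_pure_closed)
    then show "(\<Oplus>\<^bsub>?T\<^esub>i\<in>{..<m}. A_pure K A \<Omega> M (a i) (e i)) \<in> carrier ?T"
      by (rule T.finsum_closed)
    show "\<mu> (\<Oplus>\<^bsub>?T\<^esub>i\<in>{..<m}. A_pure K A \<Omega> M (a i) (e i)) = (\<Oplus>\<^bsub>M\<^esub>i\<in>{..<m}. a i \<odot>\<^bsub>M\<^esub> e i)"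
      unfolding add_hom_finsum[OF G(1,2) \<mu>(1) finite_lessThan p]
      by (rule Mg.finsum_cong') (use ae M in \<open>auto simp: \<mu>(2) left_module.lsmult_closed\<close>)
    show "\<delta> (\<Oplus>\<^bsub>?T\<^esub>i\<in>{..<m}. A_pure K A \<Omega> M (a i) (e i))
        = (\<Oplus>\<^bsub>?F\<^esub>i\<in>{..<m}. form_tensor A \<Omega> 1 M (diff \<Omega> (a i)) (e i))"
      unfolding add_hom_finsum[OF G(1,3) \<delta>(1) finite_lessThan p]
      by (rule F.finsum_cong')
         (use ae M in \<open>auto simp: \<delta>(2)[unfolded One_nat_def] form_tensor_closed diff_A[unfolded One_nat_def]\<close>)
  qed
  show ?thesis
  proof
    show "jet_kernel K A \<Omega> M \<subseteq> ?Z"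
      unfolding jet_kernel_def using sums by auto
    show "?Z \<subseteq> jet_kernel K A \<Omega> M"
    proof
      fix t assume t: "t \<in> ?Z"
      then obtain m :: nat and a e
        where ae: "\<And>i. i < m \<Longrightarrow> a i \<in> carrier A \<and> e i \<in> carrier M"
        and t_eq: "t = (\<Oplus>\<^bsub>?T\<^esub>i\<in>{..<m}. A_pure K A \<Omega> M (a i) (e i))"
        using A_tensor_eq_finsum[OF M] by blast
      have "(\<Oplus>\<^bsub>M\<^esub>i\<in>{..<m}. a i \<odot>\<^bsub>M\<^esub> e i) = \<zero>\<^bsub>M\<^esub>"
        "(\<Oplus>\<^bsub>?F\<^esub>i\<in>{..<m}. form_tensor A \<Omega> 1 M (diff \<Omega> (a i)) (e i)) = \<zero>\<^bsub>?F\<^esub>"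
        using t t_eq sums(1,2)[of m a e] ae by auto
      with ae t_eq show "t \<in> jet_kernel K A \<Omega> M"
        unfolding jet_kernel_def by blast
    qed
  qed
qed


text \<open>The map \<delta> obeys \<delta>(b t) = b \<delta>(t) + db \<otimes> \<mu>(t), so its
  kernel alone need not be stable under A. On the common kernel with \<mu> the extra term
  vanishes.\<close>

lemma jet_kernel_submodule:
  assumes M: "left_module A M"
  shows "subgroup (jet_kernel K A \<Omega> M) (add_monoid (A_tensor K A \<Omega> M))"
    and "\<lbrakk>b \<in> carrier A; t \<in> jet_kernel K A \<Omega> M\<rbrakk> \<Longrightarrow> b \<odot>\<^bsub>A_tensor K A \<Omega> M\<^esub> t \<in> jet_kernel K A \<Omega> M"
proof -
  let ?T = "A_tensor K A \<Omega> M" and ?F = "forms_in A \<Omega> 1 M"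
  note G = A_tensor_group[OF M] left_module_group[OF M] forms_in_group[OF M, of 1]
  interpret T: abelian_group ?T by (rule G(1))
  interpret Mg: abelian_group M by (rule G(2))
  interpret F: abelian_group ?F by (rule G(3))
  obtain \<mu> where \<mu>: "\<mu> \<in> add_hom ?T M"
    "\<And>a e. \<lbrakk>a \<in> carrier A; e \<in> carrier M\<rbrakk> \<Longrightarrow> \<mu> (A_pure K A \<Omega> M a e) = a \<odot>\<^bsub>M\<^esub> e"
    using A_tensor_eval[OF M] by blast
  obtain \<delta> where \<delta>: "\<delta> \<in> add_hom ?T ?F"
    "\<And>a e. \<lbrakk>a \<in> carrier A; e \<in> carrier M\<rbrakk> \<Longrightarrow>
      \<delta> (A_pure K A \<Omega> M a e) = form_tensor A \<Omega> 1 M (diff \<Omega> a) e"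
    using A_tensor_form[OF M] by blast
  note ker = jet_kernel_eq[OF M \<mu> \<delta>]
  show "subgroup (jet_kernel K A \<Omega> M) (add_monoid ?T)"
  proof (rule group.subgroupI[OF T.a_group])
    show "jet_kernel K A \<Omega> M \<noteq> {}"
      using add_hom_zero[OF G(1,2) \<mu>(1)] add_hom_zero[OF G(1,3) \<delta>(1)] by (auto simp: ker)
    show "inv\<^bsub>add_monoid ?T\<^esub> t \<in> jet_kernel K A \<Omega> M" if "t \<in> jet_kernel K A \<Omega> M" for t
      using that add_hom_neg[OF G(1,2) \<mu>(1), of t] add_hom_neg[OF G(1,3) \<delta>(1), of t]
      by (auto simp: ker a_inv_def[symmetric] Mg.add.inv_one F.add.inv_one simp del: One_nat_def)
    show "s \<otimes>\<^bsub>add_monoid ?T\<^esub> t \<in> jet_kernel K A \<Omega> M"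
      if "s \<in> jet_kernel K A \<Omega> M" "t \<in> jet_kernel K A \<Omega> M" for s t
      using that \<mu>(1) \<delta>(1) by (auto simp: ker add_hom_add simp del: One_nat_def)
  qed (auto simp: ker)
  assume b: "b \<in> carrier A" and t: "t \<in> jet_kernel K A \<Omega> M"
  then have t_in: "t \<in> carrier ?T" by (simp add: ker)
  note h = A_tensor_smult_hom[OF M b]
  have b0: "b \<in> grade \<Omega> 0" using b by (simp add: carrier_A)
  note w = wedge_hom[OF M b0, of 1, unfolded add_0]
  have "\<mu> (b \<odot>\<^bsub>?T\<^esub> t) = b \<odot>\<^bsub>M\<^esub> \<mu> t"
  proof (rule A_tensor_hom_eq[OF M G(2) _ _ _ t_in])
    show "(\<lambda>t. \<mu> (b \<odot>\<^bsub>?T\<^esub> t)) \<in> add_hom ?T M" by (rule add_hom_comp[OF h \<mu>(1)])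
    show "(\<lambda>t. b \<odot>\<^bsub>M\<^esub> \<mu> t) \<in> add_hom ?T M" by (rule add_hom_comp[OF \<mu>(1) lsmult_hom[OF M b]])
    fix a e assume "a \<in> carrier A" "e \<in> carrier M"
    then show "\<mu> (b \<odot>\<^bsub>?T\<^esub> A_pure K A \<Omega> M a e) = b \<odot>\<^bsub>M\<^esub> \<mu> (A_pure K A \<Omega> M a e)"
      using M b by (simp add: A_tensor_smult_pure \<mu>(2) A.B.m_closed left_module.lsmult_assoc)
  qed
  \<comment> \<open>The defect db \<otimes> \<mu>(t) is additive in t, so this twisted rule can be
    checked on pure tensors, where it is the Leibniz rule for d(b a).\<close>
  moreover have "\<delta> (b \<odot>\<^bsub>?T\<^esub> t) = wedge 0 1 M b (\<delta> t) \<oplus>\<^bsub>?F\<^esub> form_tensor A \<Omega> 1 M (diff \<Omega> b) (\<mu> t)"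
  proof (rule A_tensor_hom_eq[OF M G(3) _ _ _ t_in])
    show "(\<lambda>t. \<delta> (b \<odot>\<^bsub>?T\<^esub> t)) \<in> add_hom ?T ?F" by (rule add_hom_comp[OF h \<delta>(1)])
    show "(\<lambda>t. wedge 0 1 M b (\<delta> t) \<oplus>\<^bsub>?F\<^esub> form_tensor A \<Omega> 1 M (diff \<Omega> b) (\<mu> t)) \<in> add_hom ?T ?F"
      by (intro add_hom_sum G(3) add_hom_comp[OF \<delta>(1)] add_hom_comp[OF \<mu>(1)]
          form_tensor_hom_right[OF M diff_A[OF b]]) (use w in simp)
    fix a e assume a: "a \<in> carrier A" and e: "e \<in> carrier M"
    have d: "diff \<Omega> b \<in> grade \<Omega> 1" "diff \<Omega> a \<in> grade \<Omega> 1" using a b diff_A by blast+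
    have "\<delta> (b \<odot>\<^bsub>?T\<^esub> A_pure K A \<Omega> M a e) = form_tensor A \<Omega> 1 M (diff \<Omega> (b \<otimes>\<^bsub>\<Omega>\<^esub> a)) e"
      using M a b e by (simp add: A_tensor_smult_pure \<delta>(2)[unfolded One_nat_def] A.B.m_closed mult_A[symmetric])
    also have "\<dots> = form_tensor A \<Omega> 1 M (diff \<Omega> b \<otimes>\<^bsub>\<Omega>\<^esub> a) e \<oplus>\<^bsub>?F\<^esub> form_tensor A \<Omega> 1 M (b \<otimes>\<^bsub>\<Omega>\<^esub> diff \<Omega> a) e"
      unfolding diff_A_mult[OF b A_closed[OF a]]
      by (intro form_tensor_add_left M e grade_mult_A A_mult_grade a b d)
    also have "\<dots> = form_tensor A \<Omega> 1 M (b \<otimes>\<^bsub>\<Omega>\<^esub> diff \<Omega> a) e \<oplus>\<^bsub>?F\<^esub> form_tensor A \<Omega> 1 M (diff \<Omega> b) (a \<odot>\<^bsub>M\<^esub> e)"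
      unfolding form_tensor_balanced[OF M d(1) a e]
      by (intro F.a_comm form_tensor_closed M e d A_mult_grade a b left_module.lsmult_closed[OF M])
    also have "form_tensor A \<Omega> 1 M (b \<otimes>\<^bsub>\<Omega>\<^esub> diff \<Omega> a) e = wedge 0 1 M b (form_tensor A \<Omega> 1 M (diff \<Omega> a) e)"
      using wedge_tensor[OF M b0 d(2) e] by simp
    finally show "\<delta> (b \<odot>\<^bsub>?T\<^esub> A_pure K A \<Omega> M a e) = wedge 0 1 M b (\<delta> (A_pure K A \<Omega> M a e))
        \<oplus>\<^bsub>?F\<^esub> form_tensor A \<Omega> 1 M (diff \<Omega> b) (\<mu> (A_pure K A \<Omega> M a e))"
      unfolding \<mu>(2)[OF a e] \<delta>(2)[OF a e] .
  qed
  ultimately show "b \<odot>\<^bsub>?T\<^esub> t \<in> jet_kernel K A \<Omega> M"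
    using t add_hom_closed[OF h t_in] add_hom_zero[OF G(3,3) w]
      add_hom_zero[OF G(2,2) lsmult_hom[OF M b]]
      add_hom_zero[OF G(2,3) form_tensor_hom_right[OF M diff_A[OF b]]]
    by (simp add: ker del: One_nat_def)
qed

section \<open>The quotient by the jet relations\<close>

lemma jet1_quotient_module:
  assumes M: "left_module A M"
  shows "left_module A (jet1_quotient K A \<Omega> M)"
  unfolding jet1_quotient_def
  by (intro left_module_quotient A_tensor_module jet_kernel_submodule M)

lemma jet1_quotient_class_closed:
  assumes M: "left_module A M" and "a \<in> carrier A" "e \<in> carrier M"
  shows "jet1_quotient_class K A \<Omega> M a e \<in> carrier (jet1_quotient K A \<Omega> M)"
  using assms quotient_module_group(2)[OF A_tensor_group jet_kernel_submodule(1), OF M M]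
  by (auto simp: jet1_quotient_class_def jet1_quotient_def A_pure_closed)

lemma jet1_quotient_class_smult:
  assumes M: "left_module A M" and "a \<in> carrier A" "b \<in> carrier A" "e \<in> carrier M"
  shows "b \<odot>\<^bsub>jet1_quotient K A \<Omega> M\<^esub> jet1_quotient_class K A \<Omega> M a e
    = jet1_quotient_class K A \<Omega> M (b \<otimes>\<^bsub>A\<^esub> a) e"
  unfolding jet1_quotient_class_def jet1_quotient_def
  by (subst quotient_module_smult[OF A_tensor_module[OF M] jet_kernel_submodule(1)[OF M]])
     (use assms in \<open>simp_all add: jet_kernel_submodule A_pure_closed A_tensor_smult_pure\<close>)

lemma jet1_quotient_induct [consumes 2, case_names zero jet add]:
  assumes M: "left_module A M" and U: "U \<in> carrier (jet1_quotient K A \<Omega> M)"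
    and zero: "P \<zero>\<^bsub>jet1_quotient K A \<Omega> M\<^esub>"
    and jet: "\<And>a e. \<lbrakk>a \<in> carrier A; e \<in> carrier M\<rbrakk> \<Longrightarrow> P (jet1_quotient_class K A \<Omega> M a e)"
    and add: "\<And>u v. \<lbrakk>u \<in> carrier (jet1_quotient K A \<Omega> M); v \<in> carrier (jet1_quotient K A \<Omega> M); P u; P v\<rbrakk>
      \<Longrightarrow> P (u \<oplus>\<^bsub>jet1_quotient K A \<Omega> M\<^esub> v)"
  shows "P U"
proof -
  let ?T = "A_tensor K A \<Omega> M" and ?Q = "jet1_quotient K A \<Omega> M"
  note G = A_tensor_group[OF M]
  note q = quotient_module_group[OF G jet_kernel_submodule(1)[OF M], folded jet1_quotient_def]
  obtain t where t: "t \<in> carrier ?T" "U = jet_kernel K A \<Omega> M +>\<^bsub>?T\<^esub> t"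
    using U by (auto simp: q(2))
  have "P (jet_kernel K A \<Omega> M +>\<^bsub>?T\<^esub> t)"
    using M t(1)
  proof (induction t rule: A_tensor_induct)
    case zero
    then show ?case using assms(3) add_hom_zero[OF G q(1) q(3)] by simp
  next
    case (pure a e)
    then show ?case using jet by (simp add: jet1_quotient_class_def)
  next
    case (add u v)
    then show ?case using add_hom_add[OF q(3)] assms(5) by (simp add: add_hom_closed[OF q(3)])
  qed
  with t show ?thesis by simp
qed

text \<open>What is divided out is exactly the common kernel of \<mu> and \<delta>; both descend and
  are jointly injective on the quotient. They are obtained together so that joint injectivity speaks
  of the same two maps.\<close>

lemma jet1_quotient_maps:
  assumes M: "left_module A M"
  obtains p r where "p \<in> add_hom (jet1_quotient K A \<Omega> M) M"
    and "\<And>a e. \<lbrakk>a \<in> carrier A; e \<in> carrier M\<rbrakk> \<Longrightarrow> p (jet1_quotient_class K A \<Omega> M a e) = a \<odot>\<^bsub>M\<^esub> e"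
    and "r \<in> add_hom (jet1_quotient K A \<Omega> M) (forms_in A \<Omega> 1 M)"
    and "\<And>a e. \<lbrakk>a \<in> carrier A; e \<in> carrier M\<rbrakk> \<Longrightarrow>
      r (jet1_quotient_class K A \<Omega> M a e) = form_tensor A \<Omega> 1 M (diff \<Omega> a) e"
    and "\<And>U. \<lbrakk>U \<in> carrier (jet1_quotient K A \<Omega> M); p U = \<zero>\<^bsub>M\<^esub>; r U = \<zero>\<^bsub>forms_in A \<Omega> 1 M\<^esub>\<rbrakk>
      \<Longrightarrow> U = \<zero>\<^bsub>jet1_quotient K A \<Omega> M\<^esub>"
proof -
  let ?T = "A_tensor K A \<Omega> M" and ?F = "forms_in A \<Omega> 1 M" and ?N = "jet_kernel K A \<Omega> M"
  note G = A_tensor_group[OF M] left_module_group[OF M] forms_in_group[OF M, of 1]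
  note N = jet_kernel_submodule(1)[OF M]
  note q = quotient_module_group[OF G(1) N, folded jet1_quotient_def]
  obtain \<mu> where \<mu>: "\<mu> \<in> add_hom ?T M"
    "\<And>a e. \<lbrakk>a \<in> carrier A; e \<in> carrier M\<rbrakk> \<Longrightarrow> \<mu> (A_pure K A \<Omega> M a e) = a \<odot>\<^bsub>M\<^esub> e"
    using A_tensor_eval[OF M] by blast
  obtain \<delta> where \<delta>: "\<delta> \<in> add_hom ?T ?F"
    "\<And>a e. \<lbrakk>a \<in> carrier A; e \<in> carrier M\<rbrakk> \<Longrightarrow>
      \<delta> (A_pure K A \<Omega> M a e) = form_tensor A \<Omega> 1 M (diff \<Omega> a) e"
    using A_tensor_form[OF M] by blast
  note ker = jet_kernel_eq[OF M \<mu> \<delta>]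
  obtain p where p: "p \<in> add_hom (jet1_quotient K A \<Omega> M) M"
      "\<And>t. t \<in> carrier ?T \<Longrightarrow> p (?N +>\<^bsub>?T\<^esub> t) = \<mu> t"
    by (rule quotient_module_lift[OF G(1) N G(2) \<mu>(1), folded jet1_quotient_def])
       (auto simp: ker)
  obtain r where r: "r \<in> add_hom (jet1_quotient K A \<Omega> M) ?F"
      "\<And>t. t \<in> carrier ?T \<Longrightarrow> r (?N +>\<^bsub>?T\<^esub> t) = \<delta> t"
    by (rule quotient_module_lift[OF G(1) N G(3) \<delta>(1), folded jet1_quotient_def])
       (auto simp: ker)
  show thesis
  proof (rule that[OF p(1) _ r(1)])
    fix a e assume ae: "a \<in> carrier A" "e \<in> carrier M"
    then have "A_pure K A \<Omega> M a e \<in> carrier ?T" using M by (simp add: A_pure_closed)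
    then show "p (jet1_quotient_class K A \<Omega> M a e) = a \<odot>\<^bsub>M\<^esub> e"
      and "r (jet1_quotient_class K A \<Omega> M a e) = form_tensor A \<Omega> 1 M (diff \<Omega> a) e"
      unfolding jet1_quotient_class_def by (simp_all only: p(2) r(2) \<mu>(2)[OF ae] \<delta>(2)[OF ae])
  next
    fix U assume U: "U \<in> carrier (jet1_quotient K A \<Omega> M)" "p U = \<zero>\<^bsub>M\<^esub>" "r U = \<zero>\<^bsub>?F\<^esub>"
    then obtain t where t: "t \<in> carrier ?T" "U = ?N +>\<^bsub>?T\<^esub> t" by (auto simp: q(2))
    then have "t \<in> ?N" using U p(2) r(2) by (simp add: ker)
    then show "U = \<zero>\<^bsub>jet1_quotient K A \<Omega> M\<^esub>" using t q(4) by simp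
  qed
qed

text \<open>A name is a list whose sum is the class, so the class can be recovered from it. Such a
  list exists because classes of pure tensors span the quotient by sums alone.\<close>

lemma jet_name_inj:
  assumes M: "left_module A M"
  shows "inj_on (jet_name K A \<Omega> M) (carrier (jet1_quotient K A \<Omega> M))"
proof -
  let ?Q = "jet1_quotient K A \<Omega> M"
  let ?P = "\<lambda>U ps. set ps \<subseteq> carrier A \<times> carrier M \<and>
     U = foldr (\<lambda>(a, e) V. jet1_quotient_class K A \<Omega> M a e \<oplus>\<^bsub>?Q\<^esub> V) ps \<zero>\<^bsub>?Q\<^esub>"
  have "\<exists>ps. ?P U ps" if U: "U \<in> carrier ?Q" for U
  proof -
    \<comment> \<open>\<open>additive_span_foldr\<close> folds with a summand that depends on p,
      while \<open>jet_name\<close> splits the pair in the fold function itself; the two functions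
      are equal.\<close>
    have "(\<lambda>(a, e) V. jet1_quotient_class K A \<Omega> M a e \<oplus>\<^bsub>?Q\<^esub> V)
        = (\<lambda>p V. (\<lambda>(a, e). jet1_quotient_class K A \<Omega> M a e) p \<oplus>\<^bsub>?Q\<^esub> V)"
      by (simp add: fun_eq_iff)
    moreover have "\<exists>ps. set ps \<subseteq> carrier A \<times> carrier M \<and>
        U = foldr (\<lambda>p V. (\<lambda>(a, e). jet1_quotient_class K A \<Omega> M a e) p \<oplus>\<^bsub>?Q\<^esub> V) ps \<zero>\<^bsub>?Q\<^esub>"
      by (rule additive_span_foldr[OF left_module_group[OF jet1_quotient_module[OF M]] _ U])
         (auto simp: jet1_quotient_class_closed M intro: jet1_quotient_induct[OF M U])
    ultimately show ?thesis by (simp only:)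
  qed
  then have name: "?P U (SOME ps. ?P U ps)" if "U \<in> carrier ?Q" for U
    by (rule someI_ex) (rule that)
  show ?thesis
  proof (rule inj_onI)
    fix U V assume UV: "U \<in> carrier ?Q" "V \<in> carrier ?Q"
      and "jet_name K A \<Omega> M U = jet_name K A \<Omega> M V"
    then have "(SOME ps. ?P U ps) = (SOME ps. ?P V ps)" by (simp only: jet_name_def jet.inject)
    then show "U = V" using name[OF UV(1)] name[OF UV(2)] by (metis (no_types))
  qed
qed

section \<open>The named module \<open>jet1\<close> and its generators\<close>

lemma jet1_module:
  assumes M: "left_module A M"
  shows "left_module A (jet1 K A \<Omega> M)"
  unfolding jet1_def by (rule left_module_transport[OF jet1_quotient_module[OF M] jet_name_inj[OF M]])

lemma jet1_class_closed:
  "\<lbrakk>left_module A M; a \<in> carrier A; e \<in> carrier M\<rbrakk> \<Longrightarrow> jet1_class K A \<Omega> M a e \<in> carrier (jet1 K A \<Omega> M)"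
  by (simp add: jet1_def jet1_class_def transport_facts[OF jet_name_inj] jet1_quotient_class_closed)

lemma jet1_class_smult:
  "\<lbrakk>left_module A M; a \<in> carrier A; b \<in> carrier A; e \<in> carrier M\<rbrakk> \<Longrightarrow>
    b \<odot>\<^bsub>jet1 K A \<Omega> M\<^esub> jet1_class K A \<Omega> M a e = jet1_class K A \<Omega> M (b \<otimes>\<^bsub>A\<^esub> a) e"
  by (simp add: jet1_def jet1_class_def transport_facts[OF jet_name_inj] jet1_quotient_class_closed
      jet1_quotient_class_smult)

lemma jet1_induct [consumes 2, case_names zero jet add]:
  assumes M: "left_module A M" and x: "x \<in> carrier (jet1 K A \<Omega> M)"
    and zero: "P \<zero>\<^bsub>jet1 K A \<Omega> M\<^esub>"
    and jet: "\<And>a e. \<lbrakk>a \<in> carrier A; e \<in> carrier M\<rbrakk> \<Longrightarrow> P (jet1_class K A \<Omega> M a e)"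
    and add: "\<And>u v. \<lbrakk>u \<in> carrier (jet1 K A \<Omega> M); v \<in> carrier (jet1 K A \<Omega> M); P u; P v\<rbrakk>
      \<Longrightarrow> P (u \<oplus>\<^bsub>jet1 K A \<Omega> M\<^esub> v)"
  shows "P x"
proof -
  note t = transport_facts[OF jet_name_inj[OF M], folded jet1_def]
  obtain U where U: "U \<in> carrier (jet1_quotient K A \<Omega> M)" "x = jet_name K A \<Omega> M U"
    using x by (auto simp: t)
  have "P (jet_name K A \<Omega> M U)"
    using M U(1)
  proof (induction U rule: jet1_quotient_induct)
    case zero
    then show ?case using assms(3) by (simp add: t)
  next
    case (jet a e)
    then show ?case using assms(4) by (simp add: jet1_class_def)
  next
    case (add u v)
    then show ?case using assms(5) by (simp add: t(3)[symmetric]) (simp add: t(1))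
  qed
  with U show ?thesis by simp
qed

lemma jet1_hom_eq:
  assumes M: "left_module A M" and G: "abelian_group G"
    and f: "f \<in> add_hom (jet1 K A \<Omega> M) G" and g: "g \<in> add_hom (jet1 K A \<Omega> M) G"
    and eq: "\<And>a e. \<lbrakk>a \<in> carrier A; e \<in> carrier M\<rbrakk> \<Longrightarrow> f (jet1_class K A \<Omega> M a e) = g (jet1_class K A \<Omega> M a e)"
    and x: "x \<in> carrier (jet1 K A \<Omega> M)"
  shows "f x = g x"
  using M x
proof (induction x rule: jet1_induct)
  case zero
  then show ?case using f g G left_module_group[OF jet1_module[OF M]] by (simp add: add_hom_zero)
next
  case (jet a e)
  then show ?case by (rule eq)
next
  case (add u v)
  then show ?case using f g by (simp add: add_hom_add)
qed

text \<open>Replaces a definite description on \<open>jet1\<close> by an explicit function: f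
  witnesses existence, \<open>jet1_hom_eq\<close> gives uniqueness, and the restriction meets the
  extensionality demanded by \<open>additive_map\<close>.\<close>

lemma jet1_additive_map:
  assumes M: "left_module A M" and G: "abelian_group G"
    and f: "f \<in> add_hom (jet1 K A \<Omega> M) G"
    and eq: "\<And>a e. \<lbrakk>a \<in> carrier A; e \<in> carrier M\<rbrakk> \<Longrightarrow> f (jet1_class K A \<Omega> M a e) = v a e"
  shows "additive_map (jet1 K A \<Omega> M) G
      (\<lambda>g. \<forall>a\<in>carrier A. \<forall>e\<in>carrier M. g (jet1_class K A \<Omega> M a e) = v a e)
    = restrict f (carrier (jet1 K A \<Omega> M))"
proof (rule additive_map_eq[OF f])
  interpret J: abelian_group "jet1 K A \<Omega> M" by (rule left_module_group[OF jet1_module[OF M]])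
  show "x \<oplus>\<^bsub>jet1 K A \<Omega> M\<^esub> y \<in> carrier (jet1 K A \<Omega> M)"
    if "x \<in> carrier (jet1 K A \<Omega> M)" "y \<in> carrier (jet1 K A \<Omega> M)" for x y
    using that by simp
  show "\<forall>x\<in>carrier (jet1 K A \<Omega> M). g x = f x"
    if "g \<in> add_hom (jet1 K A \<Omega> M) G"
      "\<forall>a\<in>carrier A. \<forall>e\<in>carrier M. g (jet1_class K A \<Omega> M a e) = v a e" for g
    using jet1_hom_eq[OF M G that(1) f] that(2) eq by auto
qed (use eq jet1_class_closed[OF M] in auto)

text \<open>The map \<rho> of the overview, described in the same style as \<open>jet1_proj\<close>
  so that \<open>jet1_additive_map\<close> evaluates both. Its failure to be A-linear is measured in
  \<open>jet1_form_smult\<close>.\<close>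

definition jet1_form ::
  "('w, ('w, 'x) jet) module \<Rightarrow> ('w, 'x) jet \<Rightarrow> (('w \<times> ('w, 'x) jet) \<Rightarrow>\<^sub>0 int) set" where
  "jet1_form M = additive_map (jet1 K A \<Omega> M) (forms_in A \<Omega> 1 M)
     (\<lambda>g. \<forall>a\<in>carrier A. \<forall>e\<in>carrier M.
        g (jet1_class K A \<Omega> M a e) = form_tensor A \<Omega> 1 M (diff \<Omega> a) e)"

text \<open>The two maps are those of \<open>jet1_quotient_maps\<close> composed with the inverse of
  the naming; joint injectivity is inherited since a jet names exactly one class.\<close>

lemma
  assumes M: "left_module A M"
  shows jet1_proj_hom: "jet1_proj K A \<Omega> M \<in> add_hom (jet1 K A \<Omega> M) M"
    and jet1_proj_class: "\<lbrakk>a \<in> carrier A; e \<in> carrier M\<rbrakk> \<Longrightarrow>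
      jet1_proj K A \<Omega> M (jet1_class K A \<Omega> M a e) = a \<odot>\<^bsub>M\<^esub> e"
    and jet1_form_hom: "jet1_form M \<in> add_hom (jet1 K A \<Omega> M) (forms_in A \<Omega> 1 M)"
    and jet1_form_class: "\<lbrakk>a \<in> carrier A; e \<in> carrier M\<rbrakk> \<Longrightarrow>
      jet1_form M (jet1_class K A \<Omega> M a e) = form_tensor A \<Omega> 1 M (diff \<Omega> a) e"
    and jet1_eq_zero: "\<lbrakk>x \<in> carrier (jet1 K A \<Omega> M); jet1_proj K A \<Omega> M x = \<zero>\<^bsub>M\<^esub>;
      jet1_form M x = \<zero>\<^bsub>forms_in A \<Omega> 1 M\<^esub>\<rbrakk> \<Longrightarrow> x = \<zero>\<^bsub>jet1 K A \<Omega> M\<^esub>"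
proof -
  let ?J = "jet1 K A \<Omega> M" and ?Q = "jet1_quotient K A \<Omega> M"
  let ?i = "inv_into (carrier ?Q) (jet_name K A \<Omega> M)"
  note inj = jet_name_inj[OF M]
  note t = transport_facts[OF inj, folded jet1_def]
  note GQ = left_module_group[OF jet1_quotient_module[OF M]]
  note GJ = left_module_group[OF jet1_module[OF M]]
  note G = left_module_group[OF M] forms_in_group[OF M, of 1]
  note i = transport_hom(2)[OF GQ inj, folded jet1_def]
  obtain p r where p: "p \<in> add_hom ?Q M"
      "\<And>a e. \<lbrakk>a \<in> carrier A; e \<in> carrier M\<rbrakk> \<Longrightarrow> p (jet1_quotient_class K A \<Omega> M a e) = a \<odot>\<^bsub>M\<^esub> e"
    and r: "r \<in> add_hom ?Q (forms_in A \<Omega> 1 M)"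
      "\<And>a e. \<lbrakk>a \<in> carrier A; e \<in> carrier M\<rbrakk> \<Longrightarrow>
      r (jet1_quotient_class K A \<Omega> M a e) = form_tensor A \<Omega> 1 M (diff \<Omega> a) e"
    and pr: "\<And>U. \<lbrakk>U \<in> carrier ?Q; p U = \<zero>\<^bsub>M\<^esub>; r U = \<zero>\<^bsub>forms_in A \<Omega> 1 M\<^esub>\<rbrakk> \<Longrightarrow> U = \<zero>\<^bsub>?Q\<^esub>"
    using jet1_quotient_maps[OF M] by blast
  have i_class: "?i (jet1_class K A \<Omega> M a e) = jet1_quotient_class K A \<Omega> M a e"
    if "a \<in> carrier A" "e \<in> carrier M" for a e
    unfolding jet1_class_def using inv_into_f_f[OF inj jet1_quotient_class_closed[OF M that]] .
  note hp = add_hom_comp[OF i p(1)] and hr = add_hom_comp[OF i r(1)]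
  have proj: "jet1_proj K A \<Omega> M = restrict (\<lambda>x. p (?i x)) (carrier ?J)"
    unfolding jet1_proj_def
    by (rule jet1_additive_map[OF M G(1) hp]) (simp add: i_class p(2))
  have form: "jet1_form M = restrict (\<lambda>x. r (?i x)) (carrier ?J)"
    unfolding jet1_form_def
    by (rule jet1_additive_map[OF M G(2) hr]) (simp only: i_class r(2))
  show "jet1_proj K A \<Omega> M \<in> add_hom ?J M"
    unfolding proj by (rule add_hom_restrict[OF GJ hp])
  show "jet1_form M \<in> add_hom ?J (forms_in A \<Omega> 1 M)"
    unfolding form by (rule add_hom_restrict[OF GJ hr])
  show "jet1_proj K A \<Omega> M (jet1_class K A \<Omega> M a e) = a \<odot>\<^bsub>M\<^esub> e"
    "jet1_form M (jet1_class K A \<Omega> M a e) = form_tensor A \<Omega> 1 M (diff \<Omega> a) e"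
    if "a \<in> carrier A" "e \<in> carrier M"
    using that jet1_class_closed[OF M that] i_class p(2) r(2) by (simp_all add: proj form)
  show "x = \<zero>\<^bsub>?J\<^esub>" if x: "x \<in> carrier ?J" "jet1_proj K A \<Omega> M x = \<zero>\<^bsub>M\<^esub>"
      "jet1_form M x = \<zero>\<^bsub>forms_in A \<Omega> 1 M\<^esub>"
  proof -
    obtain U where U: "U \<in> carrier ?Q" "x = jet_name K A \<Omega> M U" using x(1) by (auto simp: t)
    then have "?i x = U" using inj by simp
    then have "U = \<zero>\<^bsub>?Q\<^esub>" using pr[of U] U x by (simp add: proj form)
    with U show ?thesis by (simp add: t)
  qed
qed


section \<open>Jets determined by their projection and their form\<close>

lemma jet1_group: "left_module A M \<Longrightarrow> abelian_group (jet1 K A \<Omega> M)"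
  by (rule left_module_group[OF jet1_module])

text \<open>Both components are additive, so they vanish on the difference of x and y, where
  \<open>jet1_eq_zero\<close> applies.\<close>

lemma jet1_eqI:
  assumes M: "left_module A M" and xy: "x \<in> carrier (jet1 K A \<Omega> M)" "y \<in> carrier (jet1 K A \<Omega> M)"
    and "jet1_proj K A \<Omega> M x = jet1_proj K A \<Omega> M y" "jet1_form M x = jet1_form M y"
  shows "x = y"
proof -
  let ?J = "jet1 K A \<Omega> M"
  interpret J: abelian_group ?J by (rule jet1_group[OF M])
  interpret Mg: abelian_group M by (rule left_module_group[OF M])
  interpret F: abelian_group "forms_in A \<Omega> 1 M" by (rule forms_in_group[OF M])
  note hom = jet1_proj_hom[OF M] jet1_form_hom[OF M]
  have "x \<ominus>\<^bsub>?J\<^esub> y = \<zero>\<^bsub>?J\<^esub>"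
  proof (rule jet1_eq_zero[OF M])
    show "jet1_proj K A \<Omega> M (x \<ominus>\<^bsub>?J\<^esub> y) = \<zero>\<^bsub>M\<^esub>"
      using xy assms(4) add_hom_closed[OF hom(1)]
      by (simp add: a_minus_def add_hom_add[OF hom(1)] Mg.r_neg
          add_hom_neg[OF J.abelian_group_axioms Mg.abelian_group_axioms hom(1)])
    show "jet1_form M (x \<ominus>\<^bsub>?J\<^esub> y) = \<zero>\<^bsub>forms_in A \<Omega> 1 M\<^esub>"
      using xy assms(5) add_hom_closed[OF hom(2)]
      by (simp add: a_minus_def add_hom_add[OF hom(2)] F.r_neg del: One_nat_def
          add: add_hom_neg[OF J.abelian_group_axioms F.abelian_group_axioms hom(2)])
  qed (use xy in simp)
  then show ?thesis
    using xy by (metis J.minus_equality J.minus_minus J.a_inv_closed a_minus_def)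
qed

text \<open>Both components of [a \<otimes> e] are additive in e. The fact is needed to decompose an
  inner jet inside an outer class, see \<open>jet2_hom_eq\<close>.\<close>

lemma jet1_class_hom_right:
  assumes M: "left_module A M" and a: "a \<in> carrier A"
  shows "jet1_class K A \<Omega> M a \<in> add_hom M (jet1 K A \<Omega> M)"
proof (rule add_homI)
  interpret J: abelian_group "jet1 K A \<Omega> M" by (rule jet1_group[OF M])
  interpret Mg: abelian_group M by (rule left_module_group[OF M])
  fix e e' assume e: "e \<in> carrier M"
  then show "jet1_class K A \<Omega> M a e \<in> carrier (jet1 K A \<Omega> M)" using M a by (simp add: jet1_class_closed)
  assume e': "e' \<in> carrier M"
  note cl = jet1_class_closed[OF M a]
  note hom = jet1_proj_hom[OF M] jet1_form_hom[OF M]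
  show "jet1_class K A \<Omega> M a (e \<oplus>\<^bsub>M\<^esub> e')
      = jet1_class K A \<Omega> M a e \<oplus>\<^bsub>jet1 K A \<Omega> M\<^esub> jet1_class K A \<Omega> M a e'"
    by (rule jet1_eqI[OF M])
       (simp_all add: cl e e' a add_hom_add[OF hom(1)] add_hom_add[OF hom(2)] jet1_proj_class[OF M]
          jet1_form_class[OF M] left_module.lsmult_r_distr[OF M]
          form_tensor_add_right[OF M diff_A[OF a]] del: One_nat_def)
qed

lemma jet1_proj_linear:
  assumes M: "left_module A M"
  shows "jet1_proj K A \<Omega> M \<in> left_linear A (jet1 K A \<Omega> M) M"
proof (rule left_linearI[OF jet1_proj_hom[OF M]])
  fix b x assume b: "b \<in> carrier A" and x: "x \<in> carrier (jet1 K A \<Omega> M)"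
  show "jet1_proj K A \<Omega> M (b \<odot>\<^bsub>jet1 K A \<Omega> M\<^esub> x) = b \<odot>\<^bsub>M\<^esub> jet1_proj K A \<Omega> M x"
  proof (rule jet1_hom_eq[OF M left_module_group[OF M] _ _ _ x])
    show "(\<lambda>x. jet1_proj K A \<Omega> M (b \<odot>\<^bsub>jet1 K A \<Omega> M\<^esub> x)) \<in> add_hom (jet1 K A \<Omega> M) M"
      by (rule add_hom_comp[OF lsmult_hom[OF jet1_module[OF M] b] jet1_proj_hom[OF M]])
    show "(\<lambda>x. b \<odot>\<^bsub>M\<^esub> jet1_proj K A \<Omega> M x) \<in> add_hom (jet1 K A \<Omega> M) M"
      by (rule add_hom_comp[OF jet1_proj_hom[OF M] lsmult_hom[OF M b]])
    fix a e assume "a \<in> carrier A" "e \<in> carrier M"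
    then show "jet1_proj K A \<Omega> M (b \<odot>\<^bsub>jet1 K A \<Omega> M\<^esub> jet1_class K A \<Omega> M a e)
        = b \<odot>\<^bsub>M\<^esub> jet1_proj K A \<Omega> M (jet1_class K A \<Omega> M a e)"
      using M b by (simp add: jet1_class_smult jet1_proj_class A.B.m_closed left_module.lsmult_assoc)
  qed
qed

text \<open>On a generator, d(b a) \<otimes> e = b da \<otimes> e + db a \<otimes> e; in the last
  term a crosses the tensor product and produces the projection a e.\<close>

lemma jet1_form_smult:
  assumes M: "left_module A M" and b: "b \<in> carrier A" and x: "x \<in> carrier (jet1 K A \<Omega> M)"
  shows "jet1_form M (b \<odot>\<^bsub>jet1 K A \<Omega> M\<^esub> x)
    = wedge 0 1 M b (jet1_form M x) \<oplus>\<^bsub>forms_in A \<Omega> 1 M\<^esub> form_tensor A \<Omega> 1 M (diff \<Omega> b) (jet1_proj K A \<Omega> M x)"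
proof (rule jet1_hom_eq[OF M forms_in_group[OF M] _ _ _ x])
  let ?F = "forms_in A \<Omega> 1 M"
  interpret F: abelian_group ?F by (rule forms_in_group[OF M])
  have b0: "b \<in> grade \<Omega> 0" using b by (simp add: carrier_A)
  note w = wedge_hom[OF M b0, of 1, unfolded add_0]
  show "(\<lambda>x. jet1_form M (b \<odot>\<^bsub>jet1 K A \<Omega> M\<^esub> x)) \<in> add_hom (jet1 K A \<Omega> M) ?F"
    by (rule add_hom_comp[OF lsmult_hom[OF jet1_module[OF M] b] jet1_form_hom[OF M]])
  show "(\<lambda>x. wedge 0 1 M b (jet1_form M x)
      \<oplus>\<^bsub>?F\<^esub> form_tensor A \<Omega> 1 M (diff \<Omega> b) (jet1_proj K A \<Omega> M x)) \<in> add_hom (jet1 K A \<Omega> M) ?F"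
    by (intro add_hom_sum forms_in_group M add_hom_comp[OF jet1_form_hom[OF M] w]
        add_hom_comp[OF jet1_proj_hom[OF M] form_tensor_hom_right[OF M diff_A[OF b]]])
  fix a e assume a: "a \<in> carrier A" and e: "e \<in> carrier M"
  have d: "diff \<Omega> b \<in> grade \<Omega> 1" "diff \<Omega> a \<in> grade \<Omega> 1" using a b diff_A by blast+
  have "jet1_form M (b \<odot>\<^bsub>jet1 K A \<Omega> M\<^esub> jet1_class K A \<Omega> M a e)
      = form_tensor A \<Omega> 1 M (diff \<Omega> (b \<otimes>\<^bsub>\<Omega>\<^esub> a)) e"
    using a b e by (simp add: jet1_class_smult[OF M] jet1_form_class[OF M] A.B.m_closed mult_A[symmetric]
        del: One_nat_def)
  also have "\<dots> = form_tensor A \<Omega> 1 M (diff \<Omega> b \<otimes>\<^bsub>\<Omega>\<^esub> a) e \<oplus>\<^bsub>?F\<^esub> form_tensor A \<Omega> 1 M (b \<otimes>\<^bsub>\<Omega>\<^esub> diff \<Omega> a) e"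
    unfolding diff_A_mult[OF b A_closed[OF a]]
    by (intro form_tensor_add_left M e grade_mult_A A_mult_grade a b d)
  also have "\<dots> = form_tensor A \<Omega> 1 M (b \<otimes>\<^bsub>\<Omega>\<^esub> diff \<Omega> a) e \<oplus>\<^bsub>?F\<^esub> form_tensor A \<Omega> 1 M (diff \<Omega> b) (a \<odot>\<^bsub>M\<^esub> e)"
    unfolding form_tensor_balanced[OF M d(1) a e]
    by (intro F.a_comm form_tensor_closed M e d A_mult_grade a b left_module.lsmult_closed[OF M])
  also have "form_tensor A \<Omega> 1 M (b \<otimes>\<^bsub>\<Omega>\<^esub> diff \<Omega> a) e = wedge 0 1 M b (form_tensor A \<Omega> 1 M (diff \<Omega> a) e)"
    using wedge_tensor[OF M b0 d(2) e] by simp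
  finally show "jet1_form M (b \<odot>\<^bsub>jet1 K A \<Omega> M\<^esub> jet1_class K A \<Omega> M a e)
      = wedge 0 1 M b (jet1_form M (jet1_class K A \<Omega> M a e))
        \<oplus>\<^bsub>?F\<^esub> form_tensor A \<Omega> 1 M (diff \<Omega> b) (jet1_proj K A \<Omega> M (jet1_class K A \<Omega> M a e))"
    unfolding jet1_proj_class[OF M a e] jet1_form_class[OF M a e] .
qed

text \<open>Rather than descending from tensors, J^1(f) is recovered from its graph in components:
  the image of x must have projection f(\<pi>(x)) and form (id \<otimes> f)(\<rho>(x)). An element
  with these components exists for generators and hence for sums, and \<open>jet1_eqI\<close> makes
  it unique.\<close>

lemma
  assumes M: "left_module A M" and N: "left_module A N" and f: "f \<in> left_linear A M N"
  shows jet1_map_hom: "jet1_map K A \<Omega> M N f \<in> add_hom (jet1 K A \<Omega> M) (jet1 K A \<Omega> N)"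
    and jet1_map_class: "\<lbrakk>a \<in> carrier A; e \<in> carrier M\<rbrakk> \<Longrightarrow>
      jet1_map K A \<Omega> M N f (jet1_class K A \<Omega> M a e) = jet1_class K A \<Omega> N a (f e)"
proof -
  let ?J = "jet1 K A \<Omega> M" and ?J' = "jet1 K A \<Omega> N"
  interpret J: abelian_group ?J by (rule jet1_group[OF M])
  interpret J': abelian_group ?J' by (rule jet1_group[OF N])
  note fh = left_linear_hom[OF f]
  note hM = jet1_proj_hom[OF M] jet1_form_hom[OF M] and hN = jet1_proj_hom[OF N] jet1_form_hom[OF N]
  obtain F where F: "F \<in> add_hom (forms_in A \<Omega> 1 M) (forms_in A \<Omega> 1 N)"
    "\<And>w m. \<lbrakk>w \<in> grade \<Omega> 1; m \<in> carrier M\<rbrakk> \<Longrightarrow>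
      F (form_tensor A \<Omega> 1 M w m) = form_tensor A \<Omega> 1 N w (f m)"
    using forms_in_map[OF M N f] by blast
  note p = add_hom_comp[OF hM(1) fh] and r = add_hom_comp[OF hM(2) F(1)]
  let ?P = "\<lambda>x y. y \<in> carrier ?J' \<and> jet1_proj K A \<Omega> N y = f (jet1_proj K A \<Omega> M x)
      \<and> jet1_form N y = F (jet1_form M x)"
  have cls: "?P (jet1_class K A \<Omega> M a e) (jet1_class K A \<Omega> N a (f e))"
    if "a \<in> carrier A" "e \<in> carrier M" for a e
    using that M N f add_hom_closed[OF fh]
    by (simp add: jet1_class_closed jet1_proj_class jet1_form_class[OF M] jet1_form_class[OF N]
        F(2)[OF diff_A] left_linear_smult[OF f] del: One_nat_def)
  have sum: "?P (x \<oplus>\<^bsub>?J\<^esub> x') (y \<oplus>\<^bsub>?J'\<^esub> y')"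
    if "?P x y" "?P x' y'" "x \<in> carrier ?J" "x' \<in> carrier ?J" for x x' y y'
    using that by (simp add: add_hom_add[OF p] add_hom_add[OF r] add_hom_add[OF hN(1)] add_hom_add[OF hN(2)]
        del: One_nat_def)
  have ex: "\<exists>y. ?P x y" if "x \<in> carrier ?J" for x
    using M that
  proof (induction x rule: jet1_induct)
    case zero
    have "?P \<zero>\<^bsub>?J\<^esub> \<zero>\<^bsub>?J'\<^esub>"
      using add_hom_zero[OF J.abelian_group_axioms left_module_group[OF N] p]
        add_hom_zero[OF J.abelian_group_axioms forms_in_group[OF N] r]
        add_hom_zero[OF J'.abelian_group_axioms left_module_group[OF N] hN(1)]
        add_hom_zero[OF J'.abelian_group_axioms forms_in_group[OF N] hN(2)] by simp
    then show ?case by blast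
  next
    case (jet a e)
    then show ?case using cls by blast
  next
    case (add x x')
    then obtain y y' where "?P x y" "?P x' y'" by blast
    from sum[OF this add(1,2)] show ?case by blast
  qed
  \<comment> \<open>The choice is determined by \<open>uniq\<close> below, and uniqueness turns
    \<open>sum\<close> into additivity of g.\<close>
  define g where "g x = (SOME y. ?P x y)" for x
  have g: "?P x (g x)" if "x \<in> carrier ?J" for x
    unfolding g_def by (rule someI_ex) (rule ex[OF that])
  have uniq: "y = g x" if "x \<in> carrier ?J" "?P x y" for x y
    by (rule jet1_eqI[OF N]) (use that(2) g[OF that(1)] in simp_all)
  have hom: "g \<in> add_hom ?J ?J'"
  proof (rule add_homI)
    fix x x' assume x: "x \<in> carrier ?J" "x' \<in> carrier ?J"
    show "g x \<in> carrier ?J'" using g[OF x(1)] by blast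
    show "g (x \<oplus>\<^bsub>?J\<^esub> x') = g x \<oplus>\<^bsub>?J'\<^esub> g x'"
      by (rule uniq[symmetric, OF _ sum[OF g g]]) (use x in auto)
  qed
  have g_class: "g (jet1_class K A \<Omega> M a e) = jet1_class K A \<Omega> N a (f e)"
    if "a \<in> carrier A" "e \<in> carrier M" for a e
    using uniq[OF jet1_class_closed[OF M that] cls[OF that]] by simp
  have map: "jet1_map K A \<Omega> M N f = restrict g (carrier ?J)"
    unfolding jet1_map_def by (rule jet1_additive_map[OF M jet1_group[OF N] hom g_class])
  show "jet1_map K A \<Omega> M N f \<in> add_hom ?J ?J'"
    unfolding map by (rule add_hom_restrict[OF J.abelian_group_axioms hom])
  show "jet1_map K A \<Omega> M N f (jet1_class K A \<Omega> M a e) = jet1_class K A \<Omega> N a (f e)"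
    if "a \<in> carrier A" "e \<in> carrier M"
    using that g_class jet1_class_closed[OF M that] by (simp add: map)
qed

section \<open>Linearity, functoriality and naturality\<close>

lemma jet1_map_linear:
  assumes M: "left_module A M" and N: "left_module A N" and f: "f \<in> left_linear A M N"
  shows "jet1_map K A \<Omega> M N f \<in> left_linear A (jet1 K A \<Omega> M) (jet1 K A \<Omega> N)"
proof (rule left_linearI[OF jet1_map_hom[OF M N f]])
  fix b x assume b: "b \<in> carrier A" and x: "x \<in> carrier (jet1 K A \<Omega> M)"
  show "jet1_map K A \<Omega> M N f (b \<odot>\<^bsub>jet1 K A \<Omega> M\<^esub> x) = b \<odot>\<^bsub>jet1 K A \<Omega> N\<^esub> jet1_map K A \<Omega> M N f x"
  proof (rule jet1_hom_eq[OF M jet1_group[OF N] _ _ _ x])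
    show "(\<lambda>x. jet1_map K A \<Omega> M N f (b \<odot>\<^bsub>jet1 K A \<Omega> M\<^esub> x)) \<in> add_hom (jet1 K A \<Omega> M) (jet1 K A \<Omega> N)"
      by (rule add_hom_comp[OF lsmult_hom[OF jet1_module[OF M] b] jet1_map_hom[OF M N f]])
    show "(\<lambda>x. b \<odot>\<^bsub>jet1 K A \<Omega> N\<^esub> jet1_map K A \<Omega> M N f x) \<in> add_hom (jet1 K A \<Omega> M) (jet1 K A \<Omega> N)"
      by (rule add_hom_comp[OF jet1_map_hom[OF M N f] lsmult_hom[OF jet1_module[OF N] b]])
    fix a e assume "a \<in> carrier A" "e \<in> carrier M"
    then show "jet1_map K A \<Omega> M N f (b \<odot>\<^bsub>jet1 K A \<Omega> M\<^esub> jet1_class K A \<Omega> M a e)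
        = b \<odot>\<^bsub>jet1 K A \<Omega> N\<^esub> jet1_map K A \<Omega> M N f (jet1_class K A \<Omega> M a e)"
      using b add_hom_closed[OF left_linear_hom[OF f]]
      by (simp add: jet1_class_smult[OF M] jet1_class_smult[OF N] jet1_map_class[OF M N f] A.B.m_closed)
  qed
qed

lemma jet1_map_comp:
  assumes L: "left_module A L" and M: "left_module A M" and N: "left_module A N"
    and f: "f \<in> left_linear A L M" and g: "g \<in> left_linear A M N"
    and x: "x \<in> carrier (jet1 K A \<Omega> L)"
  shows "jet1_map K A \<Omega> M N g (jet1_map K A \<Omega> L M f x) = jet1_map K A \<Omega> L N (\<lambda>x. g (f x)) x"
  by (rule jet1_hom_eq[OF L jet1_group[OF N] add_hom_comp[OF jet1_map_hom[OF L M f] jet1_map_hom[OF M N g]]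
        jet1_map_hom[OF L N left_linear_comp[OF f g]] _ x])
     (simp add: jet1_map_class[OF L M f] jet1_map_class[OF M N g] add_hom_closed[OF left_linear_hom[OF f]]
        jet1_map_class[OF L N left_linear_comp[OF f g]])

text \<open>The map f has to be the identity on the carrier only: in the application it is the
  composite of C, l and \<pi>, which is controlled only there.\<close>

lemma jet1_map_id:
  assumes M: "left_module A M" and f: "f \<in> left_linear A M M"
    and id: "\<And>e. e \<in> carrier M \<Longrightarrow> f e = e" and x: "x \<in> carrier (jet1 K A \<Omega> M)"
  shows "jet1_map K A \<Omega> M M f x = x"
proof (rule jet1_hom_eq[OF M jet1_group[OF M] jet1_map_hom[OF M M f] _ _ x])
  show "(\<lambda>x. x) \<in> add_hom (jet1 K A \<Omega> M) (jet1 K A \<Omega> M)" by (intro add_homI) simp_all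
qed (simp add: jet1_map_class[OF M M f] id)

text \<open>On [a \<otimes> e] the left side is a f(e) and the right side is f(a e), equal by
  linearity of f.\<close>

lemma jet1_proj_natural:
  assumes M: "left_module A M" and N: "left_module A N" and f: "f \<in> left_linear A M N"
    and x: "x \<in> carrier (jet1 K A \<Omega> M)"
  shows "jet1_proj K A \<Omega> N (jet1_map K A \<Omega> M N f x) = f (jet1_proj K A \<Omega> M x)"
  by (rule jet1_hom_eq[OF M left_module_group[OF N] add_hom_comp[OF jet1_map_hom[OF M N f] jet1_proj_hom[OF N]]
        add_hom_comp[OF jet1_proj_hom[OF M] left_linear_hom[OF f]] _ x])
     (simp add: jet1_map_class[OF M N f] jet1_proj_class[OF N] jet1_proj_class[OF M]
        add_hom_closed[OF left_linear_hom[OF f]] left_linear_smult[OF f])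

end


section \<open>The maps \<open>D_I\<close> and \<open>D_II\<close>\<close>

context exterior_algebra
begin

text \<open>There are two layers of generators: with the outer coefficient fixed, both sides are
  additive in the inner jet, so \<open>jet1_hom_eq\<close> is used once more inside.\<close>

lemma jet2_hom_eq:
  assumes M: "left_module A M" and G: "abelian_group G"
    and f: "f \<in> add_hom (jet1 K A \<Omega> (jet1 K A \<Omega> M)) G"
    and g: "g \<in> add_hom (jet1 K A \<Omega> (jet1 K A \<Omega> M)) G"
    and eq: "\<And>a c e. \<lbrakk>a \<in> carrier A; c \<in> carrier A; e \<in> carrier M\<rbrakk> \<Longrightarrow>
      f (jet1_class K A \<Omega> (jet1 K A \<Omega> M) a (jet1_class K A \<Omega> M c e))
        = g (jet1_class K A \<Omega> (jet1 K A \<Omega> M) a (jet1_class K A \<Omega> M c e))"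
    and y: "y \<in> carrier (jet1 K A \<Omega> (jet1 K A \<Omega> M))"
  shows "f y = g y"
proof (rule jet1_hom_eq[OF jet1_module[OF M] G f g _ y])
  fix a j assume a: "a \<in> carrier A" and j: "j \<in> carrier (jet1 K A \<Omega> M)"
  note h = jet1_class_hom_right[OF jet1_module[OF M] a]
  show "f (jet1_class K A \<Omega> (jet1 K A \<Omega> M) a j) = g (jet1_class K A \<Omega> (jet1 K A \<Omega> M) a j)"
    by (rule jet1_hom_eq[OF M G add_hom_comp[OF h f] add_hom_comp[OF h g] _ j]) (simp add: eq a)
qed

lemma jet2_additive_map:
  assumes M: "left_module A M" and G: "abelian_group G"
    and f: "f \<in> add_hom (jet1 K A \<Omega> (jet1 K A \<Omega> M)) G"
    and eq: "\<And>a c e. \<lbrakk>a \<in> carrier A; c \<in> carrier A; e \<in> carrier M\<rbrakk> \<Longrightarrow>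
      f (jet1_class K A \<Omega> (jet1 K A \<Omega> M) a (jet1_class K A \<Omega> M c e)) = v a c e"
  shows "additive_map (jet1 K A \<Omega> (jet1 K A \<Omega> M)) G
      (\<lambda>g. \<forall>a\<in>carrier A. \<forall>c\<in>carrier A. \<forall>e\<in>carrier M.
        g (jet1_class K A \<Omega> (jet1 K A \<Omega> M) a (jet1_class K A \<Omega> M c e)) = v a c e)
    = restrict f (carrier (jet1 K A \<Omega> (jet1 K A \<Omega> M)))"
proof (rule additive_map_eq[OF f])
  let ?JJ = "jet1 K A \<Omega> (jet1 K A \<Omega> M)"
  interpret JJ: abelian_group ?JJ by (rule jet1_group[OF jet1_module[OF M]])
  show "x \<oplus>\<^bsub>?JJ\<^esub> y \<in> carrier ?JJ" if "x \<in> carrier ?JJ" "y \<in> carrier ?JJ" for x y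
    using that by simp
  show "\<forall>x\<in>carrier ?JJ. g x = f x"
    if g: "g \<in> add_hom ?JJ G" "\<forall>a\<in>carrier A. \<forall>c\<in>carrier A. \<forall>e\<in>carrier M.
        g (jet1_class K A \<Omega> (jet1 K A \<Omega> M) a (jet1_class K A \<Omega> M c e)) = v a c e" for g
  proof
    fix x assume "x \<in> carrier ?JJ"
    then show "g x = f x"
      by (rule jet2_hom_eq[OF M G g(1) f, rotated]) (simp add: eq g(2))
  qed
qed (use eq jet1_class_closed[OF M] jet1_class_closed[OF jet1_module[OF M]] in auto)

text \<open>In \<open>J\<^sup>1J\<^sup>1\<close> both \<open>\<pi>\<close> of the outer jets and the prolongation of \<open>\<pi>\<close> of the inner jets
  lead to \<open>J\<^sup>1\<close>; \<open>D_I\<close> is the difference of the two after applying \<open>[a \<otimes> e] \<mapsto> da \<otimes> e\<close>.\<close>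

lemma
  assumes M: "left_module A M"
  shows D_I_hom: "D_I K A \<Omega> M \<in> add_hom (jet1 K A \<Omega> (jet1 K A \<Omega> M)) (forms_in A \<Omega> 1 M)"
    and D_I_eq: "y \<in> carrier (jet1 K A \<Omega> (jet1 K A \<Omega> M)) \<Longrightarrow>
      D_I K A \<Omega> M y = jet1_form M (jet1_proj K A \<Omega> (jet1 K A \<Omega> M) y)
        \<ominus>\<^bsub>forms_in A \<Omega> 1 M\<^esub> jet1_form M (jet1_map K A \<Omega> (jet1 K A \<Omega> M) M (jet1_proj K A \<Omega> M) y)"
    and D_I_class: "\<lbrakk>a \<in> carrier A; c \<in> carrier A; e \<in> carrier M\<rbrakk> \<Longrightarrow>
      D_I K A \<Omega> M (jet1_class K A \<Omega> (jet1 K A \<Omega> M) a (jet1_class K A \<Omega> M c e))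
        = form_tensor A \<Omega> 1 M (a \<otimes>\<^bsub>\<Omega>\<^esub> diff \<Omega> c) e"
proof -
  let ?J = "jet1 K A \<Omega> M" and ?F = "forms_in A \<Omega> 1 M"
  let ?JJ = "jet1 K A \<Omega> ?J"
  note J = jet1_module[OF M]
  note F = forms_in_group[OF M, of 1]
  interpret F: abelian_group ?F by (rule F)
  note p = jet1_proj_linear[OF M]
  let ?f = "\<lambda>y. jet1_form M (jet1_proj K A \<Omega> ?J y) \<ominus>\<^bsub>?F\<^esub> jet1_form M (jet1_map K A \<Omega> ?J M (jet1_proj K A \<Omega> M) y)"
  have hom: "?f \<in> add_hom ?JJ ?F"
    by (rule add_hom_diff[OF F add_hom_comp[OF jet1_proj_hom[OF J] jet1_form_hom[OF M]]
        add_hom_comp[OF jet1_map_hom[OF J M p] jet1_form_hom[OF M]]])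
  \<comment> \<open>The two terms are d(a c) \<otimes> e = da \<otimes> c e + a dc \<otimes> e and
    da \<otimes> c e; their common part cancels.\<close>
  have val: "?f (jet1_class K A \<Omega> ?J a (jet1_class K A \<Omega> M c e)) = form_tensor A \<Omega> 1 M (a \<otimes>\<^bsub>\<Omega>\<^esub> diff \<Omega> c) e"
    if a: "a \<in> carrier A" and c: "c \<in> carrier A" and e: "e \<in> carrier M" for a c e
  proof -
    note ce = jet1_class_closed[OF M c e]
    have d: "diff \<Omega> a \<in> grade \<Omega> 1" "diff \<Omega> c \<in> grade \<Omega> 1" using a c diff_A by blast+
    have ft: "form_tensor A \<Omega> 1 M (diff \<Omega> a) (c \<odot>\<^bsub>M\<^esub> e) \<in> carrier ?F"
      "form_tensor A \<Omega> 1 M (a \<otimes>\<^bsub>\<Omega>\<^esub> diff \<Omega> c) e \<in> carrier ?F"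
      by (intro form_tensor_closed M d e A_mult_grade a left_module.lsmult_closed[OF M] c)+
    have "jet1_form M (jet1_proj K A \<Omega> ?J (jet1_class K A \<Omega> ?J a (jet1_class K A \<Omega> M c e)))
        = form_tensor A \<Omega> 1 M (diff \<Omega> (a \<otimes>\<^bsub>\<Omega>\<^esub> c)) e"
      using a c e by (simp add: jet1_proj_class[OF J a ce] jet1_class_smult[OF M] jet1_form_class[OF M]
          A.B.m_closed mult_A[symmetric] del: One_nat_def)
    also have "\<dots> = form_tensor A \<Omega> 1 M (diff \<Omega> a \<otimes>\<^bsub>\<Omega>\<^esub> c) e \<oplus>\<^bsub>?F\<^esub> form_tensor A \<Omega> 1 M (a \<otimes>\<^bsub>\<Omega>\<^esub> diff \<Omega> c) e"
      unfolding diff_A_mult[OF a A_closed[OF c]]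
      by (intro form_tensor_add_left M e grade_mult_A A_mult_grade a c d)
    also have "form_tensor A \<Omega> 1 M (diff \<Omega> a \<otimes>\<^bsub>\<Omega>\<^esub> c) e = form_tensor A \<Omega> 1 M (diff \<Omega> a) (c \<odot>\<^bsub>M\<^esub> e)"
      by (rule form_tensor_balanced[OF M d(1) c e])
    finally have 1: "jet1_form M (jet1_proj K A \<Omega> ?J (jet1_class K A \<Omega> ?J a (jet1_class K A \<Omega> M c e)))
        = form_tensor A \<Omega> 1 M (diff \<Omega> a) (c \<odot>\<^bsub>M\<^esub> e) \<oplus>\<^bsub>?F\<^esub> form_tensor A \<Omega> 1 M (a \<otimes>\<^bsub>\<Omega>\<^esub> diff \<Omega> c) e" .
    have 2: "jet1_form M (jet1_map K A \<Omega> ?J M (jet1_proj K A \<Omega> M) (jet1_class K A \<Omega> ?J a (jet1_class K A \<Omega> M c e)))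
        = form_tensor A \<Omega> 1 M (diff \<Omega> a) (c \<odot>\<^bsub>M\<^esub> e)"
      using jet1_map_class[OF J M p a ce] jet1_proj_class[OF M c e]
        jet1_form_class[OF M a left_module.lsmult_closed[OF M c e]] by simp
    show ?thesis
      unfolding 1 2 a_minus_def F.a_comm[OF ft]
      using ft by (simp only: F.a_inv_closed F.a_assoc F.r_neg F.r_zero)
  qed
  have D: "D_I K A \<Omega> M = restrict ?f (carrier ?JJ)"
    unfolding D_I_def by (rule jet2_additive_map[OF M F hom val])
  show "D_I K A \<Omega> M \<in> add_hom ?JJ ?F"
    unfolding D by (rule add_hom_restrict[OF jet1_group[OF J] hom])
  show "D_I K A \<Omega> M y = ?f y" if "y \<in> carrier ?JJ"
    using that by (simp add: D)
  show "D_I K A \<Omega> M (jet1_class K A \<Omega> ?J a (jet1_class K A \<Omega> M c e)) = form_tensor A \<Omega> 1 M (a \<otimes>\<^bsub>\<Omega>\<^esub> diff \<Omega> c) e"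
    if "a \<in> carrier A" "c \<in> carrier A" "e \<in> carrier M"
    using val[OF that] jet1_class_closed[OF J that(1) jet1_class_closed[OF M that(2,3)]] by (simp add: D)
qed

text \<open>The map \<open>w \<otimes> j \<mapsto> w \<and> \<rho> j\<close>, with \<open>\<rho>\<close> the derivation \<open>jet1_form\<close>, is not balanced;
  the correction by \<open>dw \<otimes> \<pi> j\<close> makes it so and vanishes when \<open>w\<close> is exact.\<close>

lemma forms_in_jet1_wedge:
  assumes M: "left_module A M"
  obtains \<sigma> where "\<sigma> \<in> add_hom (forms_in A \<Omega> 1 (jet1 K A \<Omega> M)) (forms_in A \<Omega> 2 M)"
    and "\<And>w j. \<lbrakk>w \<in> grade \<Omega> 1; j \<in> carrier (jet1 K A \<Omega> M)\<rbrakk> \<Longrightarrow>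
      \<sigma> (form_tensor A \<Omega> 1 (jet1 K A \<Omega> M) w j) = wedge 1 1 M w (jet1_form M j)
        \<ominus>\<^bsub>forms_in A \<Omega> 2 M\<^esub> form_tensor A \<Omega> 2 M (diff \<Omega> w) (jet1_proj K A \<Omega> M j)"
proof -
  let ?J = "jet1 K A \<Omega> M" and ?F = "forms_in A \<Omega> 2 M"
  note J = jet1_module[OF M] and F = forms_in_group[OF M, of 2]
  interpret F: abelian_group ?F by (rule F)
  interpret F1: abelian_group "forms_in A \<Omega> 1 M" by (rule forms_in_group[OF M])
  let ?f = "\<lambda>w j. wedge 1 1 M w (jet1_form M j) \<ominus>\<^bsub>?F\<^esub> form_tensor A \<Omega> 2 M (diff \<Omega> w) (jet1_proj K A \<Omega> M j)"
  note w_hom = wedge_hom[OF M, of _ 1 1, unfolded one_add_one]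
  note w_tensor = wedge_tensor[OF M, of _ 1 _ 1, unfolded one_add_one]
  note w_add = wedge_add[OF M, of _ 1 _ _ 1, unfolded one_add_one]
  note r_hom = jet1_form_hom[OF M] and p_hom = jet1_proj_hom[OF M]
  have hom: "?f w \<in> add_hom ?J ?F" if "w \<in> grade \<Omega> 1" for w
    by (rule add_hom_diff[OF F add_hom_comp[OF r_hom w_hom[OF that]]
        add_hom_comp[OF p_hom form_tensor_hom_right[OF M diff_grade1[OF that]]]])
  have cl: "wedge 1 1 M w (jet1_form M j) \<in> carrier ?F"
    "form_tensor A \<Omega> 2 M (diff \<Omega> w) (jet1_proj K A \<Omega> M j) \<in> carrier ?F"
    if "w \<in> grade \<Omega> 1" "j \<in> carrier ?J" for w j
    using add_hom_closed[OF add_hom_comp[OF r_hom w_hom[OF that(1)]] that(2)]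
      add_hom_closed[OF add_hom_comp[OF p_hom form_tensor_hom_right[OF M diff_grade1[OF that(1)]]] that(2)]
    by blast+
  obtain \<sigma> where "\<sigma> \<in> add_hom (forms_in A \<Omega> 1 ?J) ?F"
    and "\<And>w j. \<lbrakk>w \<in> grade \<Omega> 1; j \<in> carrier ?J\<rbrakk> \<Longrightarrow> \<sigma> (form_tensor A \<Omega> 1 ?J w j) = ?f w j"
  proof (rule forms_in_lift[OF J F, of 1 ?f])
    fix v w b j j'
    assume v: "v \<in> grade \<Omega> 1" and j: "j \<in> carrier ?J"
    show "?f v j \<in> carrier ?F" by (rule add_hom_closed[OF hom[OF v] j])
    show "?f v (j \<oplus>\<^bsub>?J\<^esub> j') = ?f v j \<oplus>\<^bsub>?F\<^esub> ?f v j'" if "j' \<in> carrier ?J"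
      by (rule add_hom_add[OF hom[OF v] j that])
    show "?f (v \<oplus>\<^bsub>\<Omega>\<^esub> w) j = ?f v j \<oplus>\<^bsub>?F\<^esub> ?f w j" if w: "w \<in> grade \<Omega> 1"
    proof -
      have "wedge 1 1 M (v \<oplus>\<^bsub>\<Omega>\<^esub> w) (jet1_form M j)
          = wedge 1 1 M v (jet1_form M j) \<oplus>\<^bsub>?F\<^esub> wedge 1 1 M w (jet1_form M j)"
        by (rule w_add[OF v w add_hom_closed[OF r_hom j]])
      moreover have "form_tensor A \<Omega> 2 M (diff \<Omega> (v \<oplus>\<^bsub>\<Omega>\<^esub> w)) (jet1_proj K A \<Omega> M j)
          = form_tensor A \<Omega> 2 M (diff \<Omega> v) (jet1_proj K A \<Omega> M j)
            \<oplus>\<^bsub>?F\<^esub> form_tensor A \<Omega> 2 M (diff \<Omega> w) (jet1_proj K A \<Omega> M j)"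
        unfolding diff_add[OF grade_closed[OF v] grade_closed[OF w]]
        by (rule form_tensor_add_left[OF M diff_grade1[OF v] diff_grade1[OF w] add_hom_closed[OF p_hom j]])
      ultimately show ?thesis
        using cl[OF v j] cl[OF w j] by (simp only: a_minus_def F.minus_add F.a_ac F.a_inv_closed F.a_closed)
    qed
    \<comment> \<open>The term v \<and> \<rho>(b j) expands to v b \<and> \<rho>(j) + (v \<and> db)
      \<otimes> \<pi>(j), and dv \<otimes> \<pi>(b j) is dv b \<otimes> \<pi>(j). Since dv b - v
      \<and> db = d(v b), what remains next to v b \<and> \<rho>(j) is the correction term for v
      b.\<close>
    show "?f (v \<otimes>\<^bsub>\<Omega>\<^esub> b) j = ?f v (b \<odot>\<^bsub>?J\<^esub> j)" if b: "b \<in> carrier A"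
    proof -
      let ?p = "jet1_proj K A \<Omega> M j" and ?r = "jet1_form M j"
      have b0: "b \<in> grade \<Omega> 0" using b by (simp add: carrier_A)
      have p: "?p \<in> carrier M" and r: "?r \<in> carrier (forms_in A \<Omega> 1 M)"
        using add_hom_closed[OF p_hom j] add_hom_closed[OF r_hom j] .
      have db: "diff \<Omega> b \<in> grade \<Omega> 1" using b by (rule diff_A)
      have vdb: "v \<otimes>\<^bsub>\<Omega>\<^esub> diff \<Omega> b \<in> grade \<Omega> 2" using grade_mult[OF v db] by (simp add: numeral_2_eq_2)
      have dvb: "diff \<Omega> v \<otimes>\<^bsub>\<Omega>\<^esub> b \<in> grade \<Omega> 2" by (rule grade_mult_A[OF diff_grade1[OF v] b])
      have br: "wedge 0 1 M b ?r \<in> carrier (forms_in A \<Omega> 1 M)"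
        by (rule add_hom_closed[OF wedge_hom[OF M b0, of 1, unfolded add_0] r])
      have dbp: "form_tensor A \<Omega> 1 M (diff \<Omega> b) ?p \<in> carrier (forms_in A \<Omega> 1 M)"
        by (rule form_tensor_closed[OF M db p])
      have cl': "wedge 1 1 M v (wedge 0 1 M b ?r) \<in> carrier ?F"
        "form_tensor A \<Omega> 2 M (v \<otimes>\<^bsub>\<Omega>\<^esub> diff \<Omega> b) ?p \<in> carrier ?F"
        "form_tensor A \<Omega> 2 M (diff \<Omega> v \<otimes>\<^bsub>\<Omega>\<^esub> b) ?p \<in> carrier ?F"
        using add_hom_closed[OF w_hom[OF v] br] form_tensor_closed[OF M vdb p] form_tensor_closed[OF M dvb p] .
      have "?f v (b \<odot>\<^bsub>?J\<^esub> j) = wedge 1 1 M v (wedge 0 1 M b ?r \<oplus>\<^bsub>forms_in A \<Omega> 1 M\<^esub> form_tensor A \<Omega> 1 M (diff \<Omega> b) ?p)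
          \<ominus>\<^bsub>?F\<^esub> form_tensor A \<Omega> 2 M (diff \<Omega> v) (b \<odot>\<^bsub>M\<^esub> ?p)"
        by (simp only: jet1_form_smult[OF M b j] left_linear_smult[OF jet1_proj_linear[OF M] b j])
      also have "\<dots> = wedge 1 1 M v (wedge 0 1 M b ?r) \<oplus>\<^bsub>?F\<^esub> form_tensor A \<Omega> 2 M (v \<otimes>\<^bsub>\<Omega>\<^esub> diff \<Omega> b) ?p
          \<ominus>\<^bsub>?F\<^esub> form_tensor A \<Omega> 2 M (diff \<Omega> v \<otimes>\<^bsub>\<Omega>\<^esub> b) ?p"
        by (simp only: add_hom_add[OF w_hom[OF v] br dbp] w_tensor[OF v db p]
            form_tensor_balanced[OF M diff_grade1[OF v] b p])
      also have "\<dots> = wedge 1 1 M (v \<otimes>\<^bsub>\<Omega>\<^esub> b) ?r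
          \<ominus>\<^bsub>?F\<^esub> (form_tensor A \<Omega> 2 M (diff \<Omega> v \<otimes>\<^bsub>\<Omega>\<^esub> b) ?p \<ominus>\<^bsub>?F\<^esub> form_tensor A \<Omega> 2 M (v \<otimes>\<^bsub>\<Omega>\<^esub> diff \<Omega> b) ?p)"
        unfolding wedge_wedge_A[OF M v b r, symmetric]
        using cl' by (simp only: a_minus_def F.minus_add F.minus_minus F.a_ac F.a_inv_closed F.a_closed)
      also have "\<dots> = ?f (v \<otimes>\<^bsub>\<Omega>\<^esub> b) j"
        by (simp only: diff_mult_A[OF v b] form_tensor_diff_left[OF M dvb vdb p])
      finally show ?thesis by (rule sym)
    qed
  qed blast
  then show thesis using that by blast
qed

text \<open>\<open>D_II\<close> is \<sigma> after the outer form map: [a \<otimes> j] goes to da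
  \<otimes> j and then to da \<and> \<rho>(j), the correction being killed by d(da) = 0. At j =
  [c \<otimes> e] this is the prescribed value.\<close>

lemma
  assumes M: "left_module A M"
  shows D_II_hom: "D_II K A \<Omega> M \<in> add_hom (jet1 K A \<Omega> (jet1 K A \<Omega> M)) (forms_in A \<Omega> 2 M)"
    and D_II_class: "\<lbrakk>a \<in> carrier A; c \<in> carrier A; e \<in> carrier M\<rbrakk> \<Longrightarrow>
      D_II K A \<Omega> M (jet1_class K A \<Omega> (jet1 K A \<Omega> M) a (jet1_class K A \<Omega> M c e))
        = form_tensor A \<Omega> 2 M (diff \<Omega> a \<otimes>\<^bsub>\<Omega>\<^esub> diff \<Omega> c) e"
proof -
  let ?J = "jet1 K A \<Omega> M" and ?F = "forms_in A \<Omega> 2 M"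
  let ?JJ = "jet1 K A \<Omega> ?J"
  note J = jet1_module[OF M]
  note F = forms_in_group[OF M, of 2]
  interpret F: abelian_group ?F by (rule F)
  obtain \<sigma> where \<sigma>: "\<sigma> \<in> add_hom (forms_in A \<Omega> 1 ?J) ?F"
    "\<And>w j. \<lbrakk>w \<in> grade \<Omega> 1; j \<in> carrier ?J\<rbrakk> \<Longrightarrow>
      \<sigma> (form_tensor A \<Omega> 1 ?J w j) = wedge 1 1 M w (jet1_form M j)
        \<ominus>\<^bsub>?F\<^esub> form_tensor A \<Omega> 2 M (diff \<Omega> w) (jet1_proj K A \<Omega> M j)"
    using forms_in_jet1_wedge[OF M] by blast
  note hom = add_hom_comp[OF jet1_form_hom[OF J] \<sigma>(1)]
  have val: "\<sigma> (jet1_form ?J (jet1_class K A \<Omega> ?J a (jet1_class K A \<Omega> M c e)))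
      = form_tensor A \<Omega> 2 M (diff \<Omega> a \<otimes>\<^bsub>\<Omega>\<^esub> diff \<Omega> c) e"
    if a: "a \<in> carrier A" and c: "c \<in> carrier A" and e: "e \<in> carrier M" for a c e
  proof -
    note ce = jet1_class_closed[OF M c e]
    have d: "diff \<Omega> a \<in> grade \<Omega> 1" "diff \<Omega> c \<in> grade \<Omega> 1" using a c diff_A by blast+
    have dd: "diff \<Omega> a \<otimes>\<^bsub>\<Omega>\<^esub> diff \<Omega> c \<in> grade \<Omega> 2" using grade_mult[OF d] by (simp add: numeral_2_eq_2)
    have "form_tensor A \<Omega> 2 M (diff \<Omega> (diff \<Omega> a)) (c \<odot>\<^bsub>M\<^esub> e) = \<zero>\<^bsub>?F\<^esub>"
      unfolding diff_diff[OF A_closed[OF a]]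
      by (rule form_tensor_zero_left[OF M left_module.lsmult_closed[OF M c e]])
    then have "\<sigma> (jet1_form ?J (jet1_class K A \<Omega> ?J a (jet1_class K A \<Omega> M c e)))
        = form_tensor A \<Omega> 2 M (diff \<Omega> a \<otimes>\<^bsub>\<Omega>\<^esub> diff \<Omega> c) e \<ominus>\<^bsub>?F\<^esub> \<zero>\<^bsub>?F\<^esub>"
      by (simp only: jet1_form_class[OF J a ce] \<sigma>(2)[OF d(1) ce] jet1_form_class[OF M c e]
          jet1_proj_class[OF M c e] wedge_tensor[OF M d(1) d(2) e] one_add_one)
    then show ?thesis
      using form_tensor_closed[OF M dd e] by (simp add: a_minus_def)
  qed
  have D: "D_II K A \<Omega> M = restrict (\<lambda>y. \<sigma> (jet1_form ?J y)) (carrier ?JJ)"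
    unfolding D_II_def by (rule jet2_additive_map[OF M F hom val])
  show "D_II K A \<Omega> M \<in> add_hom ?JJ ?F"
    unfolding D by (rule add_hom_restrict[OF jet1_group[OF J] hom])
  show "D_II K A \<Omega> M (jet1_class K A \<Omega> ?J a (jet1_class K A \<Omega> M c e))
      = form_tensor A \<Omega> 2 M (diff \<Omega> a \<otimes>\<^bsub>\<Omega>\<^esub> diff \<Omega> c) e"
    if "a \<in> carrier A" "c \<in> carrier A" "e \<in> carrier M"
    using val[OF that] jet1_class_closed[OF J that(1) jet1_class_closed[OF M that(2,3)]] by (simp add: D)
qed

text \<open>\<open>D_I\<close> is A-linear although \<rho> is not, because the outer coefficient
  enters a dc \<otimes> e undifferentiated.\<close>

lemma D_I_smult:
  assumes M: "left_module A M" and b: "b \<in> carrier A"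
    and y: "y \<in> carrier (jet1 K A \<Omega> (jet1 K A \<Omega> M))"
  shows "D_I K A \<Omega> M (b \<odot>\<^bsub>jet1 K A \<Omega> (jet1 K A \<Omega> M)\<^esub> y) = wedge 0 1 M b (D_I K A \<Omega> M y)"
proof (rule jet2_hom_eq[OF M forms_in_group[OF M] _ _ _ y])
  note J = jet1_module[OF M]
  have b0: "b \<in> grade \<Omega> 0" using b by (simp add: carrier_A)
  show "(\<lambda>y. D_I K A \<Omega> M (b \<odot>\<^bsub>jet1 K A \<Omega> (jet1 K A \<Omega> M)\<^esub> y))
      \<in> add_hom (jet1 K A \<Omega> (jet1 K A \<Omega> M)) (forms_in A \<Omega> 1 M)"
    by (rule add_hom_comp[OF lsmult_hom[OF jet1_module[OF J] b] D_I_hom[OF M]])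
  show "(\<lambda>y. wedge 0 1 M b (D_I K A \<Omega> M y)) \<in> add_hom (jet1 K A \<Omega> (jet1 K A \<Omega> M)) (forms_in A \<Omega> 1 M)"
    by (rule add_hom_comp[OF D_I_hom[OF M] wedge_hom[OF M b0, of 1, unfolded add_0]])
  fix a c e assume a: "a \<in> carrier A" and c: "c \<in> carrier A" and e: "e \<in> carrier M"
  have dc: "diff \<Omega> c \<in> grade \<Omega> 1" using c by (rule diff_A)
  show "D_I K A \<Omega> M (b \<odot>\<^bsub>jet1 K A \<Omega> (jet1 K A \<Omega> M)\<^esub> jet1_class K A \<Omega> (jet1 K A \<Omega> M) a (jet1_class K A \<Omega> M c e))
      = wedge 0 1 M b (D_I K A \<Omega> M (jet1_class K A \<Omega> (jet1 K A \<Omega> M) a (jet1_class K A \<Omega> M c e)))"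
    unfolding jet1_class_smult[OF J a b jet1_class_closed[OF M c e]]
      D_I_class[OF M a c e] D_I_class[OF M A.B.m_closed[OF b a] c e]
      wedge_tensor[OF M b0 A_mult_grade[OF a dc] e] add_0
    unfolding mult_A B.m_assoc[OF A_closed[OF b] A_closed[OF a] grade_closed[OF dc]] ..
qed

text \<open>Here the outer coefficient is differentiated: d(b a) \<and> dc = b da \<and> dc + db
  \<and> a dc, and a dc is the form in the value of \<open>D_I\<close>. On the kernel of
  \<open>D_I\<close> the defect vanishes.\<close>

lemma D_II_smult:
  assumes M: "left_module A M" and b: "b \<in> carrier A"
    and y: "y \<in> carrier (jet1 K A \<Omega> (jet1 K A \<Omega> M))"
  shows "D_II K A \<Omega> M (b \<odot>\<^bsub>jet1 K A \<Omega> (jet1 K A \<Omega> M)\<^esub> y)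
    = wedge 0 2 M b (D_II K A \<Omega> M y) \<oplus>\<^bsub>forms_in A \<Omega> 2 M\<^esub> wedge 1 1 M (diff \<Omega> b) (D_I K A \<Omega> M y)"
proof (rule jet2_hom_eq[OF M forms_in_group[OF M] _ _ _ y])
  let ?J = "jet1 K A \<Omega> M" and ?F = "forms_in A \<Omega> 2 M"
  let ?JJ = "jet1 K A \<Omega> ?J"
  note J = jet1_module[OF M]
  interpret F: abelian_group ?F by (rule forms_in_group[OF M])
  have b0: "b \<in> grade \<Omega> 0" using b by (simp add: carrier_A)
  have db: "diff \<Omega> b \<in> grade \<Omega> 1" using b by (rule diff_A)
  show "(\<lambda>y. D_II K A \<Omega> M (b \<odot>\<^bsub>?JJ\<^esub> y)) \<in> add_hom ?JJ ?F"
    by (rule add_hom_comp[OF lsmult_hom[OF jet1_module[OF J] b] D_II_hom[OF M]])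
  show "(\<lambda>y. wedge 0 2 M b (D_II K A \<Omega> M y) \<oplus>\<^bsub>?F\<^esub> wedge 1 1 M (diff \<Omega> b) (D_I K A \<Omega> M y)) \<in> add_hom ?JJ ?F"
    by (rule add_hom_sum[OF forms_in_group[OF M]
        add_hom_comp[OF D_II_hom[OF M] wedge_hom[OF M b0, of 2, unfolded add_0]]
        add_hom_comp[OF D_I_hom[OF M] wedge_hom[OF M db, of 1, unfolded one_add_one]]])
  fix a c e assume a: "a \<in> carrier A" and c: "c \<in> carrier A" and e: "e \<in> carrier M"
  have da: "diff \<Omega> a \<in> grade \<Omega> 1" and dc: "diff \<Omega> c \<in> grade \<Omega> 1" using a c diff_A by blast+
  have dd: "diff \<Omega> a \<otimes>\<^bsub>\<Omega>\<^esub> diff \<Omega> c \<in> grade \<Omega> 2" using grade_mult[OF da dc] by (simp add: numeral_2_eq_2)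
  have adc: "a \<otimes>\<^bsub>\<Omega>\<^esub> diff \<Omega> c \<in> grade \<Omega> 1" by (rule A_mult_grade[OF a dc])
  have dbadc: "diff \<Omega> b \<otimes>\<^bsub>\<Omega>\<^esub> (a \<otimes>\<^bsub>\<Omega>\<^esub> diff \<Omega> c) \<in> grade \<Omega> 2"
    using grade_mult[OF db adc] by (simp add: numeral_2_eq_2)
  have bdd: "b \<otimes>\<^bsub>\<Omega>\<^esub> (diff \<Omega> a \<otimes>\<^bsub>\<Omega>\<^esub> diff \<Omega> c) \<in> grade \<Omega> 2" by (rule A_mult_grade[OF b dd])
  note in\<Omega> = A_closed[OF a] A_closed[OF b] grade_closed[OF da] grade_closed[OF db] grade_closed[OF dc]
  have "diff \<Omega> (b \<otimes>\<^bsub>\<Omega>\<^esub> a) \<otimes>\<^bsub>\<Omega>\<^esub> diff \<Omega> c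
      = diff \<Omega> b \<otimes>\<^bsub>\<Omega>\<^esub> (a \<otimes>\<^bsub>\<Omega>\<^esub> diff \<Omega> c) \<oplus>\<^bsub>\<Omega>\<^esub> b \<otimes>\<^bsub>\<Omega>\<^esub> (diff \<Omega> a \<otimes>\<^bsub>\<Omega>\<^esub> diff \<Omega> c)"
    using in\<Omega> by (simp add: diff_A_mult[OF b A_closed[OF a]] B.l_distr B.m_assoc)
  then have "form_tensor A \<Omega> 2 M (diff \<Omega> (b \<otimes>\<^bsub>\<Omega>\<^esub> a) \<otimes>\<^bsub>\<Omega>\<^esub> diff \<Omega> c) e
      = form_tensor A \<Omega> 2 M (b \<otimes>\<^bsub>\<Omega>\<^esub> (diff \<Omega> a \<otimes>\<^bsub>\<Omega>\<^esub> diff \<Omega> c)) e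
        \<oplus>\<^bsub>?F\<^esub> form_tensor A \<Omega> 2 M (diff \<Omega> b \<otimes>\<^bsub>\<Omega>\<^esub> (a \<otimes>\<^bsub>\<Omega>\<^esub> diff \<Omega> c)) e"
    using form_tensor_add_left[OF M dbadc bdd e]
      F.a_comm[OF form_tensor_closed[OF M dbadc e] form_tensor_closed[OF M bdd e]] by simp
  then show "D_II K A \<Omega> M (b \<odot>\<^bsub>?JJ\<^esub> jet1_class K A \<Omega> ?J a (jet1_class K A \<Omega> M c e))
      = wedge 0 2 M b (D_II K A \<Omega> M (jet1_class K A \<Omega> ?J a (jet1_class K A \<Omega> M c e)))
        \<oplus>\<^bsub>?F\<^esub> wedge 1 1 M (diff \<Omega> b) (D_I K A \<Omega> M (jet1_class K A \<Omega> ?J a (jet1_class K A \<Omega> M c e)))"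
    unfolding jet1_class_smult[OF J a b jet1_class_closed[OF M c e]] D_I_class[OF M a c e]
      D_II_class[OF M a c e] D_II_class[OF M A.B.m_closed[OF b a] c e]
      wedge_tensor[OF M b0 dd e] wedge_tensor[OF M db adc e] add_0 one_add_one
    unfolding mult_A .
qed


section \<open>Holonomic jets and connections\<close>

text \<open>Expresses the recursion through \<open>jet_incl\<close>. Later steps rewrite with this
  equation and take \<open>jets.simps\<close> out of the simplifier, so that jet modules of lower
  order stay folded.\<close>

lemma jets_Suc_Suc:
  "jets K A \<Omega> E (Suc (Suc n)) = (jet1 K A \<Omega> (jets K A \<Omega> E (Suc n)))\<lparr>carrier :=
    {x \<in> carrier (jet1 K A \<Omega> (jets K A \<Omega> E (Suc n))).
      D_I K A \<Omega> (jets K A \<Omega> E n) (jet1_map K A \<Omega> (jets K A \<Omega> E (Suc n))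
        (jet1 K A \<Omega> (jets K A \<Omega> E n)) (jet_incl K A \<Omega> E (Suc n)) x) = \<zero>\<^bsub>forms_in A \<Omega> 1 (jets K A \<Omega> E n)\<^esub>
      \<and> D_II K A \<Omega> (jets K A \<Omega> E n) (jet1_map K A \<Omega> (jets K A \<Omega> E (Suc n))
        (jet1 K A \<Omega> (jets K A \<Omega> E n)) (jet_incl K A \<Omega> E (Suc n)) x) = \<zero>\<^bsub>forms_in A \<Omega> 2 (jets K A \<Omega> E n)\<^esub>}\<rparr>"
  by (simp add: Let_def jet_incl_def)

text \<open>An arbitrary linear l is allowed, which keeps the induction over \<open>jets\<close>
  free of the concrete inclusion. Stability under scalars follows from linearity of J^1(l) and the
  two product formulas, all of whose terms vanish on a holonomic jet.\<close>

lemma holonomic_submodule: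
  assumes M: "left_module A M" and N: "left_module A N" and l: "l \<in> left_linear A N (jet1 K A \<Omega> M)"
  shows "left_module A ((jet1 K A \<Omega> N)\<lparr>carrier := {x \<in> carrier (jet1 K A \<Omega> N).
    D_I K A \<Omega> M (jet1_map K A \<Omega> N (jet1 K A \<Omega> M) l x) = \<zero>\<^bsub>forms_in A \<Omega> 1 M\<^esub>
    \<and> D_II K A \<Omega> M (jet1_map K A \<Omega> N (jet1 K A \<Omega> M) l x) = \<zero>\<^bsub>forms_in A \<Omega> 2 M\<^esub>}\<rparr>)"
proof -
  let ?J = "jet1 K A \<Omega> M" and ?F1 = "forms_in A \<Omega> 1 M" and ?F2 = "forms_in A \<Omega> 2 M"
  let ?l = "jet1_map K A \<Omega> N ?J l"
  note J = jet1_module[OF M]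
  interpret F1: abelian_group ?F1 by (rule forms_in_group[OF M])
  interpret F2: abelian_group ?F2 by (rule forms_in_group[OF M])
  interpret JN: abelian_group "jet1 K A \<Omega> N" by (rule jet1_group[OF N])
  note lin = jet1_map_linear[OF N J l]
  note lh = left_linear_hom[OF lin]
  note h1 = add_hom_comp[OF lh D_I_hom[OF M]] and h2 = add_hom_comp[OF lh D_II_hom[OF M]]
  show ?thesis
  \<comment> \<open>The cases are, in this order, the subset condition, zero, sums and scalar
    multiples.\<close>
  proof (rule left_module_submodule[OF jet1_module[OF N]], goal_cases)
    case 2
    show ?case
      using add_hom_zero[OF JN.abelian_group_axioms F1.abelian_group_axioms h1]
        add_hom_zero[OF JN.abelian_group_axioms F2.abelian_group_axioms h2] by simp
  next
    case (3 x y)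
    then show ?case by (simp add: add_hom_add[OF h1] add_hom_add[OF h2] del: One_nat_def)
  next
    case (4 b x)
    then have b: "b \<in> carrier A" and x: "x \<in> carrier (jet1 K A \<Omega> N)" by auto
    have b0: "b \<in> grade \<Omega> 0" using b by (simp add: carrier_A)
    note lx = add_hom_closed[OF lh x]
    have "wedge 0 1 M b \<zero>\<^bsub>?F1\<^esub> = \<zero>\<^bsub>?F1\<^esub>" "wedge 0 2 M b \<zero>\<^bsub>?F2\<^esub> = \<zero>\<^bsub>?F2\<^esub>"
      "wedge 1 1 M (diff \<Omega> b) \<zero>\<^bsub>?F1\<^esub> = \<zero>\<^bsub>?F2\<^esub>"
      using add_hom_zero[OF F1.abelian_group_axioms F1.abelian_group_axioms wedge_hom[OF M b0, of 1, unfolded add_0]]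
        add_hom_zero[OF F2.abelian_group_axioms F2.abelian_group_axioms wedge_hom[OF M b0, of 2, unfolded add_0]]
        add_hom_zero[OF F1.abelian_group_axioms F2.abelian_group_axioms
          wedge_hom[OF M diff_A[OF b], of 1, unfolded one_add_one]] .
    then show ?case
      using 4 left_module.lsmult_closed[OF jet1_module[OF N] b x]
      by (simp add: left_linear_smult[OF lin b x] D_I_smult[OF M b lx] D_II_smult[OF M b lx] del: One_nat_def)
  qed blast
qed

text \<open>The recursion refers to the two preceding levels and to the inclusion joining them, so
  the induction carries two modules and the linearity of that inclusion.\<close>

lemma jets_module:
  assumes E: "left_module A E"
  shows "left_module A (jets K A \<Omega> E n)
    \<and> left_module A (jets K A \<Omega> E (Suc n))
    \<and> jet_incl K A \<Omega> E (Suc n) \<in> left_linear A (jets K A \<Omega> E (Suc n)) (jet1 K A \<Omega> (jets K A \<Omega> E n))"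
proof (induction n)
  case 0
  have J0: "left_module A (jets K A \<Omega> E 0)"
    using left_module_transport[OF E, of Base] by (simp add: inj_on_def)
  moreover have J1: "left_module A (jets K A \<Omega> E (Suc 0))"
    using jet1_module[OF J0] by simp
  moreover have "jet_incl K A \<Omega> E (Suc 0) \<in> left_linear A (jets K A \<Omega> E (Suc 0)) (jet1 K A \<Omega> (jets K A \<Omega> E 0))"
    \<comment> \<open>At level 1 nothing is cut out: the inclusion is the identity of J^1, treated
      as the inclusion of the full carrier.\<close>
    using left_linear_inclusion[where R = A and M = "jet1 K A \<Omega> (jets K A \<Omega> E 0)"
        and H = "carrier (jet1 K A \<Omega> (jets K A \<Omega> E 0))"]
      jet1_module[OF J0] by (simp add: jet_incl_def)
  ultimately show ?case by blast
next
  case (Suc n)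
  then have M: "left_module A (jets K A \<Omega> E n)" and N: "left_module A (jets K A \<Omega> E (Suc n))"
    and l: "jet_incl K A \<Omega> E (Suc n) \<in> left_linear A (jets K A \<Omega> E (Suc n)) (jet1 K A \<Omega> (jets K A \<Omega> E n))"
    by blast+
  note sub = holonomic_submodule[OF M N l]
  have "jet_incl K A \<Omega> E (Suc (Suc n))
      \<in> left_linear A (jets K A \<Omega> E (Suc (Suc n))) (jet1 K A \<Omega> (jets K A \<Omega> E (Suc n)))"
    unfolding jet_incl_def[of K A \<Omega> E "Suc (Suc n)"] jets_Suc_Suc
    using left_linear_inclusion[OF sub] by (simp del: jets.simps One_nat_def)
  moreover have "left_module A (jets K A \<Omega> E (Suc (Suc n)))"
    unfolding jets_Suc_Suc by (rule sub)
  ultimately show ?case using N by blast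
qed

text \<open>By naturality of \<open>\<pi>\<close>, both terms of \<open>D_I_eq\<close> evaluate to \<open>jet1_form M (l (C x))\<close>.\<close>

lemma D_I_connection_zero:
  assumes M: "left_module A M" and N: "left_module A N"
    and l: "l \<in> left_linear A N (jet1 K A \<Omega> M)" and C: "C \<in> left_linear A M N"
    and proj_C: "\<And>x. x \<in> carrier M \<Longrightarrow> jet1_proj K A \<Omega> M (l (C x)) = x" and x: "x \<in> carrier M"
  shows "D_I K A \<Omega> M (jet1_map K A \<Omega> N (jet1 K A \<Omega> M) l (jet1_map K A \<Omega> M N C (l (C x))))
    = \<zero>\<^bsub>forms_in A \<Omega> 1 M\<^esub>"
proof -
  let ?J = "jet1 K A \<Omega> M" and ?F = "forms_in A \<Omega> 1 M"
  interpret F: abelian_group ?F by (rule forms_in_group[OF M])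
  note J = jet1_module[OF M]
  note lC = left_linear_comp[OF C l]
  note p = jet1_proj_linear[OF M]
  have z: "l (C x) \<in> carrier ?J" by (rule add_hom_closed[OF left_linear_hom[OF lC] x])
  \<comment> \<open>Fusing J^1(l) and J^1(C) into J^1(l C) brings in the section l C of \<pi>, to
    which naturality and functoriality apply.\<close>
  have comp: "jet1_map K A \<Omega> N ?J l (jet1_map K A \<Omega> M N C (l (C x))) = jet1_map K A \<Omega> M ?J (\<lambda>x. l (C x)) (l (C x))"
    by (rule jet1_map_comp[OF M N J C l z])
  have "jet1_proj K A \<Omega> ?J (jet1_map K A \<Omega> M ?J (\<lambda>x. l (C x)) (l (C x))) = l (C x)"
    by (simp add: jet1_proj_natural[OF M J lC z] proj_C[OF x])
  \<comment> \<open>Here J^1(\<pi>) J^1(l C) = J^1(\<pi> l C), and \<pi> l C is the identity on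
    M.\<close>
  moreover have "jet1_map K A \<Omega> ?J M (jet1_proj K A \<Omega> M) (jet1_map K A \<Omega> M ?J (\<lambda>x. l (C x)) (l (C x))) = l (C x)"
    unfolding jet1_map_comp[OF M J M lC p z]
    by (rule jet1_map_id[OF M left_linear_comp[OF lC p] proj_C z])
  ultimately show ?thesis
    using add_hom_closed[OF jet1_form_hom[OF M] z]
    by (simp add: comp D_I_eq[OF M add_hom_closed[OF jet1_map_hom[OF M J lC] z]] a_minus_def F.r_neg
        del: One_nat_def)
qed

end

theorem proposition4p9:
  fixes K :: "'k ring" and A :: "('k, 'w) module" and \<Omega> :: "('k, 'w) dga"
    and E :: "('w, 'e) module" and n :: nat
    and C :: "('w, 'e) jet \<Rightarrow> ('w, 'e) jet"
  assumes "exterior_algebra K A \<Omega>"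
    and "left_module A E"
    and "n \<ge> 1"
    and "n_connection K A \<Omega> E n C"
  shows "(\<forall>x\<in>carrier (jets K A \<Omega> E (n - 1)).
            curvature K A \<Omega> E n C x = \<zero>\<^bsub>forms_in A \<Omega> 2 (jets K A \<Omega> E (n - 1))\<^esub>)
     \<longleftrightarrow> (jet1_map K A \<Omega> (jets K A \<Omega> E (n - 1)) (jets K A \<Omega> E n) C
            \<circ> jet_incl K A \<Omega> E n \<circ> C) ` carrier (jets K A \<Omega> E (n - 1))
          \<subseteq> carrier (jets K A \<Omega> E (n + 1))"
proof -
  interpret exterior_algebra K A \<Omega> by fact
  \<comment> \<open>With n = Suc m the indices n - 1, n and n + 1 become m, \<open>Suc m\<close> and
    \<open>Suc (Suc m)\<close>, which matches the third equation of \<open>jets\<close>. For n = 0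
    the truncated difference n - 1 would be 0 as well.\<close>
  obtain m where n: "n = Suc m" using assms(3) by (cases n) auto
  let ?M = "jets K A \<Omega> E m" and ?N = "jets K A \<Omega> E (Suc m)"
  let ?l = "jet_incl K A \<Omega> E (Suc m)"
  let ?z = "\<lambda>x. jet1_map K A \<Omega> ?M ?N C (?l (C x))"
  let ?y = "\<lambda>x. jet1_map K A \<Omega> ?N (jet1 K A \<Omega> ?M) ?l (?z x)"
  have M: "left_module A ?M" and N: "left_module A ?N" and l: "?l \<in> left_linear A ?N (jet1 K A \<Omega> ?M)"
    using jets_module[OF assms(2), of m] by blast+
  have C: "C \<in> left_linear A ?M ?N"
    and proj_C: "\<And>x. x \<in> carrier ?M \<Longrightarrow> jet1_proj K A \<Omega> ?M (?l (C x)) = x"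
    using assms(4) by (simp_all add: n_connection_def n jet_proj_def)
  interpret F: abelian_group "forms_in A \<Omega> 2 ?M" by (rule forms_in_group[OF M])
  have z: "?z x \<in> carrier (jet1 K A \<Omega> ?N)" if "x \<in> carrier ?M" for x
    using add_hom_closed[OF add_hom_comp[OF left_linear_hom[OF left_linear_comp[OF C l]]
          jet1_map_hom[OF M N C]] that] .
  have y: "?y x \<in> carrier (jet1 K A \<Omega> (jet1 K A \<Omega> ?M))" if "x \<in> carrier ?M" for x
    by (rule add_hom_closed[OF jet1_map_hom[OF N jet1_module[OF M] l] z[OF that]])
  have "curvature K A \<Omega> E n C x = \<zero>\<^bsub>forms_in A \<Omega> 2 ?M\<^esub> \<longleftrightarrow> D_II K A \<Omega> ?M (?y x) = \<zero>\<^bsub>forms_in A \<Omega> 2 ?M\<^esub>"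
    if x: "x \<in> carrier ?M" for x
  proof -
    have "curvature K A \<Omega> E n C x = \<ominus>\<^bsub>forms_in A \<Omega> 2 ?M\<^esub> D_II K A \<Omega> ?M (?y x)"
      by (simp add: curvature_def n del: jets.simps)
    then show ?thesis
      using F.add.inv_eq_1_iff[OF add_hom_closed[OF D_II_hom[OF M] y[OF x]]] by simp
  qed
  \<comment> \<open>Besides the condition on \<open>D_II\<close>, membership asks that
    \<open>?z x\<close> be a 1-jet over \<open>?N\<close>, which is the fact \<open>z\<close>, and
    that its \<open>D_I\<close> condition hold, which is \<open>D_I_connection_zero\<close>.\<close>
  moreover have "?z x \<in> carrier (jets K A \<Omega> E (Suc (Suc m))) \<longleftrightarrow> D_II K A \<Omega> ?M (?y x) = \<zero>\<^bsub>forms_in A \<Omega> 2 ?M\<^esub>"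
    if x: "x \<in> carrier ?M" for x
    unfolding jets_Suc_Suc
    using z[OF x] D_I_connection_zero[OF M N l C proj_C x] by (simp del: jets.simps)
  ultimately show ?thesis
    by (simp add: n image_subset_iff del: jets.simps)
qed

end
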